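(* Let $\alpha>0$ and $h_0=\frac1{4\pi}$, so that $\mathcal G_{h_0}f=\Delta_{\mathbb S^2}\big(f+\frac1{4\pi}\mathcal Uf\big)$ on mean-zero functions on $\mathbb S^2$. The eigenvalues of $\mathcal G_{h_0}$ are $\lambda_k=-k(k+1)$ for $k\ge1$, $k\ne2$, with the spherical harmonics $Y_{k,\ell}$ of degree $k$ as corresponding eigenfunctions, and $-6+\frac{4\alpha}5$, with the spherical harmonics of degree $2$ as corresponding eigenfunctions. In particular, $\mathcal G_{h_0}$ has a positive eigenvalue if and only if $\alpha>7.5$.
   Context: $\mathbb S^2$ is the unit sphere, $\Delta_{\mathbb S^2}$ its Laplace--Beltrami operator, and $\mathcal Uf(\mathbf m)=\alpha\int_{\mathbb S^2}|\mathbf m\times\mathbf m'|^2f(\mathbf m')d\mathbf m'$. In general, for a critical point $h$, $\mathcal G_hf=\mathcal R\cdot(\mathcal Rf+h\mathcal R\,\mathcal Uf+f\mathcal R\,\mathcal Uh)$ with $\mathcal R=\mathbf m\times\nabla_{\mathbf m}$; $\mathcal G_{h_0}$ is the case $h=h_0$. The operator is considered on mean-zero functions, with domain $\{f\in H^2(\mathbb S^2):\int_{\mathbb S^2}f\,d\mathbf m=0\}$. *)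

theory Defs
  imports "HOL-Analysis.Analysis" "HOL-Computational_Algebra.Polynomial"
begin

text \<open>
  Functions on the sphere are represented by functions on \<^typ>\<open>real^3\<close>; only their values on
  \<^term>\<open>sphere 0 1 :: (real^3) set\<close> matter. They are complex valued, so that eigenvalues
  range over the complex numbers.
\<close>

text \<open>
  Surface measure: the measure of a set of unit vectors is three times the Lebesgue measure of the
  part of the unit ball lying over it (polar coordinates; the total mass is \<open>4\<pi>\<close>). Here
  \<^term>\<open>sgn x\<close> is \<open>x / \<bar>x\<bar>\<close>.
\<close>

definition sphere_measure :: "(real^3) measure" where
  "sphere_measure =
     scale_measure 3
       (distr (restrict_space lborel (ball 0 1 - {0})) (restrict_space borel (sphere 0 1)) sgn)"

definition sphere_integral :: "(real^3 \<Rightarrow> complex) \<Rightarrow> complex" where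
  "sphere_integral f = integral\<^sup>L sphere_measure f"

definition L2_sphere :: "(real^3 \<Rightarrow> complex) set" where
  "L2_sphere = {f \<in> borel_measurable sphere_measure.
                  integrable sphere_measure (\<lambda>m. (norm (f m))\<^sup>2)}"

definition partial :: "3 \<Rightarrow> (real^3 \<Rightarrow> complex) \<Rightarrow> real^3 \<Rightarrow> complex" where
  "partial i f x = frechet_derivative f (at x) (axis i 1)"

primrec Ck :: "nat \<Rightarrow> (real^3 \<Rightarrow> complex) \<Rightarrow> bool" where
  "Ck 0 f \<longleftrightarrow> continuous_on UNIV f"
| "Ck (Suc k) f \<longleftrightarrow> f differentiable_on UNIV \<and> (\<forall>i. Ck k (partial i f))"

definition smooth :: "(real^3 \<Rightarrow> complex) \<Rightarrow> bool" where
  "smooth f \<longleftrightarrow> (\<forall>k. Ck k f)"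

text \<open>
  The \<open>i\<close>-th component of \<open>m \<times> \<nabla>\<phi>\<close>, written as a directional derivative by
  \<open>e\<^sub>i \<bullet> (m \<times> \<nabla>\<phi>) = \<nabla>\<phi> \<bullet> (e\<^sub>i \<times> m)\<close>. Since \<open>e\<^sub>i \<times> m\<close> is tangent to
  the sphere at \<open>m\<close>, the result on the sphere depends only on \<open>\<phi>\<close> on the sphere.
\<close>

definition rot_smooth :: "3 \<Rightarrow> (real^3 \<Rightarrow> complex) \<Rightarrow> real^3 \<Rightarrow> complex" where
  "rot_smooth i \<phi> m = frechet_derivative \<phi> (at m) (cross3 (axis i 1) m)"

text \<open>
  Laplace--Beltrami operator on smooth functions: the Euclidean Laplacian of the extension that is
  constant along rays.
\<close>

definition laplace_beltrami_smooth :: "(real^3 \<Rightarrow> complex) \<Rightarrow> real^3 \<Rightarrow> complex" where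
  "laplace_beltrami_smooth \<phi> m = (\<Sum>i\<in>UNIV. partial i (partial i (\<lambda>x. \<phi> (sgn x))) m)"

text \<open>
  Weak forms. Every smooth function on the sphere is the restriction of one on \<^typ>\<open>real^3\<close>, so
  the test functions below are exactly the smooth functions on the sphere. The fields
  \<open>e\<^sub>i \<times> m\<close> are divergence free, hence no zero-order term in the integration by parts.
\<close>

definition has_weak_rot :: "3 \<Rightarrow> (real^3 \<Rightarrow> complex) \<Rightarrow> (real^3 \<Rightarrow> complex) \<Rightarrow> bool" where
  "has_weak_rot i f g \<longleftrightarrow> f \<in> L2_sphere \<and> g \<in> L2_sphere \<and>
     (\<forall>\<phi>. smooth \<phi> \<longrightarrow>
        sphere_integral (\<lambda>m. g m * \<phi> m) = - sphere_integral (\<lambda>m. f m * rot_smooth i \<phi> m))"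

definition has_weak_laplacian :: "(real^3 \<Rightarrow> complex) \<Rightarrow> (real^3 \<Rightarrow> complex) \<Rightarrow> bool" where
  "has_weak_laplacian f g \<longleftrightarrow> f \<in> L2_sphere \<and> g \<in> L2_sphere \<and>
     (\<forall>\<phi>. smooth \<phi> \<longrightarrow>
        sphere_integral (\<lambda>m. g m * \<phi> m)
          = sphere_integral (\<lambda>m. f m * laplace_beltrami_smooth \<phi> m))"

text \<open>
  The weak derivative, determined up to null sets where it exists.
\<close>

definition rot :: "3 \<Rightarrow> (real^3 \<Rightarrow> complex) \<Rightarrow> real^3 \<Rightarrow> complex" where
  "rot i f = (SOME g. has_weak_rot i f g)"

text \<open>
  The fields \<open>e\<^sub>i \<times> m\<close> span the tangent space at every \<open>m\<close>, so the following are the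
  Sobolev spaces \<open>H\<^sup>k\<close> of the sphere.
\<close>

primrec sobolev_sphere :: "nat \<Rightarrow> (real^3 \<Rightarrow> complex) set" where
  "sobolev_sphere 0 = L2_sphere"
| "sobolev_sphere (Suc k) =
     {f \<in> L2_sphere. \<forall>i. \<exists>g \<in> sobolev_sphere k. has_weak_rot i f g}"

definition domG :: "(real^3 \<Rightarrow> complex) set" where
  "domG = {f \<in> sobolev_sphere 2. sphere_integral f = 0}"

definition U :: "real \<Rightarrow> (real^3 \<Rightarrow> complex) \<Rightarrow> real^3 \<Rightarrow> complex" where
  "U \<alpha> f m = of_real \<alpha> * sphere_integral (\<lambda>m'. of_real ((norm (cross3 m m'))\<^sup>2) * f m')"

definition G :: "real \<Rightarrow> (real^3 \<Rightarrow> complex) \<Rightarrow> (real^3 \<Rightarrow> complex) \<Rightarrow> real^3 \<Rightarrow> complex" where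
  "G \<alpha> h f m =
     (\<Sum>i\<in>UNIV. rot i (\<lambda>m. rot i f m + h m * rot i (U \<alpha> f) m + f m * rot i (U \<alpha> h) m) m)"

definition h0 :: "real^3 \<Rightarrow> complex" where
  "h0 = (\<lambda>m. of_real (1 / (4 * pi)))"

definition ae_eq :: "(real^3 \<Rightarrow> complex) \<Rightarrow> (real^3 \<Rightarrow> complex) \<Rightarrow> bool" where
  "ae_eq f g \<longleftrightarrow> (AE m in sphere_measure. f m = g m)"

definition eigenfunction ::
  "((real^3 \<Rightarrow> complex) \<Rightarrow> real^3 \<Rightarrow> complex) \<Rightarrow> (real^3 \<Rightarrow> complex) set \<Rightarrow> complex
     \<Rightarrow> (real^3 \<Rightarrow> complex) \<Rightarrow> bool" where
  "eigenfunction T D \<mu> f \<longleftrightarrow> f \<in> D \<and> \<not> ae_eq f (\<lambda>m. 0) \<and> ae_eq (T f) (\<lambda>m. \<mu> * f m)"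

definition eigenvalue ::
  "((real^3 \<Rightarrow> complex) \<Rightarrow> real^3 \<Rightarrow> complex) \<Rightarrow> (real^3 \<Rightarrow> complex) set \<Rightarrow> complex \<Rightarrow> bool" where
  "eigenvalue T D \<mu> \<longleftrightarrow> (\<exists>f. eigenfunction T D \<mu> f)"

text \<open>
  Rodrigues' formula.
\<close>

definition legendre :: "nat \<Rightarrow> real poly" where
  "legendre k = smult (1 / (2 ^ k * fact k)) ((pderiv ^^ k) ([:-1, 0, 1:] ^ k))"

text \<open>
  The orthonormal spherical harmonic of degree \<open>k\<close> and order \<open>l\<close>, \<open>\<bar>l\<bar> \<le> k\<close>, with
  Condon--Shortley phase. For \<open>l \<ge> 0\<close> it is
  \<open>N P\<^sub>k\<^sup>l (cos \<theta>) exp (\<i> l \<phi>)\<close>, where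
  \<open>P\<^sub>k\<^sup>l (z) = (-1)\<^sup>l (1 - z\<^sup>2)\<^bsup>l/2\<^esup> (d/dz)\<^sup>l P\<^sub>k (z)\<close>; in Cartesian coordinates
  \<open>sin\<^sup>l \<theta> exp (\<i> l \<phi>) = (x + \<i> y)\<^sup>l\<close> on the sphere. For negative order it is
  \<open>Y k (- l) = (-1)\<^sup>l cnj (Y k l)\<close>.
\<close>

definition Y :: "nat \<Rightarrow> int \<Rightarrow> real^3 \<Rightarrow> complex" where
  "Y k l m =
     (let j = nat \<bar>l\<bar> in
        of_real (sqrt ((2 * real k + 1) / (4 * pi) * (fact (k - j) / fact (k + j)))
                 * poly ((pderiv ^^ j) (legendre k)) (m $ 3))
        * (if l \<ge> 0 then (-1) ^ j * Complex (m $ 1) (m $ 2) ^ j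
           else Complex (m $ 1) (- (m $ 2)) ^ j))"

text \<open>
  The eigenvalue belonging to degree \<open>k\<close>. It is injective in \<open>k \<ge> 1\<close> except for \<open>\<alpha> = 5\<close>
  (among positive \<open>\<alpha>\<close>), where degrees 1 and 2 share the eigenvalue \<open>-2\<close>; so every value is attained
  by finitely many degrees only.
\<close>

definition eig :: "real \<Rightarrow> nat \<Rightarrow> real" where
  "eig \<alpha> k = (if k = 2 then - 6 + 4 * \<alpha> / 5 else - (real k * (real k + 1)))"

end

theory Submission
  imports Defs
begin

text \<open>
  Write \<open>R\<^sub>i\<close> for the derivative along the field \<open>e\<^sub>i \<times> m\<close>. These three fields generate the rotations of
  the sphere, so each \<open>R\<^sub>i\<close> is antisymmetric for the pairing \<open>\<integral> f g\<close>, and the sum of their squares (the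
  Casimir operator) is the Laplace--Beltrami operator. The uniform state \<open>h\<^sub>0\<close> is rotation invariant, so
  the term of the operator that differentiates \<open>U h\<^sub>0\<close> vanishes, and in weak form \<open>G\<close> maps \<open>f\<close> to the
  Laplacian of \<open>f + U f / (4\<pi>)\<close>.

  Both ingredients are diagonal in the spherical harmonics. The Casimir operator is a sum of squares of
  derivations, so its value on \<open>(x \<plusminus> \<i> y)\<^sup>j q(z)\<close> follows from the product rule, and for \<open>q\<close> a derivative
  of a Legendre polynomial the Legendre equation makes it \<open>- k (k + 1)\<close> times the function.
  Up to the factor \<open>\<alpha>\<close> the kernel of \<open>U\<close> is \<open>1 - (m \<bullet> m')\<^sup>2\<close> on the sphere, so for \<open>f\<close> of mean zero \<open>U f\<close> depends only on the second
  moments of \<open>f\<close>. They vanish for a harmonic of degree \<open>k \<noteq> 2\<close>, because quadratic forms without trace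
  are eigenfunctions of the Laplacian for another eigenvalue, \<open>- 6\<close>. For degree 2 the fourth moments
  of the sphere give \<open>U Y = - (8\<pi>/15) \<alpha> Y\<close>, whence \<open>- 6 (1 - 2\<alpha>/15) = - 6 + 4\<alpha>/5\<close>.

  Testing \<open>G f\<close> against a harmonic therefore multiplies the corresponding coefficient of \<open>f\<close> by \<open>eig \<alpha> k\<close>
  (\<open>G_coefficient\<close>). The harmonics separate square integrable functions (\<open>Y_complete\<close>): every polynomial
  restricted to the sphere is a combination of them, and polynomials are dense by Stone--Weierstrass.
  So \<open>G f = \<mu> f\<close> holds exactly if every coefficient of \<open>f\<close> with \<open>eig \<alpha> k \<noteq> \<mu>\<close> vanishes
  (\<open>G_eigen_iff_coefficients\<close>), which by orthogonality means that \<open>f\<close> is a combination of the harmonics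
  with \<open>eig \<alpha> k = \<mu>\<close> (\<open>G_eigenspace\<close>). All assertions about eigenvalues are read off from this.

  Coefficients are taken with respect to the bilinear pairing \<open>\<integral> f g\<close>, without complex conjugation; the
  partner of order \<open>l\<close> is then order \<open>- l\<close>, and the expansion coefficient of \<open>f\<close> is its pairing with this
  partner divided by the nonzero pairing of the two partners.
\<close>

section \<open>The surface measure\<close>

lemma space_sphere_measure [simp]: "space sphere_measure = sphere 0 1"
  by (simp add: sphere_measure_def space_restrict_space space_scale_measure)

lemma sets_sphere_measure: "sets sphere_measure = sets (restrict_space borel (sphere 0 1))"
  by (simp add: sphere_measure_def)

lemma borel_measurable_sphere_measure:
  "borel_measurable sphere_measure = borel_measurable (restrict_space borel (sphere 0 1))"
  by (rule measurable_cong_sets[OF sets_sphere_measure refl])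

lemma continuous_borel_measurable_sphere:
  fixes f :: "real^3 \<Rightarrow> 'b::topological_space"
  assumes "continuous_on (sphere 0 1) f"
  shows "f \<in> borel_measurable sphere_measure"
  unfolding borel_measurable_sphere_measure
  by (rule borel_measurable_continuous_on_restrict[OF assms])

lemma in_sets_sphere_measure:
  "A \<in> sets sphere_measure \<longleftrightarrow> A \<subseteq> sphere 0 1 \<and> A \<in> sets borel"
  unfolding sets_sphere_measure by (subst sets_restrict_space_iff) auto

lemma sgn_measurable_ball_sphere:
  "sgn \<in> measurable (restrict_space lborel (ball 0 1 - {0::real^3})) (restrict_space borel (sphere 0 1))"
proof (rule measurable_restrict_space2)
  show "sgn \<in> space (restrict_space lborel (ball 0 1 - {0::real^3})) \<rightarrow> sphere 0 1"
    by (auto simp: space_restrict_space norm_sgn)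
  have "sgn \<in> borel_measurable (restrict_space borel (ball 0 1 - {0::real^3}))"
    by (rule borel_measurable_continuous_on_restrict)
       (auto intro!: continuous_on_sgn continuous_on_id)
  then show "sgn \<in> borel_measurable (restrict_space lborel (ball 0 1 - {0::real^3}))"
    by (subst measurable_cong_sets[OF _ refl, of _ "restrict_space borel (ball 0 1 - {0})"])
       (auto simp: sets_restrict_space)
qed

text \<open>
  The total mass, the positivity on open sets and the rotation invariance are all obtained from this
  formula, as statements about the volume of the cone over a set.
\<close>

lemma emeasure_sphere_measure:
  assumes "A \<in> sets sphere_measure"
  shows "emeasure sphere_measure A = 3 * emeasure lborel {x \<in> ball 0 1 - {0}. sgn x \<in> A}"
    and "{x \<in> ball 0 1 - {0}. sgn x \<in> A} \<in> sets borel"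
proof -
  let ?B = "ball 0 1 - {0::real^3}"
  have A: "A \<in> sets (restrict_space borel (sphere 0 1))"
    using assms by (simp add: sets_sphere_measure)
  have eq: "sgn -` A \<inter> space (restrict_space lborel ?B) = {x \<in> ?B. sgn x \<in> A}"
    by (auto simp: space_restrict_space)
  have "sgn -` A \<inter> space (restrict_space lborel ?B) \<in> sets (restrict_space lborel ?B)"
    by (rule measurable_sets[OF sgn_measurable_ball_sphere A])
  then show "{x \<in> ?B. sgn x \<in> A} \<in> sets borel"
    unfolding eq by (subst (asm) sets_restrict_space_iff) auto
  show "emeasure sphere_measure A = 3 * emeasure lborel {x \<in> ?B. sgn x \<in> A}"
    unfolding sphere_measure_def emeasure_scale_measure
      emeasure_distr[OF sgn_measurable_ball_sphere A] eq
    by (subst emeasure_restrict_space) auto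
qed

lemma emeasure_sphere_measure_space: "emeasure sphere_measure (sphere 0 1) = ennreal (4 * pi)"
proof -
  have *: "sphere 0 1 \<in> sets sphere_measure"
    by (simp add: in_sets_sphere_measure)
  have eq: "{x \<in> ball 0 1 - {0::real^3}. sgn x \<in> sphere 0 1} = ball 0 1 - {0}"
    by (auto simp: norm_sgn)
  have "emeasure lborel (ball 0 1 - {0::real^3}) = emeasure lborel (ball (0::real^3) 1)"
    by (subst emeasure_Diff) auto
  also have "\<dots> = ennreal (4 / 3 * pi)"
    by (simp add: emeasure_ball unit_ball_vol_3)
  finally show ?thesis
    unfolding emeasure_sphere_measure(1)[OF *] eq
    using ennreal_mult[of 3 "4 / 3 * pi"] by simp
qed

interpretation sphere: finite_measure sphere_measure
  by standard (simp add: emeasure_sphere_measure_space)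

lemma measure_sphere_measure: "measure sphere_measure (sphere 0 1) = 4 * pi"
  by (simp add: measure_def emeasure_sphere_measure_space)

text \<open>
  The cone over a nonempty relatively open set is a nonempty open subset of the ball. Consequently a
  continuous function that vanishes almost everywhere on the sphere vanishes everywhere on it.
\<close>

lemma emeasure_sphere_measure_open_pos:
  assumes "open V" "V \<inter> sphere 0 1 \<noteq> {}"
  shows "emeasure sphere_measure (V \<inter> sphere 0 1) \<noteq> 0"
proof -
  let ?W = "{x \<in> ball 0 1 - {0::real^3}. sgn x \<in> V \<inter> sphere 0 1}"
  have *: "V \<inter> sphere 0 1 \<in> sets sphere_measure"
    using assms by (auto simp: in_sets_sphere_measure)
  have eq: "?W = (ball 0 1 - {0}) \<inter> sgn -` V"
    by (auto simp: norm_sgn)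
  have "open ?W"
    unfolding eq using assms(1)
    by (intro continuous_open_preimage) (auto intro!: continuous_on_sgn continuous_on_id)
  moreover obtain v where v: "v \<in> V" "norm v = 1" using assms by auto
  \<comment> \<open>The point \<open>v\<close> itself is not in the open ball.\<close>
  have "(1/2) *\<^sub>R v \<in> ?W"
    using v by (auto simp: sgn_div_norm)
  then have "?W \<noteq> {}" by blast
  ultimately have "emeasure lborel ?W \<noteq> 0"
    using open_not_negligible[of ?W] emeasure_sphere_measure(2)[OF *]
    unfolding negligible_iff_null_sets null_sets_def by force
  then show ?thesis
    by (simp add: emeasure_sphere_measure(1)[OF *])
qed

text \<open>
  The preimage is the image under the inverse map, which is orthogonal again, and orthogonal images of
  Lebesgue measurable sets keep their volume; the completed measure agrees with the Borel one here.
\<close>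

lemma orthogonal_transformation_emeasure_vimage:
  fixes T :: "real^3 \<Rightarrow> real^3"
  assumes T: "orthogonal_transformation T" and W: "W \<in> sets borel" "bounded W"
  shows "emeasure lborel (T -` W) = emeasure lborel W"
proof -
  let ?S = "inv T"
  have bij: "bij T" using orthogonal_transformation_bij[OF T] .
  have S: "orthogonal_transformation ?S" by (rule orthogonal_transformation_inv[OF T])
  have eq: "T -` W = ?S ` W" by (rule bij_vimage_eq_inv_image[OF bij])
  have W': "W \<in> lmeasurable"
    by (rule bounded_set_imp_lmeasurable[OF W(2)]) (use W(1) in auto)
  have T': "?S ` W \<in> lmeasurable"
    using measurable_orthogonal_image[OF S W'] .
  have m: "measure lebesgue (?S ` W) = measure lebesgue W"
    by (rule measure_orthogonal_image[OF S W'])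
  have "T \<in> borel_measurable borel"
    using orthogonal_transformation_linear[OF T]
    by (intro borel_measurable_continuous_onI linear_continuous_on linear_conv_bounded_linear[THEN iffD1])
  then have "T -` W \<in> sets borel"
    using measurable_sets[of T borel borel W] W(1) by simp
  then have "emeasure lborel (T -` W) = emeasure lebesgue (T -` W)"
    by (subst emeasure_completion) (simp_all add: main_part_sets)
  also have "\<dots> = ennreal (measure lebesgue (?S ` W))"
    unfolding eq by (rule emeasure_eq_measure2[OF T'])
  also have "\<dots> = emeasure lebesgue W"
    unfolding m by (rule emeasure_eq_measure2[OF W', symmetric])
  also have "\<dots> = emeasure lborel W"
    using W(1) by (subst emeasure_completion) (simp_all add: main_part_sets)
  finally show ?thesis .
qed

lemma orthogonal_transformation_measurable_sphere:
  fixes T :: "real^3 \<Rightarrow> real^3"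
  assumes T: "orthogonal_transformation T"
  shows "T \<in> measurable sphere_measure sphere_measure"
proof -
  have "continuous_on (sphere 0 1) T"
    using orthogonal_transformation_linear[OF T]
    by (simp add: linear_continuous_on linear_conv_bounded_linear)
  then have "T \<in> borel_measurable sphere_measure"
    by (rule continuous_borel_measurable_sphere)
  moreover have "T \<in> space sphere_measure \<rightarrow> sphere 0 1"
    using T by (auto simp: orthogonal_transformation)
  ultimately have "T \<in> measurable sphere_measure (restrict_space borel (sphere 0 1))"
    by (intro measurable_restrict_space2)
  then show ?thesis
    by (subst measurable_cong_sets[OF refl sets_sphere_measure])
qed

text \<open>
  An orthogonal map commutes with \<open>x \<mapsto> x / \<bar>x\<bar>\<close>, so the cone over a preimage is the preimage of the cone.
\<close>

lemma sphere_measure_rotation_invariant: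
  fixes T :: "real^3 \<Rightarrow> real^3"
  assumes T: "orthogonal_transformation T"
  shows "distr sphere_measure sphere_measure T = sphere_measure"
proof (rule measure_eqI)
  fix A assume "A \<in> sets (distr sphere_measure sphere_measure T)"
  then have A: "A \<in> sets sphere_measure" by simp
  note meas = orthogonal_transformation_measurable_sphere[OF T]
  let ?B = "ball 0 1 - {0::real^3}"
  let ?W = "{x \<in> ?B. sgn x \<in> A}"
  have A': "T -` A \<inter> space sphere_measure \<in> sets sphere_measure"
    by (rule measurable_sets[OF meas A])
  have nT: "norm (T x) = norm x" for x using T by (simp add: orthogonal_transformation)
  then have z: "T x = 0 \<longleftrightarrow> x = 0" for x by (metis norm_eq_zero)
  have s: "T (sgn x) = sgn (T x)" for x
    using orthogonal_transformation_linear[OF T] nT by (simp add: sgn_div_norm linear_cmul)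
  have "{x \<in> ?B. sgn x \<in> T -` A \<inter> space sphere_measure} = T -` ?W"
    by (auto simp: nT z s norm_sgn)
  moreover have "emeasure lborel (T -` ?W) = emeasure lborel ?W"
    by (rule orthogonal_transformation_emeasure_vimage[OF T emeasure_sphere_measure(2)[OF A]])
       (rule bounded_subset[OF bounded_ball[of 0 1]], auto)
  ultimately show "emeasure (distr sphere_measure sphere_measure T) A = emeasure sphere_measure A"
    unfolding emeasure_distr[OF meas A] emeasure_sphere_measure(1)[OF A] emeasure_sphere_measure(1)[OF A']
    by simp
qed simp

lemma sphere_integral_rotation:
  fixes T :: "real^3 \<Rightarrow> real^3"
  assumes T: "orthogonal_transformation T" and f: "f \<in> borel_measurable sphere_measure"
  shows "sphere_integral (\<lambda>m. f (T m)) = sphere_integral f"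
  unfolding sphere_integral_def
  using integral_distr[OF orthogonal_transformation_measurable_sphere[OF T] f]
  by (simp add: sphere_measure_rotation_invariant[OF T])

section \<open>Smooth functions and the rotational derivatives\<close>

lemma partial_eqI: "(f has_derivative D) (at x) \<Longrightarrow> partial i f x = D (axis i 1)"
  unfolding partial_def using frechet_derivative_at by metis

lemma rot_smooth_eqI: "(f has_derivative D) (at m) \<Longrightarrow> rot_smooth i f m = D (cross3 (axis i 1) m)"
  unfolding rot_smooth_def using frechet_derivative_at by metis

lemma linear_axis_expansion:
  fixes l :: "real^3 \<Rightarrow> 'a::real_vector"
  assumes "linear l"
  shows "l v = (\<Sum>k\<in>UNIV. (v $ k) *\<^sub>R l (axis k 1))"
proof -
  interpret linear l by (rule assms)
  have "v = (\<Sum>k\<in>UNIV. (v $ k) *\<^sub>R axis k 1)"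
    by (simp add: vec_eq_iff axis_def if_distrib cong: if_cong)
  then have "l v = l (\<Sum>k\<in>UNIV. (v $ k) *\<^sub>R axis k 1)" by (rule arg_cong)
  then show ?thesis by (simp add: sum scale)
qed

lemma frechet_derivative_partial:
  assumes "f differentiable (at x)"
  shows "frechet_derivative f (at x) v = (\<Sum>k\<in>UNIV. of_real (v $ k) * partial k f x)"
  by (subst linear_axis_expansion[OF linear_frechet_derivative[OF assms]])
     (simp add: partial_def scaleR_conv_of_real)

lemma rot_smooth_partial:
  assumes "f differentiable (at m)"
  shows "rot_smooth i f m = (\<Sum>k\<in>UNIV. of_real (cross3 (axis i 1) m $ k) * partial k f m)"
  unfolding rot_smooth_def by (rule frechet_derivative_partial[OF assms])

lemma Ck_Suc_imp_Ck: "Ck (Suc k) f \<Longrightarrow> Ck k f"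
proof (induction k arbitrary: f)
  case 0
  then show ?case by (simp add: differentiable_imp_continuous_on)
next
  case (Suc k)
  then show ?case by (metis Ck.simps(2))
qed

lemma Ck_Suc_differentiable: "Ck (Suc k) f \<Longrightarrow> f differentiable (at x)"
  by (simp add: differentiable_on_def)

lemma Ck_const: "Ck k (\<lambda>x. c)"
proof (induction k arbitrary: c)
  case (Suc k)
  have "partial i (\<lambda>x. c) = (\<lambda>x. 0)" for i
    by (rule ext, subst partial_eqI[where D = "\<lambda>_. 0"]) (auto intro: derivative_eq_intros)
  with Suc show ?case by simp
qed simp

lemma Ck_add: "Ck k f \<Longrightarrow> Ck k g \<Longrightarrow> Ck k (\<lambda>x. f x + g x)"
proof (induction k arbitrary: f g)
  case 0
  then show ?case by (auto intro: continuous_intros)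
next
  case (Suc k)
  have "partial i (\<lambda>x. f x + g x) = (\<lambda>x. partial i f x + partial i g x)" for i
  proof
    fix x
    have "(f has_derivative frechet_derivative f (at x)) (at x)"
         "(g has_derivative frechet_derivative g (at x)) (at x)"
      using Suc.prems Ck_Suc_differentiable by (auto simp: frechet_derivative_works[symmetric])
    from has_derivative_add[OF this] show "partial i (\<lambda>x. f x + g x) x = partial i f x + partial i g x"
      by (subst partial_eqI) (auto simp: partial_def)
  qed
  with Suc show ?case by (simp add: differentiable_on_def)
qed

lemma Ck_mult: "Ck k f \<Longrightarrow> Ck k g \<Longrightarrow> Ck k (\<lambda>x. f x * g x)"
proof (induction k arbitrary: f g)
  case 0
  then show ?case by (auto intro: continuous_intros)
next
  case (Suc k)
  have "partial i (\<lambda>x. f x * g x) = (\<lambda>x. f x * partial i g x + partial i f x * g x)" for i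
  proof
    fix x
    have "(f has_derivative frechet_derivative f (at x)) (at x)"
         "(g has_derivative frechet_derivative g (at x)) (at x)"
      using Suc.prems Ck_Suc_differentiable by (auto simp: frechet_derivative_works[symmetric])
    from has_derivative_mult[OF this]
    show "partial i (\<lambda>x. f x * g x) x = f x * partial i g x + partial i f x * g x"
      by (subst partial_eqI) (auto simp: partial_def)
  qed
  moreover have "Ck k (\<lambda>x. f x * partial i g x + partial i f x * g x)" for i
    using Suc.prems Ck_Suc_imp_Ck by (intro Ck_add Suc.IH) auto
  ultimately show ?case using Suc.prems by (simp add: differentiable_on_def)
qed

lemma has_derivative_coordinate:
  "((\<lambda>x::real^3. complex_of_real (x $ j)) has_derivative (\<lambda>v. of_real (v $ j))) (at x)"
  by (intro bounded_linear_imp_has_derivative bounded_linear_compose[OF bounded_linear_of_real]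
      bounded_linear_vec_nth)

lemma Ck_coordinate: "Ck k (\<lambda>x. of_real (x $ j))"
proof (cases k)
  case 0
  then show ?thesis by (auto intro!: continuous_intros)
next
  case (Suc k)
  have "partial i (\<lambda>x. of_real (x $ j)) = (\<lambda>x. of_real (axis i 1 $ j))" for i
    by (rule ext, rule partial_eqI[OF has_derivative_coordinate])
  then show ?thesis
    using has_derivative_coordinate Suc
    by (simp add: Ck_const differentiable_on_def differentiable_def) blast
qed

lemma smooth_const [simp]: "smooth (\<lambda>x. c)"
  by (simp add: smooth_def Ck_const)

lemma smooth_add: "smooth f \<Longrightarrow> smooth g \<Longrightarrow> smooth (\<lambda>x. f x + g x)"
  by (simp add: smooth_def Ck_add)

lemma smooth_mult: "smooth f \<Longrightarrow> smooth g \<Longrightarrow> smooth (\<lambda>x. f x * g x)"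
  by (simp add: smooth_def Ck_mult)

lemma smooth_coordinate [simp]: "smooth (\<lambda>x. of_real (x $ j))"
  by (simp add: smooth_def Ck_coordinate)

lemma smooth_sum: "(\<And>k. k \<in> A \<Longrightarrow> smooth (f k)) \<Longrightarrow> smooth (\<lambda>x. \<Sum>k\<in>A. f k x)"
  by (induction A rule: infinite_finite_induct) (auto intro: smooth_add)

lemma smooth_linear:
  fixes l :: "real^3 \<Rightarrow> real"
  assumes "linear l"
  shows "smooth (\<lambda>m. of_real (l m))"
proof -
  have "(\<lambda>m. complex_of_real (l m)) = (\<lambda>m. \<Sum>k\<in>UNIV. of_real (m $ k) * of_real (l (axis k 1)))"
    by (rule ext, subst linear_axis_expansion[OF assms]) simp
  then show ?thesis
    by (rule ssubst[where P = smooth]) (intro smooth_sum smooth_mult smooth_const smooth_coordinate)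
qed

lemma smooth_differentiable: "smooth f \<Longrightarrow> f differentiable (at x)"
  unfolding smooth_def using Ck_Suc_differentiable by blast

lemma smooth_has_derivative: "smooth f \<Longrightarrow> (f has_derivative frechet_derivative f (at x)) (at x)"
  using smooth_differentiable frechet_derivative_works by blast

lemma smooth_partial: "smooth f \<Longrightarrow> smooth (partial i f)"
  unfolding smooth_def using Ck.simps(2) by blast

lemma smooth_continuous: "smooth f \<Longrightarrow> continuous_on A f"
  unfolding smooth_def using Ck.simps(1) continuous_on_subset by blast

lemma linear_cross_component: "linear (\<lambda>m. cross3 a m $ k)"
  by (intro linearI) (simp_all add: cross_add_right cross_mult_right)

lemma smooth_cross_component [simp]: "smooth (\<lambda>m. of_real (cross3 a m $ k))"
  by (rule smooth_linear[OF linear_cross_component])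

lemma smooth_rot_smooth:
  assumes "smooth f"
  shows "smooth (rot_smooth i f)"
proof -
  have "rot_smooth i f = (\<lambda>m. \<Sum>k\<in>UNIV. of_real (cross3 (axis i 1) m $ k) * partial k f m)"
    using rot_smooth_partial smooth_differentiable[OF assms] by blast
  then show ?thesis
    by (rule ssubst[where P = smooth]) (intro smooth_sum smooth_mult smooth_cross_component smooth_partial assms)
qed

lemma rot_smooth_const: "rot_smooth i (\<lambda>m. c) = (\<lambda>m. 0)"
  by (rule ext, subst rot_smooth_eqI[where D = "\<lambda>_. 0"]) (auto intro: derivative_eq_intros)

lemma rot_smooth_add:
  assumes "smooth f" "smooth g"
  shows "rot_smooth i (\<lambda>m. f m + g m) = (\<lambda>m. rot_smooth i f m + rot_smooth i g m)"
  using rot_smooth_eqI[OF has_derivative_add[OF assms[THEN smooth_has_derivative]]]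
  by (auto simp: rot_smooth_def)

lemma rot_smooth_mult:
  assumes "smooth f" "smooth g"
  shows "rot_smooth i (\<lambda>m. f m * g m) = (\<lambda>m. rot_smooth i f m * g m + f m * rot_smooth i g m)"
  using rot_smooth_eqI[OF has_derivative_mult[OF assms[THEN smooth_has_derivative]]]
  by (auto simp: rot_smooth_def)

lemma rot_smooth_cmult:
  assumes "smooth f"
  shows "rot_smooth i (\<lambda>m. c * f m) = (\<lambda>m. c * rot_smooth i f m)"
  by (subst rot_smooth_mult) (auto simp: assms rot_smooth_const)

lemma rot_smooth_sum:
  assumes "\<And>k. k \<in> A \<Longrightarrow> smooth (f k)"
  shows "rot_smooth i (\<lambda>m. \<Sum>k\<in>A. f k m) = (\<lambda>m. \<Sum>k\<in>A. rot_smooth i (f k) m)"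
  using assms
  by (induction A rule: infinite_finite_induct) (auto simp: rot_smooth_const rot_smooth_add smooth_sum)

lemma rot_smooth_coordinate:
  "rot_smooth i (\<lambda>m. of_real (m $ a)) = (\<lambda>m. of_real (cross3 (axis i 1) m $ a))"
  by (rule ext, rule rot_smooth_eqI[OF has_derivative_coordinate])

lemma cross_axis:
  fixes m :: "real^3"
  shows "cross3 (axis 1 1) m $ 1 = 0" "cross3 (axis 1 1) m $ 2 = - m $ 3" "cross3 (axis 1 1) m $ 3 = m $ 2"
    "cross3 (axis 2 1) m $ 1 = m $ 3" "cross3 (axis 2 1) m $ 2 = 0" "cross3 (axis 2 1) m $ 3 = - m $ 1"
    "cross3 (axis 3 1) m $ 1 = - m $ 2" "cross3 (axis 3 1) m $ 2 = m $ 1" "cross3 (axis 3 1) m $ 3 = 0"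
  by (simp_all add: cross_components axis_def)

section \<open>Integration by parts on the sphere\<close>

lemma continuous_bound_sphere:
  fixes g :: "real^3 \<Rightarrow> 'b::real_normed_vector"
  assumes "continuous_on (sphere 0 1) g"
  obtains B where "B \<ge> 0" "\<And>m. m \<in> sphere 0 1 \<Longrightarrow> norm (g m) \<le> B"
proof -
  have "compact (g ` sphere 0 1)"
    by (intro compact_continuous_image assms compact_sphere)
  then obtain B where B: "\<And>x. x \<in> sphere 0 1 \<Longrightarrow> norm (g x) \<le> B"
    using compact_imp_bounded bounded_iff by (metis imageI)
  have "axis 1 1 \<in> sphere (0::real^3) 1" by (simp add: norm_axis_1)
  from B[OF this] have "B \<ge> 0" using norm_ge_zero order_trans by blast
  with B that show ?thesis by blast
qed

lemma continuous_integrable_sphere: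
  fixes f :: "real^3 \<Rightarrow> 'b::{banach,second_countable_topology}"
  assumes "continuous_on (sphere 0 1) f"
  shows "integrable sphere_measure f"
proof -
  obtain B where "\<And>m. m \<in> sphere 0 1 \<Longrightarrow> norm (f m) \<le> B"
    using continuous_bound_sphere[OF assms] by blast
  then show ?thesis
    by (intro sphere.integrable_const_bound[where B = B] continuous_borel_measurable_sphere assms)
       (auto intro!: AE_I2)
qed

lemma smooth_integrable: "smooth f \<Longrightarrow> integrable sphere_measure f"
  by (intro continuous_integrable_sphere smooth_continuous)

text \<open>
  Rodrigues' formula for the rotation by the angle \<open>t\<close> about \<open>e\<^sub>i\<close>. Its velocity at \<open>t = 0\<close> is \<open>e\<^sub>i \<times> m\<close>, the
  field along which \<^const>\<open>rot_smooth\<close> differentiates.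
\<close>

definition rotation :: "3 \<Rightarrow> real \<Rightarrow> real^3 \<Rightarrow> real^3" where
  "rotation i t m = m + sin t *\<^sub>R cross3 (axis i 1) m
     + (1 - cos t) *\<^sub>R cross3 (axis i 1) (cross3 (axis i 1) m)"

lemma rotation_0 [simp]: "rotation i 0 m = m"
  by (simp add: rotation_def)

lemma norm_cross_axis_le: "norm (cross3 (axis i 1) m) \<le> norm m"
proof (rule power2_le_imp_le)
  show "(norm (cross3 (axis i 1) m))\<^sup>2 \<le> (norm m)\<^sup>2"
    using norm_cross_dot[of "axis i 1" m] zero_le_power2[of "axis i 1 \<bullet> m"]
    unfolding norm_axis_1 mult_1 by linarith
qed simp

lemma norm_rotation: "norm (rotation i t m) = norm m"
proof -
  let ?s = "sin t" and ?c = "cos t"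
  have plane: "(?c * a - ?s * b)\<^sup>2 + (?s * a + ?c * b)\<^sup>2 = a\<^sup>2 + b\<^sup>2" for a b
  proof -
    have "(?c * a - ?s * b)\<^sup>2 + (?s * a + ?c * b)\<^sup>2 = ((?s)\<^sup>2 + (?c)\<^sup>2) * (a\<^sup>2 + b\<^sup>2)"
      by (simp only: power2_eq_square) algebra
    then show ?thesis by simp
  qed
  have sq: "(norm x)\<^sup>2 = (x $ 1)\<^sup>2 + (x $ 2)\<^sup>2 + (x $ 3)\<^sup>2" for x :: "real^3"
    unfolding power2_norm_eq_inner inner_vec_def sum_3 by (simp add: power2_eq_square)
  have "(norm (rotation i t m))\<^sup>2 = (norm m)\<^sup>2"
  proof -
    consider "i = 1" | "i = 2" | "i = 3" using exhaust_3 by blast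
    then show ?thesis
    proof cases
      case 1
      then have "rotation i t m $ 1 = m $ 1" "rotation i t m $ 2 = ?c * m $ 2 - ?s * m $ 3"
        "rotation i t m $ 3 = ?s * m $ 2 + ?c * m $ 3"
        by (simp_all add: rotation_def cross_axis algebra_simps)
      then show ?thesis using plane[of "m $ 2" "m $ 3"] by (simp add: sq)
    next
      case 2
      then have "rotation i t m $ 2 = m $ 2" "rotation i t m $ 3 = ?c * m $ 3 - ?s * m $ 1"
        "rotation i t m $ 1 = ?s * m $ 3 + ?c * m $ 1"
        by (simp_all add: rotation_def cross_axis algebra_simps)
      then show ?thesis using plane[of "m $ 3" "m $ 1"] by (simp add: sq)
    next
      case 3
      then have "rotation i t m $ 3 = m $ 3" "rotation i t m $ 1 = ?c * m $ 1 - ?s * m $ 2"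
        "rotation i t m $ 2 = ?s * m $ 1 + ?c * m $ 2"
        by (simp_all add: rotation_def cross_axis algebra_simps)
      then show ?thesis using plane[of "m $ 1" "m $ 2"] by (simp add: sq)
    qed
  qed
  then show ?thesis by simp
qed

lemma orthogonal_transformation_rotation: "orthogonal_transformation (rotation i t)"
  unfolding orthogonal_transformation
proof safe
  show "linear (rotation i t)"
    unfolding rotation_def
    by (intro linearI) (simp_all add: cross_add_right cross_mult_right algebra_simps)
qed (rule norm_rotation)

lemma rotation_has_derivative:
  "((\<lambda>t. rotation i t m) has_derivative (\<lambda>h. h *\<^sub>R cross3 (axis i 1) m)) (at 0)"
  unfolding rotation_def by (auto intro!: derivative_eq_intros simp: fun_eq_iff)

lemma norm_rotation_diff_le:
  assumes "norm m = 1"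
  shows "norm (rotation i t m - m) \<le> 2 * \<bar>t\<bar>"
proof -
  let ?u = "cross3 (axis i 1) m" and ?v = "cross3 (axis i 1) (cross3 (axis i 1) m)"
  have u: "norm ?u \<le> 1" using norm_cross_axis_le[of i m] assms by simp
  have v: "norm ?v \<le> 1" using norm_cross_axis_le[of i ?u] u by simp
  have c: "\<bar>1 - cos t\<bar> \<le> \<bar>t\<bar>"
  proof -
    have "1 - cos t = 2 * (sin (t/2))\<^sup>2"
      using cos_double_sin[of "t/2"] by simp
    also have "\<dots> = 2 * (\<bar>sin (t/2)\<bar> * \<bar>sin (t/2)\<bar>)" by (simp add: power2_eq_square)
    also have "\<dots> \<le> 2 * (\<bar>t/2\<bar> * 1)"
      by (intro mult_left_mono mult_mono abs_sin_x_le_abs_x) auto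
    finally show ?thesis using cos_le_one[of t] by simp
  qed
  have "norm (rotation i t m - m) \<le> \<bar>sin t\<bar> * norm ?u + \<bar>1 - cos t\<bar> * norm ?v"
    using norm_triangle_ineq[of "sin t *\<^sub>R ?u" "(1 - cos t) *\<^sub>R ?v"]
    unfolding rotation_def by (simp add: add.assoc)
  also have "\<dots> \<le> \<bar>t\<bar> * 1 + \<bar>t\<bar> * 1"
    by (intro add_mono mult_mono u v c abs_sin_x_le_abs_x) auto
  finally show ?thesis by simp
qed

text \<open>
  This bounds the difference quotients in the limit below uniformly, so that convergence is dominated.
\<close>

lemma smooth_Lipschitz_unit_ball:
  assumes "smooth f"
  obtains B where "\<And>x y. x \<in> cball 0 1 \<Longrightarrow> y \<in> cball 0 1 \<Longrightarrow> norm (f x - f y) \<le> B * norm (x - y)"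
proof -
  have "\<exists>B. \<forall>x\<in>cball 0 1. norm (partial k f x) \<le> B" for k
  proof -
    have "compact (partial k f ` cball 0 1)"
      by (intro compact_continuous_image smooth_continuous smooth_partial assms compact_cball)
    then show ?thesis using compact_imp_bounded bounded_iff by (metis imageI)
  qed
  then obtain B where B: "\<And>k x. x \<in> cball 0 1 \<Longrightarrow> norm (partial k f x) \<le> B k" by metis
  have "norm (f x - f y) \<le> (\<Sum>k\<in>UNIV. B k) * norm (x - y)" if "x \<in> cball 0 1" "y \<in> cball 0 1" for x y
  proof (rule differentiable_bound[of "cball 0 1" f "\<lambda>x. frechet_derivative f (at x)"])
    show "(f has_derivative frechet_derivative f (at x)) (at x within cball 0 1)" for x
      by (rule has_derivative_at_withinI[OF smooth_has_derivative[OF assms]])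
    show "onorm (frechet_derivative f (at x)) \<le> sum B UNIV" if x: "x \<in> cball 0 1" for x
    proof (rule onorm_le)
      fix v
      have "norm (frechet_derivative f (at x) v) \<le> (\<Sum>k\<in>UNIV. norm (of_real (v $ k) * partial k f x))"
        unfolding frechet_derivative_partial[OF smooth_differentiable[OF assms]] by (rule norm_sum)
      also have "\<dots> \<le> (\<Sum>k\<in>UNIV. norm v * B k)"
        by (intro sum_mono) (auto simp: norm_mult intro!: mult_mono B[OF x] component_le_norm_cart)
      also have "\<dots> = sum B UNIV * norm v"
        by (subst mult.commute) (rule sum_distrib_left[symmetric])
      finally show "norm (frechet_derivative f (at x) v) \<le> sum B UNIV * norm v" .
    qed
  qed (use that in auto)
  then show ?thesis using that by blast
qed

text \<open>
  Composing \<open>f\<close> with a rotation does not change its integral, so all difference quotients of \<open>f\<close> along the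
  rotation about \<open>e\<^sub>i\<close> have integral 0. They are bounded because \<open>f\<close> is Lipschitz, and converge pointwise
  to \<open>rot_smooth i f\<close>.
\<close>

lemma sphere_integral_rot_smooth:
  assumes f: "smooth f"
  shows "sphere_integral (rot_smooth i f) = 0"
proof -
  define s where "s n = inverse (real (Suc n))" for n
  have s0: "s n > 0" for n by (simp add: s_def)
  have slim: "s \<longlonglongrightarrow> 0" unfolding s_def by (rule LIMSEQ_inverse_real_of_nat)
  define F where "F n m = (f (rotation i (s n) m) - f m) /\<^sub>R s n" for n m
  have cont: "continuous_on (sphere 0 1) f" by (rule smooth_continuous[OF f])
  have cont_rot: "continuous_on A (rotation i t)" for A t
    using orthogonal_transformation_linear[OF orthogonal_transformation_rotation]
    by (simp add: linear_continuous_on linear_conv_bounded_linear)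
  have cont_frot: "continuous_on A (\<lambda>m. f (rotation i t m))" for A t
    by (rule continuous_on_compose2[OF smooth_continuous[OF f, of UNIV] cont_rot]) auto
  obtain B where B: "\<And>x y. x \<in> cball 0 1 \<Longrightarrow> y \<in> cball 0 1 \<Longrightarrow> norm (f x - f y) \<le> B * norm (x - y)"
    using smooth_Lipschitz_unit_ball[OF f] by blast
  have B0: "B \<ge> 0"
  proof -
    have "norm (f (axis 1 1) - f 0) \<le> B"
      using B[of "axis 1 1" 0] by (simp add: norm_axis_1)
    then show ?thesis using norm_ge_zero order_trans by blast
  qed
  have "(\<lambda>n. integral\<^sup>L sphere_measure (F n)) \<longlonglongrightarrow> integral\<^sup>L sphere_measure (rot_smooth i f)"
  proof (rule integral_dominated_convergence[where w = "\<lambda>_. 2 * B"])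
    show "rot_smooth i f \<in> borel_measurable sphere_measure"
      by (intro continuous_borel_measurable_sphere smooth_continuous smooth_rot_smooth f)
    show "F n \<in> borel_measurable sphere_measure" for n
      unfolding F_def by (intro continuous_borel_measurable_sphere continuous_intros cont cont_frot)
    show "AE m in sphere_measure. (\<lambda>n. F n m) \<longlonglongrightarrow> rot_smooth i f m"
    proof (rule AE_I2)
      fix m
      have f0: "(f has_derivative frechet_derivative f (at m)) (at (rotation i 0 m))"
        using smooth_has_derivative[OF f] by (simp add: rotation_def)
      have lin: "linear (frechet_derivative f (at m))"
        by (rule linear_frechet_derivative[OF smooth_differentiable[OF f]])
      have "((\<lambda>t. f (rotation i t m)) has_derivative (\<lambda>h. h *\<^sub>R rot_smooth i f m)) (at 0)"
        using has_derivative_compose[OF rotation_has_derivative f0]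
        by (simp add: rot_smooth_def linear_cmul[OF lin])
      then have "((\<lambda>t. norm (f (rotation i t m) - f m - t *\<^sub>R rot_smooth i f m) / norm t) \<longlongrightarrow> 0) (at 0)"
        unfolding has_derivative_at rotation_0 by simp
      moreover have "filterlim s (at 0) sequentially"
        using slim s0 by (auto simp: filterlim_at less_imp_neq[symmetric])
      ultimately have "(\<lambda>n. norm (f (rotation i (s n) m) - f m - s n *\<^sub>R rot_smooth i f m) / norm (s n)) \<longlonglongrightarrow> 0"
        by (rule filterlim_compose)
      also have "(\<lambda>n. norm (f (rotation i (s n) m) - f m - s n *\<^sub>R rot_smooth i f m) / norm (s n))
          = (\<lambda>n. norm (F n m - rot_smooth i f m))"
      proof
        fix n
        have "F n m - rot_smooth i f m = (f (rotation i (s n) m) - f m - s n *\<^sub>R rot_smooth i f m) /\<^sub>R s n"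
          using s0[of n] unfolding F_def scaleR_diff_right by simp
        then show "norm (f (rotation i (s n) m) - f m - s n *\<^sub>R rot_smooth i f m) / norm (s n)
            = norm (F n m - rot_smooth i f m)"
          by (simp add: divide_inverse)
      qed
      finally show "(\<lambda>n. F n m) \<longlonglongrightarrow> rot_smooth i f m"
        unfolding tendsto_norm_zero_iff by (rule LIM_zero_cancel)
    qed
    show "AE m in sphere_measure. norm (F n m) \<le> 2 * B" for n
    proof (rule AE_I2)
      fix m assume "m \<in> space sphere_measure"
      then have m: "norm m = 1" by simp
      have "norm (f (rotation i (s n) m) - f m) \<le> B * norm (rotation i (s n) m - m)"
        by (rule B) (auto simp: norm_rotation m)
      also have "\<dots> \<le> B * (2 * s n)"
        using norm_rotation_diff_le[OF m, of i "s n"] s0[of n] B0 by (intro mult_left_mono) auto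
      finally show "norm (F n m) \<le> 2 * B"
        using s0[of n] unfolding F_def norm_scaleR by (simp add: field_simps)
    qed
  qed auto
  moreover have "integral\<^sup>L sphere_measure (F n) = 0" for n
    using sphere_integral_rotation[OF orthogonal_transformation_rotation
        continuous_borel_measurable_sphere[OF cont], of i "s n"]
    unfolding F_def sphere_integral_def
    by (simp add: Bochner_Integration.integral_diff continuous_integrable_sphere cont cont_frot)
  ultimately show ?thesis
    by (simp add: sphere_integral_def LIMSEQ_const_iff)
qed

lemma sphere_integral_by_parts:
  assumes "smooth f" "smooth g"
  shows "sphere_integral (\<lambda>m. rot_smooth i f m * g m) = - sphere_integral (\<lambda>m. f m * rot_smooth i g m)"
proof -
  have "sphere_integral (\<lambda>m. rot_smooth i f m * g m + f m * rot_smooth i g m) = 0"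
    using sphere_integral_rot_smooth[OF smooth_mult[OF assms], of i]
    by (simp add: rot_smooth_mult[OF assms])
  then show ?thesis
    unfolding sphere_integral_def
    by (subst (asm) Bochner_Integration.integral_add)
       (auto intro!: smooth_integrable smooth_mult smooth_rot_smooth assms simp: add_eq_0_iff2)
qed

section \<open>Square integrable functions\<close>

lemma L2_sphere_borel: "f \<in> L2_sphere \<Longrightarrow> f \<in> borel_measurable sphere_measure"
  by (simp add: L2_sphere_def)

lemma L2_sphereI_bound:
  assumes "f \<in> borel_measurable sphere_measure" "integrable sphere_measure g"
    and "\<And>m. m \<in> sphere 0 1 \<Longrightarrow> (norm (f m))\<^sup>2 \<le> g m"
  shows "f \<in> L2_sphere"
  unfolding L2_sphere_def mem_Collect_eq
proof
  show "integrable sphere_measure (\<lambda>m. (norm (f m))\<^sup>2)"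
    using assms(1,3) by (intro Bochner_Integration.integrable_bound[OF assms(2)])
      (auto intro!: AE_I2 order_trans[OF _ abs_ge_self])
qed (rule assms)

lemma L2_sphere_integrable:
  assumes "f \<in> L2_sphere"
  shows "integrable sphere_measure f"
proof (rule Bochner_Integration.integrable_bound)
  show "integrable sphere_measure (\<lambda>m. 1 + (norm (f m))\<^sup>2)"
    using assms by (intro Bochner_Integration.integrable_add) (auto simp: L2_sphere_def)
  show "AE m in sphere_measure. norm (f m) \<le> norm (1 + (norm (f m))\<^sup>2)"
  proof (rule AE_I2)
    fix m
    have "0 \<le> (norm (f m) - 1)\<^sup>2" by simp
    then have "2 * norm (f m) \<le> 1 + (norm (f m))\<^sup>2" by (simp add: power2_diff)
    then show "norm (f m) \<le> norm (1 + (norm (f m))\<^sup>2)"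
      using norm_ge_zero[of "f m"] unfolding real_norm_def by linarith
  qed
qed (use assms in \<open>simp add: L2_sphere_def\<close>)

lemma L2_sphere_mult:
  assumes f: "f \<in> L2_sphere" and g: "continuous_on (sphere 0 1) g"
  shows "(\<lambda>m. f m * g m) \<in> L2_sphere"
proof -
  obtain B where B: "B \<ge> 0" "\<And>m. m \<in> sphere 0 1 \<Longrightarrow> norm (g m) \<le> B"
    using continuous_bound_sphere[OF g] by blast
  show ?thesis
  proof (rule L2_sphereI_bound[where g = "\<lambda>m. B\<^sup>2 * (norm (f m))\<^sup>2"])
    show "(\<lambda>m. f m * g m) \<in> borel_measurable sphere_measure"
      by (intro borel_measurable_times L2_sphere_borel[OF f] continuous_borel_measurable_sphere[OF g])
    show "integrable sphere_measure (\<lambda>m. B\<^sup>2 * (norm (f m))\<^sup>2)"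
      using f by (auto simp: L2_sphere_def)
    show "(norm (f m * g m))\<^sup>2 \<le> B\<^sup>2 * (norm (f m))\<^sup>2" if "m \<in> sphere 0 1" for m
      unfolding norm_mult power_mult_distrib
      by (subst mult.commute, intro mult_right_mono power_mono B that) auto
  qed
qed

lemma continuous_L2_sphere:
  assumes "continuous_on (sphere 0 1) f"
  shows "f \<in> L2_sphere"
  unfolding L2_sphere_def
  by (auto intro!: continuous_borel_measurable_sphere continuous_integrable_sphere continuous_intros assms)

lemma smooth_L2_sphere: "smooth f \<Longrightarrow> f \<in> L2_sphere"
  by (intro continuous_L2_sphere smooth_continuous)

lemma L2_sphere_cmult: "f \<in> L2_sphere \<Longrightarrow> (\<lambda>m. c * f m) \<in> L2_sphere"
  using L2_sphere_mult[of f "\<lambda>_. c"] by (simp add: mult.commute)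

lemma L2_sphere_add:
  assumes f: "f \<in> L2_sphere" and g: "g \<in> L2_sphere"
  shows "(\<lambda>m. f m + g m) \<in> L2_sphere"
proof (rule L2_sphereI_bound[where g = "\<lambda>m. 2 * (norm (f m))\<^sup>2 + 2 * (norm (g m))\<^sup>2"])
  show "(\<lambda>m. f m + g m) \<in> borel_measurable sphere_measure"
    by (intro borel_measurable_add L2_sphere_borel f g)
  show "integrable sphere_measure (\<lambda>m. 2 * (norm (f m))\<^sup>2 + 2 * (norm (g m))\<^sup>2)"
    using f g by (auto simp: L2_sphere_def)
  fix m
  have "(norm (f m + g m))\<^sup>2 \<le> (norm (f m) + norm (g m))\<^sup>2"
    by (intro power_mono norm_triangle_ineq) auto
  also have "\<dots> \<le> 2 * (norm (f m))\<^sup>2 + 2 * (norm (g m))\<^sup>2"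
    using zero_le_power2[of "norm (f m) - norm (g m)"] by (simp add: power2_sum power2_diff)
  finally show "(norm (f m + g m))\<^sup>2 \<le> 2 * (norm (f m))\<^sup>2 + 2 * (norm (g m))\<^sup>2" .
qed

lemma L2_sphere_diff:
  assumes "f \<in> L2_sphere" "g \<in> L2_sphere"
  shows "(\<lambda>m. f m - g m) \<in> L2_sphere"
  using L2_sphere_add[OF assms(1) L2_sphere_cmult[OF assms(2), of "-1"]] by simp

lemma L2_sphere_sum:
  assumes "\<And>k. k \<in> A \<Longrightarrow> f k \<in> L2_sphere"
  shows "(\<lambda>m. \<Sum>k\<in>A. f k m) \<in> L2_sphere"
  using assms by (induction A rule: infinite_finite_induct)
    (auto intro: L2_sphere_add continuous_L2_sphere)

lemma L2_sphere_cong_AE: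
  assumes "f \<in> L2_sphere" "g \<in> borel_measurable sphere_measure" "ae_eq f g"
  shows "g \<in> L2_sphere"
proof -
  have "integrable sphere_measure (\<lambda>m. (norm (g m))\<^sup>2)"
    using assms unfolding L2_sphere_def ae_eq_def
    by (auto intro!: integrable_cong_AE_imp[of _ "\<lambda>m. (norm (f m))\<^sup>2"])
  with assms show ?thesis by (simp add: L2_sphere_def)
qed

lemma L2_mult_smooth_integrable:
  assumes "f \<in> L2_sphere" "smooth g"
  shows "integrable sphere_measure (\<lambda>m. f m * g m)"
  by (intro L2_sphere_integrable L2_sphere_mult smooth_continuous assms)

lemma sphere_integral_cong:
  assumes "\<And>m. norm m = 1 \<Longrightarrow> f m = g m"
  shows "sphere_integral f = sphere_integral g"
  unfolding sphere_integral_def by (intro Bochner_Integration.integral_cong) (auto simp: assms)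

lemma sphere_integral_cong_AE:
  assumes "f \<in> borel_measurable sphere_measure" "g \<in> borel_measurable sphere_measure" "ae_eq f g"
  shows "sphere_integral f = sphere_integral g"
  using assms unfolding sphere_integral_def ae_eq_def by (intro integral_cong_AE)

lemma sphere_integral_add:
  assumes "integrable sphere_measure f" "integrable sphere_measure g"
  shows "sphere_integral (\<lambda>m. f m + g m) = sphere_integral f + sphere_integral g"
  unfolding sphere_integral_def by (rule Bochner_Integration.integral_add[OF assms])

lemma sphere_integral_diff:
  assumes "integrable sphere_measure f" "integrable sphere_measure g"
  shows "sphere_integral (\<lambda>m. f m - g m) = sphere_integral f - sphere_integral g"
  unfolding sphere_integral_def by (rule Bochner_Integration.integral_diff[OF assms])

lemma sphere_integral_sum:
  assumes "\<And>k. k \<in> A \<Longrightarrow> integrable sphere_measure (f k)"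
  shows "sphere_integral (\<lambda>m. \<Sum>k\<in>A. f k m) = (\<Sum>k\<in>A. sphere_integral (f k))"
  unfolding sphere_integral_def by (rule Bochner_Integration.integral_sum[OF assms])

lemma sphere_integral_cmult: "sphere_integral (\<lambda>m. c * f m) = c * sphere_integral f"
  unfolding sphere_integral_def by simp

section \<open>Polynomials are total\<close>

text \<open>
  Polynomials are the test functions that matter: they are smooth, the spherical harmonics are among
  them, and they are dense.
\<close>

inductive polyfun :: "(real^3 \<Rightarrow> complex) \<Rightarrow> bool" where
  const: "polyfun (\<lambda>m. c)"
| coordinate: "polyfun (\<lambda>m. of_real (m $ k))"
| add: "polyfun f \<Longrightarrow> polyfun g \<Longrightarrow> polyfun (\<lambda>m. f m + g m)"
| mult: "polyfun f \<Longrightarrow> polyfun g \<Longrightarrow> polyfun (\<lambda>m. f m * g m)"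

lemma polyfun_smooth: "polyfun f \<Longrightarrow> smooth f"
  by (induction rule: polyfun.induct) (auto intro: smooth_add smooth_mult)

lemma polyfun_sum: "(\<And>k. k \<in> A \<Longrightarrow> polyfun (f k)) \<Longrightarrow> polyfun (\<lambda>m. \<Sum>k\<in>A. f k m)"
  by (induction A rule: infinite_finite_induct) (auto intro: polyfun.intros)

lemma polyfun_power: "polyfun f \<Longrightarrow> polyfun (\<lambda>m. f m ^ n)"
  by (induction n) (auto intro: polyfun.intros)

lemma real_polynomial_function_polyfun:
  "real_polynomial_function p \<Longrightarrow> polyfun (\<lambda>m. of_real (p m))"
proof (induction rule: real_polynomial_function.induct)
  case (linear l)
  then have l: "linear l" by (rule bounded_linear.linear)
  have "(\<lambda>m. complex_of_real (l m)) = (\<lambda>m. \<Sum>k\<in>UNIV. of_real (m $ k) * of_real (l (axis k 1)))"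
    by (rule ext, subst linear_axis_expansion[OF l]) simp
  then show ?case
    by (rule ssubst[where P = polyfun]) (intro polyfun_sum polyfun.intros)
qed (auto intro: polyfun.intros)

text \<open>
  The continuous functions \<open>max 0 (1 - n dist(m, K))\<close> decrease to the indicator of \<open>K\<close>.
\<close>

lemma integral_closed_zero:
  fixes h :: "real^3 \<Rightarrow> complex"
  assumes h: "integrable sphere_measure h"
    and zero: "\<And>\<phi>::real^3\<Rightarrow>real. continuous_on UNIV \<phi> \<Longrightarrow> integral\<^sup>L sphere_measure (\<lambda>m. \<phi> m *\<^sub>R h m) = 0"
    and K: "closed K"
  shows "integral\<^sup>L sphere_measure (\<lambda>m. indicator K m *\<^sub>R h m) = 0"
proof (cases "K = {}")
  case False
  define \<phi> where "\<phi> n m = max 0 (1 - real n * infdist m K)" for n m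
  have cont: "continuous_on A (\<phi> n)" for n A
    unfolding \<phi>_def by (intro continuous_intros)
  have meas: "\<phi> n \<in> borel_measurable sphere_measure" for n
    by (rule continuous_borel_measurable_sphere[OF cont])
  have "(\<lambda>n. integral\<^sup>L sphere_measure (\<lambda>m. \<phi> n m *\<^sub>R h m))
          \<longlonglongrightarrow> integral\<^sup>L sphere_measure (\<lambda>m. indicator K m *\<^sub>R h m)"
  proof (rule integral_dominated_convergence[where w = "\<lambda>m. norm (h m)"])
    have "(\<lambda>m. indicator K m :: real) \<in> borel_measurable sphere_measure"
      unfolding borel_measurable_sphere_measure
      by (intro measurable_restrict_space1 borel_measurable_indicator borel_closed K)
    then show "(\<lambda>m. indicator K m *\<^sub>R h m) \<in> borel_measurable sphere_measure"
      using h by (intro borel_measurable_scaleR) auto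
    show "(\<lambda>m. \<phi> n m *\<^sub>R h m) \<in> borel_measurable sphere_measure" for n
      using h meas by (intro borel_measurable_scaleR) auto
    show "AE m in sphere_measure. (\<lambda>n. \<phi> n m *\<^sub>R h m) \<longlonglongrightarrow> indicator K m *\<^sub>R h m"
    proof (intro AE_I2 tendsto_scaleR tendsto_const)
      fix m
      show "(\<lambda>n. \<phi> n m) \<longlonglongrightarrow> indicator K m"
      proof (cases "m \<in> K")
        case True
        then show ?thesis by (simp add: \<phi>_def)
      next
        case mK: False
        then have d: "infdist m K > 0"
          using infdist_pos_not_in_closed[OF K False] by simp
        have "eventually (\<lambda>n. real n \<ge> 1 / infdist m K) sequentially"
          using filterlim_real_sequentially by (simp add: filterlim_at_top)
        then have "eventually (\<lambda>n. \<phi> n m = 0) sequentially"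
        proof eventually_elim
          case (elim n)
          with d have "1 \<le> real n * infdist m K" by (simp add: field_simps)
          then show ?case by (simp add: \<phi>_def)
        qed
        with mK show ?thesis by (simp add: tendsto_eventually)
      qed
    qed
    show "AE m in sphere_measure. norm (\<phi> n m *\<^sub>R h m) \<le> norm (h m)" for n
    proof (rule AE_I2)
      fix m
      have "\<bar>\<phi> n m\<bar> \<le> 1" by (simp add: \<phi>_def infdist_nonneg)
      then show "norm (\<phi> n m *\<^sub>R h m) \<le> norm (h m)"
        by (simp add: mult_left_le_one_le)
    qed
  qed (use h in auto)
  then show ?thesis
    by (simp add: zero[OF cont] LIMSEQ_const_iff)
qed simp

text \<open>
  By Stone--Weierstrass the vanishing of the integrals extends from polynomials to continuous functions,
  by the previous lemma to indicators of closed sets, and, since these form an intersection-stable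
  generator, to indicators of all Borel sets. A density with vanishing integral over every measurable
  set is zero almost everywhere.
\<close>

lemma polyfun_total:
  assumes h: "integrable sphere_measure h"
    and zero: "\<And>p. polyfun p \<Longrightarrow> sphere_integral (\<lambda>m. h m * p m) = 0"
  shows "ae_eq h (\<lambda>m. 0)"
proof -
  have cont_zero: "integral\<^sup>L sphere_measure (\<lambda>m. \<phi> m *\<^sub>R h m) = 0"
    if \<phi>: "continuous_on UNIV \<phi>" for \<phi> :: "real^3 \<Rightarrow> real"
  proof -
    have cS: "continuous_on (sphere 0 1) \<phi>" using \<phi> continuous_on_subset by blast
    let ?K = "integral\<^sup>L sphere_measure (\<lambda>m. norm (h m))"
    have int: "integrable sphere_measure (\<lambda>m. \<psi> m *\<^sub>R h m)" if c\<psi>: "continuous_on (sphere 0 1) \<psi>" for \<psi> :: "real^3 \<Rightarrow> real"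
    proof -
      obtain B where B: "B \<ge> 0" "\<And>m. m \<in> sphere 0 1 \<Longrightarrow> norm (\<psi> m) \<le> B"
        using continuous_bound_sphere[OF c\<psi>] by blast
      show ?thesis
      proof (rule Bochner_Integration.integrable_bound[where f = "\<lambda>m. B * norm (h m)"])
        show "(\<lambda>m. \<psi> m *\<^sub>R h m) \<in> borel_measurable sphere_measure"
          using h continuous_borel_measurable_sphere[OF c\<psi>] by (intro borel_measurable_scaleR) auto
        show "AE m in sphere_measure. norm (\<psi> m *\<^sub>R h m) \<le> norm (B * norm (h m))"
          using B by (intro AE_I2) (auto simp: abs_mult intro!: mult_right_mono)
      qed (use h in auto)
    qed
    have *: "norm (integral\<^sup>L sphere_measure (\<lambda>m. \<phi> m *\<^sub>R h m)) \<le> e * ?K" if e: "e > 0" for e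
    proof -
      obtain g where g: "real_polynomial_function g" "\<And>x. x \<in> sphere 0 1 \<Longrightarrow> \<bar>\<phi> x - g x\<bar> < e"
        using Stone_Weierstrass_real_polynomial_function[OF compact_sphere cS e] by blast
      have cg: "continuous_on (sphere 0 1) g"
        by (rule continuous_on_subset[OF continuous_on_polymonial_function])
           (use g(1) real_polynomial_function_eq in auto)
      have "integral\<^sup>L sphere_measure (\<lambda>m. g m *\<^sub>R h m) = 0"
        using zero[OF real_polynomial_function_polyfun[OF g(1)]]
        by (simp add: sphere_integral_def scaleR_conv_of_real mult.commute)
      then have "integral\<^sup>L sphere_measure (\<lambda>m. \<phi> m *\<^sub>R h m) = integral\<^sup>L sphere_measure (\<lambda>m. (\<phi> m - g m) *\<^sub>R h m)"
        unfolding scaleR_diff_left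
        by (subst Bochner_Integration.integral_diff) (auto intro!: int cS cg)
      also have "norm \<dots> \<le> integral\<^sup>L sphere_measure (\<lambda>m. norm ((\<phi> m - g m) *\<^sub>R h m))"
        by (rule integral_norm_bound)
      also have "\<dots> \<le> integral\<^sup>L sphere_measure (\<lambda>m. e * norm (h m))"
        using h by (intro integral_mono integrable_norm int continuous_intros cS cg)
          (auto intro!: mult_right_mono less_imp_le[OF g(2)])
      finally show ?thesis by simp
    qed
    \<comment> \<open>The choice \<open>e / (K + 1)\<close> avoids dividing by \<open>K\<close>, which may be 0.\<close>
    have bound: "norm (integral\<^sup>L sphere_measure (\<lambda>m. \<phi> m *\<^sub>R h m)) \<le> e / (?K + 1) * ?K" if "e > 0" for e
      by (intro * divide_pos_pos add_nonneg_pos that) auto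
    have "norm (integral\<^sup>L sphere_measure (\<lambda>m. \<phi> m *\<^sub>R h m)) \<le> 0 + e" if e: "e > 0" for e
    proof -
      have quot: "e / (K + 1) * K \<le> e" if "K \<ge> 0" for K
        using e that by (simp add: field_simps)
      have "e / (?K + 1) * ?K \<le> e" by (rule quot) simp
      with bound[OF e] show ?thesis by linarith
    qed
    then have "norm (integral\<^sup>L sphere_measure (\<lambda>m. \<phi> m *\<^sub>R h m)) \<le> 0"
      by (rule field_le_epsilon)
    then show ?thesis by simp
  qed
  have borel_zero: "integral\<^sup>L sphere_measure (\<lambda>m. indicator A m *\<^sub>R h m) = 0" if "A \<in> sets borel" for A
  proof -
    have ind: "integrable sphere_measure (\<lambda>m. indicator A m *\<^sub>R h m)" if "A \<in> sets borel" for A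
    proof -
      have "(\<lambda>m. indicator A m :: real) \<in> borel_measurable sphere_measure"
        unfolding borel_measurable_sphere_measure
        by (intro measurable_restrict_space1 borel_measurable_indicator that)
      then show ?thesis using h
        by (intro Bochner_Integration.integrable_bound[OF h])
           (auto intro!: AE_I2 borel_measurable_scaleR simp: indicator_def)
    qed
    have borel: "sets borel = sigma_sets UNIV {K::(real^3) set. closed K}"
      by (simp add: borel_eq_closed)
    have hz: "integral\<^sup>L sphere_measure h = 0"
      using cont_zero[of "\<lambda>_. 1"] by simp
    have "Int_stable {K::(real^3) set. closed K}" "{K::(real^3) set. closed K} \<subseteq> Pow UNIV"
      "A \<in> sigma_sets UNIV {K. closed K}"
      using that borel by (auto simp: Int_stable_def)
    then show ?thesis
    proof (induction rule: sigma_sets_induct_disjoint)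
      case (compl A)
      then have A: "A \<in> sets borel" using borel by simp
      have "(\<lambda>m. indicator (UNIV - A) m *\<^sub>R h m) = (\<lambda>m. h m - indicator A m *\<^sub>R h m)"
        by (auto simp: fun_eq_iff indicator_def)
      with compl show ?case by (simp add: ind[OF A] h hz)
    next
      case (union A)
      then have A: "A i \<in> sets borel" for i using borel by auto
      have "(\<lambda>n. integral\<^sup>L sphere_measure (\<lambda>m. \<Sum>i<n. indicator (A i) m *\<^sub>R h m))
         \<longlonglongrightarrow> integral\<^sup>L sphere_measure (\<lambda>m. indicator (\<Union>i. A i) m *\<^sub>R h m)"
      proof (rule integral_dominated_convergence[where w = "\<lambda>m. norm (h m)"])
        have eq: "(\<Sum>i<n. indicator (A i) m *\<^sub>R h m) = indicator (\<Union>i<n. A i) m *\<^sub>R h m" for n m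
          unfolding scaleR_sum_left[symmetric]
          by (subst indicator_UN_disjoint) (use \<open>disjoint_family A\<close> in \<open>auto simp: disjoint_family_on_def\<close>)
        show "AE m in sphere_measure. (\<lambda>n. \<Sum>i<n. indicator (A i) m *\<^sub>R h m) \<longlonglongrightarrow> indicator (\<Union>i. A i) m *\<^sub>R h m"
          unfolding eq by (intro AE_I2 tendsto_scaleR tendsto_const LIMSEQ_indicator_UN)
        show "AE m in sphere_measure. norm (\<Sum>i<n. indicator (A i) m *\<^sub>R h m) \<le> norm (h m)" for n
          unfolding eq by (intro AE_I2) (auto simp: indicator_def)
        show "(\<lambda>m. indicator (\<Union>i. A i) m *\<^sub>R h m) \<in> borel_measurable sphere_measure"
          by (intro borel_measurable_integrable ind sets.countable_UN) (use A in auto)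
        show "(\<lambda>m. \<Sum>i<n. indicator (A i) m *\<^sub>R h m) \<in> borel_measurable sphere_measure" for n
          by (intro borel_measurable_sum borel_measurable_integrable ind A)
      qed (use h in auto)
      moreover have "integral\<^sup>L sphere_measure (\<lambda>m. \<Sum>i<n. indicator (A i) m *\<^sub>R h m) = 0" for n
        using union by (subst Bochner_Integration.integral_sum) (auto intro!: ind A)
      ultimately show ?case by (simp add: LIMSEQ_const_iff)
    qed (auto intro: integral_closed_zero[OF h cont_zero])
  qed
  show ?thesis
    unfolding ae_eq_def
    by (rule sphere.density_zero[OF h]) (auto simp: set_lebesgue_integral_def in_sets_sphere_measure intro: borel_zero)
qed

section \<open>Weak derivatives\<close>

lemma L2_polyfun_unique:
  assumes "f \<in> L2_sphere" "g \<in> L2_sphere"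
    and "\<And>p. smooth p \<Longrightarrow> sphere_integral (\<lambda>m. f m * p m) = sphere_integral (\<lambda>m. g m * p m)"
  shows "ae_eq f g"
proof -
  have "ae_eq (\<lambda>m. f m - g m) (\<lambda>m. 0)"
  proof (rule polyfun_total)
    show "integrable sphere_measure (\<lambda>m. f m - g m)"
      by (intro L2_sphere_integrable L2_sphere_diff assms)
    fix p assume "polyfun p"
    then have p: "smooth p" by (rule polyfun_smooth)
    show "sphere_integral (\<lambda>m. (f m - g m) * p m) = 0"
      unfolding left_diff_distrib
      by (subst sphere_integral_diff) (auto intro!: L2_mult_smooth_integrable assms p)
  qed
  then show ?thesis by (simp add: ae_eq_def)
qed

lemma has_weak_rot_unique: "has_weak_rot i f g \<Longrightarrow> has_weak_rot i f g' \<Longrightarrow> ae_eq g g'"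
  by (rule L2_polyfun_unique) (auto simp: has_weak_rot_def)

lemma has_weak_rot_rot: "has_weak_rot i f g \<Longrightarrow> has_weak_rot i f (rot i f)"
  unfolding rot_def using someI[of "has_weak_rot i f"] by blast

lemma has_weak_rot_smooth: "smooth f \<Longrightarrow> has_weak_rot i f (rot_smooth i f)"
  unfolding has_weak_rot_def
  by (auto intro!: smooth_L2_sphere smooth_rot_smooth sphere_integral_by_parts)

lemma has_weak_rot_cong_AE:
  assumes w: "has_weak_rot i f g" and f': "f' \<in> borel_measurable sphere_measure" "ae_eq f f'"
  shows "has_weak_rot i f' g"
proof -
  have f: "f \<in> L2_sphere" using w by (simp add: has_weak_rot_def)
  have f'L: "f' \<in> L2_sphere" by (rule L2_sphere_cong_AE[OF f f'])
  have "sphere_integral (\<lambda>m. f m * rot_smooth i \<phi> m) = sphere_integral (\<lambda>m. f' m * rot_smooth i \<phi> m)"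
    if "smooth \<phi>" for \<phi>
  proof (rule sphere_integral_cong_AE)
    show "ae_eq (\<lambda>m. f m * rot_smooth i \<phi> m) (\<lambda>m. f' m * rot_smooth i \<phi> m)"
      using f'(2) unfolding ae_eq_def by eventually_elim simp
  qed (auto intro!: borel_measurable_integrable L2_mult_smooth_integrable f f'L smooth_rot_smooth that)
  with w f'L show ?thesis by (simp add: has_weak_rot_def)
qed

lemma has_weak_rot_add:
  assumes "has_weak_rot i f g" "has_weak_rot i f' g'"
  shows "has_weak_rot i (\<lambda>m. f m + f' m) (\<lambda>m. g m + g' m)"
  using assms unfolding has_weak_rot_def
  by (auto intro!: L2_sphere_add simp: distrib_right sphere_integral_add L2_mult_smooth_integrable smooth_rot_smooth)

lemma has_weak_rot_cmult:
  assumes "has_weak_rot i f g"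
  shows "has_weak_rot i (\<lambda>m. c * f m) (\<lambda>m. c * g m)"
  using assms unfolding has_weak_rot_def
  by (auto intro!: L2_sphere_cmult simp: mult.assoc sphere_integral_cmult)

section \<open>The Laplace--Beltrami operator as the sum of the squared rotational derivatives\<close>

text \<open>
  The Casimir operator of the rotation group. It agrees with the Laplace--Beltrami operator on the
  sphere, but is built from derivations that integrate by parts, so that its symmetry and its
  product rule are immediate.
\<close>

definition casimir :: "(real^3 \<Rightarrow> complex) \<Rightarrow> real^3 \<Rightarrow> complex" where
  "casimir f m = (\<Sum>i\<in>UNIV. rot_smooth i (rot_smooth i f) m)"

lemma partial_add:
  assumes "smooth f" "smooth g"
  shows "partial i (\<lambda>x. f x + g x) x = partial i f x + partial i g x"
  using partial_eqI[OF has_derivative_add[OF assms[THEN smooth_has_derivative]]]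
  by (auto simp: partial_def)

lemma partial_mult:
  assumes "smooth f" "smooth g"
  shows "partial i (\<lambda>x. f x * g x) x = f x * partial i g x + partial i f x * g x"
  using partial_eqI[OF has_derivative_mult[OF assms[THEN smooth_has_derivative]]]
  by (auto simp: partial_def)

lemma partial_sum:
  assumes "\<And>k. k \<in> A \<Longrightarrow> smooth (f k)"
  shows "partial i (\<lambda>x. \<Sum>k\<in>A. f k x) x = (\<Sum>k\<in>A. partial i (f k) x)"
proof -
  have const0: "partial i (\<lambda>x. 0) x = 0"
    by (subst partial_eqI[where D = "\<lambda>_. 0"]) (auto intro: derivative_eq_intros)
  show ?thesis
    using assms
    by (induction A rule: infinite_finite_induct) (auto simp: const0 partial_add smooth_sum)
qed

lemma partial_linear:
  assumes "linear l"
  shows "partial i (\<lambda>x. of_real (l x)) x = of_real (l (axis i 1))"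
  by (rule partial_eqI[where D = "\<lambda>v. of_real (l v)"])
     (intro bounded_linear_imp_has_derivative bounded_linear_compose[OF bounded_linear_of_real]
        linear_conv_bounded_linear[THEN iffD1] assms)

lemma partial_coordinate: "partial i (\<lambda>x. of_real (x $ k)) x = of_real (axis i 1 $ k)"
  by (rule partial_eqI[OF has_derivative_coordinate])

lemma sgn_has_derivative:
  fixes x :: "'a::real_inner"
  assumes "x \<noteq> 0"
  shows "(sgn has_derivative (\<lambda>v. (v - (sgn x \<bullet> v) *\<^sub>R sgn x) /\<^sub>R norm x)) (at x)"
proof -
  have n: "(norm has_derivative (\<lambda>v. sgn x \<bullet> v)) (at x)"
    using has_derivative_norm[OF assms] by (simp add: inner_commute)
  have "((\<lambda>x. inverse (norm x) *\<^sub>R x) has_derivative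
      (\<lambda>v. inverse (norm x) *\<^sub>R v + (- (inverse (norm x) * (sgn x \<bullet> v) * inverse (norm x))) *\<^sub>R x)) (at x)"
    using assms by (intro has_derivative_scaleR Deriv.has_derivative_inverse n has_derivative_ident) auto
  then show ?thesis
    by (simp add: sgn_div_norm[abs_def] scaleR_diff_right mult.commute)
qed

lemma inverse_norm_has_derivative:
  fixes x :: "'a::real_inner"
  assumes "norm x = 1"
  shows "((\<lambda>x. inverse (norm x)) has_derivative (\<lambda>v. - (x \<bullet> v))) (at x)"
proof -
  have x: "x \<noteq> 0" using assms by auto
  have "((\<lambda>x. inverse (norm x)) has_derivative (\<lambda>v. - (inverse (norm x) * (sgn x \<bullet> v) * inverse (norm x)))) (at x)"
    using has_derivative_norm[OF x] x
    by (intro Deriv.has_derivative_inverse) (auto simp: inner_commute)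
  with assms show ?thesis by (simp add: sgn_div_norm)
qed

text \<open>
  At a unit vector \<open>y\<close> this is the \<open>i\<close>-th component of the projection of the gradient to the tangent
  plane. The formula makes sense on the whole space, so that it can be differentiated again in all
  directions.
\<close>

definition tangential_gradient :: "3 \<Rightarrow> (real^3 \<Rightarrow> complex) \<Rightarrow> real^3 \<Rightarrow> complex" where
  "tangential_gradient i f y =
     (\<Sum>k\<in>UNIV. (of_real (axis i 1 $ k) + of_real (-(y $ i)) * of_real (y $ k)) * partial k f y)"

lemma smooth_uminus_coordinate [simp]: "smooth (\<lambda>y. of_real (-(y $ i)))"
  by (rule smooth_linear) (auto intro!: linearI)

lemma smooth_tangential_gradient:
  assumes "smooth f"
  shows "smooth (tangential_gradient i f)"
  unfolding tangential_gradient_def[abs_def]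
  by (intro smooth_sum smooth_mult smooth_add smooth_const smooth_coordinate smooth_partial
      smooth_uminus_coordinate assms)

text \<open>
  The extension that is constant along rays has a derivative that is homogeneous of degree \<open>- 1\<close>, which
  is the factor \<open>1 / \<bar>x\<bar>\<close>; differentiating this factor produces the first term of the next lemma.
\<close>

lemma partial_comp_sgn:
  assumes f: "smooth f" and x: "x \<noteq> 0"
  shows "partial i (\<lambda>x. f (sgn x)) x = of_real (inverse (norm x)) * tangential_gradient i f (sgn x)"
proof -
  let ?v = "(axis i 1 - (sgn x \<bullet> axis i 1) *\<^sub>R sgn x) /\<^sub>R norm x"
  have "((\<lambda>x. f (sgn x)) has_derivative
      (\<lambda>v. frechet_derivative f (at (sgn x)) ((v - (sgn x \<bullet> v) *\<^sub>R sgn x) /\<^sub>R norm x))) (at x)"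
    by (rule has_derivative_compose[OF sgn_has_derivative[OF x] smooth_has_derivative[OF f]])
  then have "partial i (\<lambda>x. f (sgn x)) x = frechet_derivative f (at (sgn x)) ?v"
    by (rule partial_eqI)
  also have "\<dots> = (\<Sum>k\<in>UNIV. of_real (?v $ k) * partial k f (sgn x))"
    by (rule frechet_derivative_partial[OF smooth_differentiable[OF f]])
  also have "\<dots> = of_real (inverse (norm x)) * tangential_gradient i f (sgn x)"
    unfolding tangential_gradient_def sum_distrib_left
    by (intro sum.cong refl) (simp add: inner_axis algebra_simps)
  finally show ?thesis .
qed

lemma partial_partial_comp_sgn:
  assumes f: "smooth f" and m: "norm m = 1"
  shows "partial i (partial i (\<lambda>x. f (sgn x))) m =
    - of_real (m $ i) * tangential_gradient i f m
    + (\<Sum>l\<in>UNIV. of_real ((axis i 1 - (m $ i) *\<^sub>R m) $ l) * partial l (tangential_gradient i f) m)"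
proof -
  let ?H = "tangential_gradient i f"
  have H: "smooth ?H" by (rule smooth_tangential_gradient[OF f])
  have m0: "m \<noteq> 0" using m by auto
  have sgn_m: "sgn m = m" using m by (simp add: sgn_div_norm)
  have "((\<lambda>x. ?H (sgn x)) has_derivative
      (\<lambda>v. frechet_derivative ?H (at m) (v - (m \<bullet> v) *\<^sub>R m))) (at m)"
    using has_derivative_compose[OF sgn_has_derivative[OF m0] smooth_has_derivative[OF H]]
    by (simp add: sgn_m m)
  from has_derivative_mult[OF has_derivative_of_real[OF inverse_norm_has_derivative[OF m]] this]
  have "((\<lambda>x. of_real (inverse (norm x)) * ?H (sgn x)) has_derivative
      (\<lambda>v. frechet_derivative ?H (at m) (v - (m \<bullet> v) *\<^sub>R m) - of_real (m \<bullet> v) * ?H m)) (at m)"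
    by (simp add: sgn_m m)
  then have "(partial i (\<lambda>x. f (sgn x)) has_derivative
      (\<lambda>v. frechet_derivative ?H (at m) (v - (m \<bullet> v) *\<^sub>R m) - of_real (m \<bullet> v) * ?H m)) (at m)"
    by (rule has_derivative_transform_within_open[where s = "- {0}"])
       (use m0 in \<open>auto simp: partial_comp_sgn[OF f]\<close>)
  from partial_eqI[OF this] show ?thesis
    by (simp add: frechet_derivative_partial[OF smooth_differentiable[OF H]] inner_axis)
qed

lemma partial_tangential_gradient:
  assumes f: "smooth f"
  shows "partial l (tangential_gradient i f) m =
    (\<Sum>k\<in>UNIV. (of_real (axis i 1 $ k) - of_real (m $ i) * of_real (m $ k)) * partial l (partial k f) m
       + - (of_real (m $ i) * of_real (axis l 1 $ k) + of_real (axis l 1 $ i) * of_real (m $ k)) * partial k f m)"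
proof -
  have lin: "linear (\<lambda>x::real^3. - (x $ i))" by (auto intro!: linearI)
  have c: "partial l (\<lambda>y. c) x = 0" for c x
    by (subst partial_eqI[where D = "\<lambda>_. 0"]) (auto intro: derivative_eq_intros)
  note sm = smooth_mult smooth_add smooth_const smooth_coordinate smooth_partial smooth_uminus_coordinate f
  show ?thesis
    unfolding tangential_gradient_def[abs_def]
    by (subst partial_sum, (intro sm)+, rule sum.cong[OF refl])
       (subst partial_mult, (intro sm)+, subst partial_add, (intro sm)+, subst partial_mult, (intro sm)+,
        simp add: c partial_coordinate partial_linear[OF lin, simplified] algebra_simps)
qed

lemma partial_rot_smooth:
  assumes f: "smooth f"
  shows "partial l (rot_smooth i f) m =
    (\<Sum>k\<in>UNIV. of_real (cross3 (axis i 1) m $ k) * partial l (partial k f) m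
       + of_real (cross3 (axis i 1) (axis l 1) $ k) * partial k f m)"
proof -
  have eq: "rot_smooth i f = (\<lambda>m. \<Sum>k\<in>UNIV. of_real (cross3 (axis i 1) m $ k) * partial k f m)"
    using rot_smooth_partial smooth_differentiable[OF f] by blast
  show ?thesis
    unfolding eq
    by (simp add: partial_sum partial_mult smooth_mult smooth_partial f
        partial_linear[OF linear_cross_component])
qed

lemma norm_1_components:
  fixes m :: "real^3"
  assumes "norm m = 1"
  shows "(complex_of_real (m $ 1))\<^sup>2 + (complex_of_real (m $ 2))\<^sup>2 + (complex_of_real (m $ 3))\<^sup>2 = 1"
proof -
  have "(m $ 1)\<^sup>2 + (m $ 2)\<^sup>2 + (m $ 3)\<^sup>2 = 1"
    using assms by (simp add: norm_eq_1 inner_vec_def sum_3 power2_eq_square)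
  then have "complex_of_real ((m $ 1)\<^sup>2 + (m $ 2)\<^sup>2 + (m $ 3)\<^sup>2) = of_real 1"
    by (rule arg_cong)
  then show ?thesis by (simp only: of_real_add of_real_power of_real_1)
qed

lemma axis_components:
  "axis 1 1 $ (1::3) = (1::real)" "axis 1 1 $ (2::3) = (0::real)" "axis 1 1 $ (3::3) = (0::real)"
  "axis 2 1 $ (1::3) = (0::real)" "axis 2 1 $ (2::3) = (1::real)" "axis 2 1 $ (3::3) = (0::real)"
  "axis 3 1 $ (1::3) = (0::real)" "axis 3 1 $ (2::3) = (0::real)" "axis 3 1 $ (3::3) = (1::real)"
  by (simp_all add: axis_def)

text \<open>
  Collects the coefficients of first and second derivatives in an expression of the shape that both
  sides of \<open>laplace_beltrami_smooth_eq_casimir\<close> take: once with the tangential projection, once with the rotational fields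
  in the role of \<open>P\<close>.
\<close>

lemma second_order_sum_expand:
  fixes P c :: "3 \<Rightarrow> 3 \<Rightarrow> complex"
  shows "(\<Sum>i\<in>UNIV. n i * (\<Sum>k\<in>UNIV. P i k * p k) + (\<Sum>l\<in>UNIV. P i l * (\<Sum>k\<in>UNIV. P i k * q l k + d i l k * p k)))
    = (\<Sum>l\<in>UNIV. \<Sum>k\<in>UNIV. (\<Sum>i\<in>UNIV. P i l * P i k) * q l k)
      + (\<Sum>k\<in>UNIV. ((\<Sum>i\<in>UNIV. n i * P i k) + (\<Sum>i\<in>UNIV. \<Sum>l\<in>UNIV. P i l * d i l k)) * p k)"
  by (simp add: sum_3 algebra_simps)

text \<open>
  The fields \<open>e\<^sub>i \<times> m\<close> form a tight frame of the tangent plane: the sum of their dyadic products is the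
  projection to it.
\<close>

lemma cross_axis_gram:
  fixes m :: "real^3"
  assumes "norm m = 1"
  shows "(\<Sum>i\<in>UNIV. complex_of_real (cross3 (axis i 1) m $ l) * complex_of_real (cross3 (axis i 1) m $ k))
    = of_real (axis l 1 $ k) - of_real (m $ l) * of_real (m $ k)"
proof -
  let ?x = "\<lambda>k. complex_of_real (m $ k)"
  have "(\<Sum>i\<in>UNIV. complex_of_real (cross3 (axis i 1) m $ l) * complex_of_real (cross3 (axis i 1) m $ k))
    = of_real (axis l 1 $ k) - ?x l * ?x k + of_real (axis l 1 $ k) * ((?x 1)\<^sup>2 + (?x 2)\<^sup>2 + (?x 3)\<^sup>2 - 1)"
    by (insert exhaust_3[of l] exhaust_3[of k], elim disjE;
        simp add: sum_3 axis_components cross_axis power2_eq_square algebra_simps)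
  then show ?thesis by (simp add: norm_1_components[OF assms])
qed

text \<open>
  Both sides are second-order operators in the ambient derivatives of \<open>f\<close>, whose coefficients are compared.
  The tangential projection \<open>P\<close> satisfies \<open>P\<^sup>T P = P\<close> and the rotational fields \<open>C\<close> satisfy \<open>C\<^sup>T C = P\<close>, so
  the second-order parts agree. The first-order part is \<open>- 2 m \<bullet> \<nabla>f\<close> on both sides.
\<close>

lemma laplace_beltrami_smooth_eq_casimir:
  assumes f: "smooth f" and m: "norm m = 1"
  shows "laplace_beltrami_smooth f m = casimir f m"
proof -
  let ?x = "\<lambda>k. complex_of_real (m $ k)" and ?\<delta> = "\<lambda>i k. complex_of_real (axis i 1 $ k)"
  let ?p = "\<lambda>k. partial k f m" and ?q = "\<lambda>l k. partial l (partial k f) m"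
  let ?P = "\<lambda>i k. ?\<delta> i k - ?x i * ?x k"
  let ?C = "\<lambda>i k. complex_of_real (cross3 (axis i 1) m $ k)"
  let ?d = "\<lambda>i l k. - (?x i * ?\<delta> l k + ?\<delta> l i * ?x k)"
  let ?e = "\<lambda>i l k. complex_of_real (cross3 (axis i 1) (axis l 1) $ k)"
  have unit: "(?x 1)\<^sup>2 + (?x 2)\<^sup>2 + (?x 3)\<^sup>2 = 1"
    by (rule norm_1_components[OF m])
  have PP: "(\<Sum>i\<in>UNIV. ?P i l * ?P i k) = ?P l k" for l k
  proof -
    have "(\<Sum>i\<in>UNIV. ?P i l * ?P i k) = ?P l k + ?x l * ?x k * ((?x 1)\<^sup>2 + (?x 2)\<^sup>2 + (?x 3)\<^sup>2 - 1)"
      by (insert exhaust_3[of l] exhaust_3[of k], elim disjE;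
          simp add: sum_3 axis_components power2_eq_square algebra_simps)
    then show ?thesis by (simp add: unit)
  qed
  have CC: "(\<Sum>i\<in>UNIV. ?C i l * ?C i k) = ?P l k" for l k
    by (rule cross_axis_gram[OF m])
  have nP: "(\<Sum>i\<in>UNIV. - ?x i * ?P i k) = 0" for k
  proof -
    have "(\<Sum>i\<in>UNIV. - ?x i * ?P i k) = ?x k * ((?x 1)\<^sup>2 + (?x 2)\<^sup>2 + (?x 3)\<^sup>2 - 1)"
      by (insert exhaust_3[of k], elim disjE;
          simp add: sum_3 axis_components power2_eq_square algebra_simps)
    then show ?thesis by (simp add: unit)
  qed
  have Pd: "(\<Sum>i\<in>UNIV. \<Sum>l\<in>UNIV. ?P i l * ?d i l k) = - 2 * ?x k" for k
  proof -
    have "(\<Sum>i\<in>UNIV. \<Sum>l\<in>UNIV. ?P i l * ?d i l k)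
        = - 2 * ?x k + 2 * ?x k * ((?x 1)\<^sup>2 + (?x 2)\<^sup>2 + (?x 3)\<^sup>2 - 1)"
      by (insert exhaust_3[of k], elim disjE;
          simp add: sum_3 axis_components power2_eq_square algebra_simps)
    then show ?thesis by (simp add: unit)
  qed
  have Ce: "(\<Sum>i\<in>UNIV. \<Sum>l\<in>UNIV. ?C i l * ?e i l k) = - 2 * ?x k" for k
    by (insert exhaust_3[of k], elim disjE; simp add: sum_3 axis_def cross_components)
  have "laplace_beltrami_smooth f m = (\<Sum>i\<in>UNIV. - ?x i * tangential_gradient i f m
      + (\<Sum>l\<in>UNIV. ?P i l * partial l (tangential_gradient i f) m))"
    by (simp add: laplace_beltrami_smooth_def partial_partial_comp_sgn[OF f m])
  also have "\<dots> = (\<Sum>i\<in>UNIV. - ?x i * (\<Sum>k\<in>UNIV. ?P i k * ?p k)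
      + (\<Sum>l\<in>UNIV. ?P i l * (\<Sum>k\<in>UNIV. ?P i k * ?q l k + ?d i l k * ?p k)))"
    unfolding partial_tangential_gradient[OF f]
    by (simp only: tangential_gradient_def of_real_minus mult_minus_left add_uminus_conv_diff)
  also have "\<dots> = (\<Sum>l\<in>UNIV. \<Sum>k\<in>UNIV. ?P l k * ?q l k) + (\<Sum>k\<in>UNIV. (0 + (- 2 * ?x k)) * ?p k)"
    by (subst second_order_sum_expand) (simp only: PP nP Pd)
  also have "\<dots> = (\<Sum>i\<in>UNIV. 0 * (\<Sum>k\<in>UNIV. ?C i k * ?p k)
      + (\<Sum>l\<in>UNIV. ?C i l * (\<Sum>k\<in>UNIV. ?C i k * ?q l k + ?e i l k * ?p k)))"
    by (subst second_order_sum_expand) (simp add: CC Ce)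
  also have "\<dots> = casimir f m"
    by (simp add: casimir_def rot_smooth_partial smooth_differentiable smooth_rot_smooth f
        partial_rot_smooth)
  finally show ?thesis .
qed

lemma sphere_integral_casimir_symmetric:
  assumes f: "smooth f" and g: "smooth g"
  shows "sphere_integral (\<lambda>m. casimir f m * g m) = sphere_integral (\<lambda>m. f m * casimir g m)"
proof -
  have "sphere_integral (\<lambda>m. rot_smooth i (rot_smooth i f) m * g m)
      = sphere_integral (\<lambda>m. f m * rot_smooth i (rot_smooth i g) m)" for i
    by (simp add: sphere_integral_by_parts f g smooth_rot_smooth)
  then show ?thesis
    unfolding casimir_def sum_distrib_left sum_distrib_right
    by (subst (1 2) sphere_integral_sum)
       (auto intro!: smooth_integrable smooth_mult smooth_rot_smooth f g)
qed

section \<open>Eigenfunctions of the Laplace--Beltrami operator\<close>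

lemma casimir_mult:
  assumes f: "smooth f" and g: "smooth g"
  shows "casimir (\<lambda>m. f m * g m) m = casimir f m * g m + f m * casimir g m
    + 2 * (\<Sum>i\<in>UNIV. rot_smooth i f m * rot_smooth i g m)"
proof -
  have "rot_smooth i (rot_smooth i (\<lambda>m. f m * g m)) m = rot_smooth i (rot_smooth i f) m * g m
      + f m * rot_smooth i (rot_smooth i g) m + 2 * (rot_smooth i f m * rot_smooth i g m)" for i
    by (simp add: rot_smooth_mult f g rot_smooth_add smooth_mult smooth_rot_smooth algebra_simps)
  then show ?thesis
    by (simp add: casimir_def sum.distrib sum_distrib_left sum_distrib_right)
qed

lemma casimir_add:
  assumes "smooth f" "smooth g"
  shows "casimir (\<lambda>m. f m + g m) m = casimir f m + casimir g m"
  by (simp add: casimir_def rot_smooth_add smooth_rot_smooth assms sum.distrib)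

lemma casimir_cmult:
  assumes "smooth f"
  shows "casimir (\<lambda>m. c * f m) m = c * casimir f m"
  by (simp add: casimir_def rot_smooth_cmult smooth_rot_smooth assms sum_distrib_left)

lemma casimir_const: "casimir (\<lambda>m. c) m = 0"
  by (simp add: casimir_def rot_smooth_const)

lemma rot_smooth_linear:
  assumes "linear l"
  shows "rot_smooth i (\<lambda>m. of_real (l m)) = (\<lambda>m. of_real (l (cross3 (axis i 1) m)))"
  by (rule ext, rule rot_smooth_eqI)
     (intro bounded_linear_imp_has_derivative bounded_linear_compose[OF bounded_linear_of_real]
        linear_conv_bounded_linear[THEN iffD1] assms)

text \<open>
  The coordinates are the harmonics of degree 1.
\<close>

lemma casimir_coordinate: "casimir (\<lambda>m. of_real (m $ a)) m = - 2 * of_real (m $ a)"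
proof -
  have "casimir (\<lambda>m. of_real (m $ a)) m
      = (\<Sum>i\<in>UNIV. of_real (cross3 (axis i 1) (cross3 (axis i 1) m) $ a))"
    unfolding casimir_def rot_smooth_coordinate rot_smooth_linear[OF linear_cross_component] ..
  also have "\<dots> = - 2 * of_real (m $ a)"
    by (insert exhaust_3[of a], elim disjE; simp add: sum_3 cross_axis)
  finally show ?thesis .
qed

text \<open>
  For \<open>\<sigma> = \<plusminus> 1\<close> this is \<open>x \<plusminus> \<i> y\<close>, which on the sphere is \<open>sin \<theta> exp (\<plusminus> \<i> \<phi>)\<close>.
\<close>

definition planar :: "complex \<Rightarrow> real^3 \<Rightarrow> complex" where
  "planar \<sigma> m = of_real (m $ 1) + \<sigma> * \<i> * of_real (m $ 2)"

lemma polyfun_planar: "polyfun (planar \<sigma>)"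
  unfolding planar_def[abs_def] by (intro polyfun.intros)

lemma smooth_planar: "smooth (planar \<sigma>)"
  by (rule polyfun_smooth[OF polyfun_planar])

lemma rot_smooth_planar:
  "rot_smooth i (planar \<sigma>) m = of_real (cross3 (axis i 1) m $ 1) + \<sigma> * \<i> * of_real (cross3 (axis i 1) m $ 2)"
  unfolding planar_def[abs_def]
  by (simp add: rot_smooth_add rot_smooth_cmult rot_smooth_coordinate smooth_mult)

lemma casimir_planar: "casimir (planar \<sigma>) m = - 2 * planar \<sigma> m"
  unfolding planar_def[abs_def]
  by (simp add: casimir_add casimir_cmult casimir_coordinate smooth_mult algebra_simps)

lemma smooth_power: "smooth f \<Longrightarrow> smooth (\<lambda>m. f m ^ n)"
  by (induction n) (auto intro: smooth_mult)

lemma rot_smooth_power: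
  assumes "smooth f"
  shows "rot_smooth i (\<lambda>m. f m ^ n) m = of_nat n * f m ^ (n - 1) * rot_smooth i f m"
proof (induction n)
  case (Suc n)
  have "rot_smooth i (\<lambda>m. f m ^ Suc n) m = rot_smooth i f m * f m ^ n + f m * (of_nat n * f m ^ (n - 1) * rot_smooth i f m)"
    using Suc by (simp add: rot_smooth_mult assms smooth_power)
  then show ?case by (cases n) (simp_all add: algebra_simps)
qed (simp add: rot_smooth_const)

text \<open>
  Put \<open>\<tau> = \<sigma> \<i>\<close>. The two sides differ by the multiple \<open>(\<tau>\<^sup>2 + 1) \<bar>m\<bar>\<^sup>2\<close>, and \<open>\<tau>\<^sup>2 = - 1\<close>. This isotropy is why the
  powers of \<open>x \<plusminus> \<i> y\<close> are eigenfunctions.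
\<close>

lemma rot_smooth_planar_square:
  assumes "\<sigma>\<^sup>2 = 1"
  shows "(\<Sum>i\<in>UNIV. rot_smooth i (planar \<sigma>) m * rot_smooth i (planar \<sigma>) m) = - (planar \<sigma> m)\<^sup>2"
proof -
  have *: "\<tau> * - z * (\<tau> * - z) + z * z + (- y + \<tau> * x) * (- y + \<tau> * x)
      = - (x + \<tau> * y)\<^sup>2 + (\<tau> * \<tau> + 1) * (x\<^sup>2 + y\<^sup>2 + z\<^sup>2)" for \<tau> x y z :: complex
    by (simp add: power2_eq_square algebra_simps)
  have "\<sigma> * \<i> * (\<sigma> * \<i>) = \<sigma>\<^sup>2 * (\<i> * \<i>)"
    by (simp only: power2_eq_square mult_ac)
  then have "\<sigma> * \<i> * (\<sigma> * \<i>) + 1 = 0"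
    using assms by simp
  with *[of "\<sigma> * \<i>" "of_real (m $ 3)" "of_real (m $ 2)" "of_real (m $ 1)"] show ?thesis
    by (simp only: sum_3 rot_smooth_planar cross_axis planar_def of_real_minus of_real_0 add_0_left
       add_0_right mult_zero_right mult_zero_left)
qed

lemma casimir_planar_power:
  assumes "\<sigma>\<^sup>2 = 1"
  shows "casimir (\<lambda>m. planar \<sigma> m ^ j) m = - (of_nat j * (of_nat j + 1)) * planar \<sigma> m ^ j"
proof (induction j)
  case (Suc j)
  have "(\<Sum>i\<in>UNIV. rot_smooth i (planar \<sigma>) m * rot_smooth i (\<lambda>m. planar \<sigma> m ^ j) m)
      = of_nat j * planar \<sigma> m ^ (j - 1) * (\<Sum>i\<in>UNIV. rot_smooth i (planar \<sigma>) m * rot_smooth i (planar \<sigma>) m)"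
    by (simp add: rot_smooth_power smooth_planar sum_distrib_left algebra_simps)
  also have "\<dots> = - of_nat j * planar \<sigma> m ^ Suc j"
    unfolding rot_smooth_planar_square[OF assms] by (cases j) (simp_all add: power2_eq_square algebra_simps)
  finally have cross: "(\<Sum>i\<in>UNIV. rot_smooth i (planar \<sigma>) m * rot_smooth i (\<lambda>m. planar \<sigma> m ^ j) m)
      = - of_nat j * planar \<sigma> m ^ Suc j" .
  have "casimir (\<lambda>m. planar \<sigma> m ^ Suc j) m = casimir (planar \<sigma>) m * planar \<sigma> m ^ j
      + planar \<sigma> m * casimir (\<lambda>m. planar \<sigma> m ^ j) m + 2 * (- of_nat j * planar \<sigma> m ^ Suc j)"
    unfolding power_Suc cross[unfolded power_Suc, symmetric] by (rule casimir_mult) (simp_all add: smooth_planar smooth_power)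
  also have "\<dots> = - (of_nat (Suc j) * (of_nat (Suc j) + 1)) * planar \<sigma> m ^ Suc j"
    unfolding casimir_planar Suc by (simp add: algebra_simps)
  finally show ?case .
qed (simp add: casimir_const)

lemma polyfun_poly: "polyfun (\<lambda>m. of_real (poly q (m $ k)))"
proof (induction q)
  case (pCons a q)
  then have "polyfun (\<lambda>m. of_real a + of_real (m $ k) * of_real (poly q (m $ k)))"
    by (intro polyfun.intros)
  then show ?case by simp
qed (auto intro: polyfun.const)

lemma smooth_poly: "smooth (\<lambda>m. of_real (poly q (m $ k)))"
  by (rule polyfun_smooth[OF polyfun_poly])

lemma rot_smooth_poly:
  "rot_smooth i (\<lambda>m. of_real (poly q (m $ k)))
    = (\<lambda>m. of_real (poly (pderiv q) (m $ k)) * of_real (cross3 (axis i 1) m $ k))"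
proof (induction q)
  case 0
  then show ?case by (simp add: rot_smooth_const)
next
  case (pCons a q)
  have "rot_smooth i (\<lambda>m. of_real (poly (pCons a q) (m $ k))) = rot_smooth i (\<lambda>m. of_real a + of_real (m $ k) * of_real (poly q (m $ k)))"
    by simp
  also have "\<dots> = (\<lambda>m. of_real (cross3 (axis i 1) m $ k) * of_real (poly q (m $ k))
      + of_real (m $ k) * (of_real (poly (pderiv q) (m $ k)) * of_real (cross3 (axis i 1) m $ k)))"
    by (simp add: rot_smooth_add rot_smooth_mult smooth_mult smooth_poly rot_smooth_const rot_smooth_coordinate pCons)
  finally show ?case
    by (simp add: fun_eq_iff pderiv_pCons algebra_simps)
qed

lemma casimir_poly_z:
  "casimir (\<lambda>m. of_real (poly q (m $ 3))) m =
    ((of_real (m $ 1))\<^sup>2 + (of_real (m $ 2))\<^sup>2) * of_real (poly (pderiv (pderiv q)) (m $ 3))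
    - 2 * of_real (m $ 3) * of_real (poly (pderiv q) (m $ 3))"
proof -
  have "rot_smooth i (rot_smooth i (\<lambda>m. of_real (poly q (m $ 3)))) m
      = of_real (poly (pderiv (pderiv q)) (m $ 3)) * (of_real (cross3 (axis i 1) m $ 3))\<^sup>2
        + of_real (poly (pderiv q) (m $ 3)) * rot_smooth i (rot_smooth i (\<lambda>m. of_real (m $ 3))) m" for i
    unfolding rot_smooth_poly[of i q] rot_smooth_coordinate
    by (subst rot_smooth_mult) (simp_all add: smooth_poly rot_smooth_poly power2_eq_square mult.assoc)
  then have "casimir (\<lambda>m. of_real (poly q (m $ 3))) m
      = of_real (poly (pderiv (pderiv q)) (m $ 3)) * (\<Sum>i\<in>UNIV. (of_real (cross3 (axis i 1) m $ 3))\<^sup>2)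
        + of_real (poly (pderiv q) (m $ 3)) * casimir (\<lambda>m. of_real (m $ 3)) m"
    by (simp add: casimir_def sum.distrib sum_distrib_left)
  then show ?thesis
    by (simp add: casimir_coordinate sum_3 cross_axis algebra_simps)
qed

text \<open>
  The functions \<open>(x \<plusminus> \<i> y)\<^sup>j q(z)\<close>: every spherical harmonic is a multiple of one, and \<open>q\<close> is kept arbitrary
  because all of them together span the polynomials on the sphere.
\<close>

definition azimuthal :: "complex \<Rightarrow> nat \<Rightarrow> real poly \<Rightarrow> real^3 \<Rightarrow> complex" where
  "azimuthal \<sigma> j q m = planar \<sigma> m ^ j * of_real (poly q (m $ 3))"

lemma polyfun_azimuthal: "polyfun (azimuthal \<sigma> j q)"
  unfolding azimuthal_def[abs_def] by (intro polyfun.mult polyfun_power polyfun_planar polyfun_poly)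

text \<open>
  The product rule reduces the Casimir operator on these functions to the differential operator of the
  \<open>j\<close> times differentiated Legendre equation in \<open>z\<close>; the relation \<open>x\<^sup>2 + y\<^sup>2 = 1 - z\<^sup>2\<close> eliminates the other
  coordinates.
\<close>

lemma casimir_azimuthal:
  assumes \<sigma>: "\<sigma>\<^sup>2 = 1" and m: "norm m = 1"
  shows "casimir (azimuthal \<sigma> j q) m = planar \<sigma> m ^ j *
    of_real ((1 - (m $ 3)\<^sup>2) * poly (pderiv (pderiv q)) (m $ 3)
      - 2 * (real j + 1) * (m $ 3) * poly (pderiv q) (m $ 3) - real j * (real j + 1) * poly q (m $ 3))"
proof -
  let ?Q = "\<lambda>m::real^3. complex_of_real (poly q (m $ 3))" and ?Q' = "of_real (poly (pderiv q) (m $ 3))"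
  let ?w = "planar \<sigma> m" and ?z = "complex_of_real (m $ 3)"
  have "(\<Sum>i\<in>UNIV. rot_smooth i (planar \<sigma>) m * of_real (cross3 (axis i 1) m $ 3)) = - ?z * ?w"
    by (simp add: sum_3 rot_smooth_planar cross_axis planar_def algebra_simps)
  then have "(\<Sum>i\<in>UNIV. rot_smooth i (\<lambda>m. planar \<sigma> m ^ j) m * rot_smooth i ?Q m)
      = of_nat j * ?w ^ (j - 1) * ?Q' * (- ?z * ?w)"
    by (subst sum.cong[OF refl, where h = "\<lambda>i. of_nat j * ?w ^ (j - 1) * ?Q' * (rot_smooth i (planar \<sigma>) m * of_real (cross3 (axis i 1) m $ 3))"])
       (simp_all add: rot_smooth_power smooth_planar rot_smooth_poly flip: sum_distrib_left)
  also have "\<dots> = - of_nat j * ?w ^ j * ?Q' * ?z"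
    by (cases j) (simp_all add: algebra_simps)
  finally have cross: "(\<Sum>i\<in>UNIV. rot_smooth i (\<lambda>m. planar \<sigma> m ^ j) m * rot_smooth i ?Q m)
      = - of_nat j * ?w ^ j * ?Q' * ?z" .
  have xy: "(complex_of_real (m $ 1))\<^sup>2 + (complex_of_real (m $ 2))\<^sup>2 = 1 - ?z\<^sup>2"
    using norm_1_components[OF m] by (simp add: algebra_simps)
  have "casimir (azimuthal \<sigma> j q) m = casimir (\<lambda>m. planar \<sigma> m ^ j) m * ?Q m + ?w ^ j * casimir ?Q m
      + 2 * (- of_nat j * ?w ^ j * ?Q' * ?z)"
    unfolding azimuthal_def[abs_def] cross[symmetric]
    by (rule casimir_mult) (simp_all add: smooth_power smooth_planar smooth_poly)
  then show ?thesis
    unfolding casimir_planar_power[OF \<sigma>] casimir_poly_z xy by (simp add: algebra_simps)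
qed

section \<open>The Legendre equation\<close>

text \<open>
  The power \<open>u = (z\<^sup>2 - 1)\<^sup>k\<close> satisfies \<open>(z\<^sup>2 - 1) u' = 2 k z u\<close>. Differentiating once gives the case \<open>n = 0\<close>, and
  each further derivative turns the identity for \<open>n\<close> into the one for \<open>n + 1\<close>.
\<close>

lemma higher_pderiv_Rodrigues:
  fixes k n :: nat
  defines "u \<equiv> [:-1, 0, 1::real:] ^ k"
  shows "[:-1, 0, 1:] * (pderiv ^^ Suc (Suc n)) u + 2 * (of_nat n + 1 - of_nat k) * [:0, 1:] * (pderiv ^^ Suc n) u
    + (of_nat n + 1) * (of_nat n - 2 * of_nat k) * (pderiv ^^ n) u = 0"
proof -
  let ?X = "[:0, 1::real:]" and ?Z = "[:-1, 0, 1::real:]"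
  have Z': "pderiv ?Z = 2 * ?X" by (simp add: pderiv_pCons numeral_poly)
  have X': "pderiv ?X = 1" by (simp add: pderiv_pCons)
  have smult_nat: "smult (of_nat a) p = of_nat a * p" for a and p :: "real poly"
    by (simp add: of_nat_poly)
  have first: "?Z * pderiv u = 2 * of_nat k * ?X * u"
  proof (cases k)
    case (Suc n)
    show ?thesis
      unfolding u_def Suc pderiv_power_Suc Z' smult_nat by (simp only: power_Suc mult_ac)
  qed (simp add: u_def pderiv_1)
  show ?thesis
  proof (induction n)
    case 0
    have "pderiv (?Z * pderiv u) = pderiv (2 * of_nat k * ?X * u)" using first by simp
    then show ?case
      by (simp add: pderiv_mult Z' X' pderiv_of_nat algebra_simps del: mult_pCons_left mult_pCons_right)
  next
    case (Suc n)
    let ?D = "\<lambda>n. (pderiv ^^ n) u"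
    have D: "pderiv (?D n) = ?D (Suc n)" for n by simp
    have "pderiv (?Z * ?D (Suc (Suc n)) + 2 * (of_nat n + 1 - of_nat k) * ?X * ?D (Suc n)
      + (of_nat n + 1) * (of_nat n - 2 * of_nat k) * ?D n) = 0"
      unfolding Suc by simp
    then show ?case
      by (simp add: pderiv_mult pderiv_add pderiv_diff Z' X' pderiv_of_nat D algebra_simps
           del: mult_pCons_left mult_pCons_right funpow.simps)
  qed
qed

lemma higher_pderiv_legendre:
  "(pderiv ^^ j) (legendre k) = smult (1 / (2 ^ k * fact k)) ((pderiv ^^ (j + k)) ([:-1, 0, 1:] ^ k))"
  unfolding legendre_def by (induction j) (simp_all add: pderiv_smult)

text \<open>
  This is \<open>higher_pderiv_Rodrigues\<close> for \<open>n = j + k\<close>, where \<open>(n + 1) (n - 2k) = j (j + 1) - k (k + 1)\<close>.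
\<close>

lemma legendre_equation:
  defines "P \<equiv> \<lambda>k j. (pderiv ^^ j) (legendre k)"
  shows "(1 - z\<^sup>2) * poly (pderiv (pderiv (P k j))) z - 2 * (real j + 1) * z * poly (pderiv (P k j)) z
     - real j * (real j + 1) * poly (P k j) z = - (real k * (real k + 1)) * poly (P k j) z"
proof -
  have "poly ([:-1, 0, 1:] * (pderiv ^^ Suc (Suc (j + k))) ([:-1, 0, 1:] ^ k)
     + 2 * (of_nat (j + k) + 1 - of_nat k) * [:0, 1:] * (pderiv ^^ Suc (j + k)) ([:-1, 0, 1:] ^ k)
     + (of_nat (j + k) + 1) * (of_nat (j + k) - 2 * of_nat k) * (pderiv ^^ (j + k)) ([:-1, 0, 1:] ^ k)) z = 0"
    unfolding higher_pderiv_Rodrigues by simp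
  then have *: "(z\<^sup>2 - 1) * poly ((pderiv ^^ Suc (Suc (j + k))) ([:-1, 0, 1:] ^ k)) z
     + 2 * (real j + 1) * z * poly ((pderiv ^^ Suc (j + k)) ([:-1, 0, 1:] ^ k)) z
     + (real j + real k + 1) * (real j - real k) * poly ((pderiv ^^ (j + k)) ([:-1, 0, 1:] ^ k)) z = 0"
    by (simp add: power2_eq_square algebra_simps del: funpow.simps)
  let ?c = "1 / (2 ^ k * fact k) :: real"
  have P: "pderiv (P k j) = smult ?c ((pderiv ^^ Suc (j + k)) ([:-1, 0, 1:] ^ k))"
     "pderiv (pderiv (P k j)) = smult ?c ((pderiv ^^ Suc (Suc (j + k))) ([:-1, 0, 1:] ^ k))"
     "P k j = smult ?c ((pderiv ^^ (j + k)) ([:-1, 0, 1:] ^ k))"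
    unfolding P_def higher_pderiv_legendre by (simp_all add: pderiv_smult)
  have "(1 - z\<^sup>2) * (c * a) - 2 * (real j + 1) * z * (c * b) - real j * (real j + 1) * (c * d)
       + real k * (real k + 1) * (c * d)
      = - c * ((z\<^sup>2 - 1) * a + 2 * (real j + 1) * z * b + (real j + real k + 1) * (real j - real k) * d)" for a b c d
    by (simp add: algebra_simps)
  from this[of ?c "poly ((pderiv ^^ Suc (Suc (j + k))) ([:-1, 0, 1:] ^ k)) z" "poly ((pderiv ^^ Suc (j + k)) ([:-1, 0, 1:] ^ k)) z"
      "poly ((pderiv ^^ (j + k)) ([:-1, 0, 1:] ^ k)) z"]
  show ?thesis
    unfolding P(2) unfolding P(1) unfolding P(3) poly_smult * by simp
qed

lemma degree_higher_pderiv: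
  fixes p :: "real poly"
  shows "degree ((pderiv ^^ n) p) = degree p - n"
  by (induction n) (simp_all add: degree_pderiv)

lemma higher_pderiv_neq_0:
  fixes p :: "real poly"
  assumes "p \<noteq> 0" "n \<le> degree p"
  shows "(pderiv ^^ n) p \<noteq> 0"
  using assms(2)
proof (induction n)
  case (Suc n)
  then have "degree ((pderiv ^^ n) p) \<noteq> 0" by (simp add: degree_higher_pderiv)
  then show ?case by (simp add: pderiv_eq_0_iff)
qed (use assms in simp)

lemma
  assumes "j \<le> k"
  shows degree_higher_pderiv_legendre: "degree ((pderiv ^^ j) (legendre k)) = k - j"
    and higher_pderiv_legendre_neq_0: "(pderiv ^^ j) (legendre k) \<noteq> 0"
proof -
  have Z0: "[:-1, 0, 1::real:] ^ k \<noteq> 0" by simp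
  have dZ: "degree ([:-1, 0, 1::real:] ^ k) = 2 * k"
    by (simp add: degree_power_eq)
  have "(pderiv ^^ (j + k)) ([:-1, 0, 1::real:] ^ k) \<noteq> 0"
    by (rule higher_pderiv_neq_0[OF Z0]) (use assms dZ in simp)
  then show "(pderiv ^^ j) (legendre k) \<noteq> 0"
    unfolding higher_pderiv_legendre by simp
  show "degree ((pderiv ^^ j) (legendre k)) = k - j"
    unfolding higher_pderiv_legendre by (simp add: degree_higher_pderiv dZ)
qed

section \<open>Spherical harmonics\<close>

definition orientation :: "int \<Rightarrow> complex" where
  "orientation l = (if l \<ge> 0 then 1 else -1)"

lemma orientation_square: "(orientation l)\<^sup>2 = 1"
  by (simp add: orientation_def)

text \<open>
  This reduces statements about a harmonic to the functions \<open>(x \<plusminus> \<i> y)\<^sup>j q(z)\<close>, up to a nonzero factor.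
\<close>

lemma Y_eq_azimuthal:
  obtains c where "c \<noteq> 0"
    "Y k l = (\<lambda>m. c * azimuthal (orientation l) (nat \<bar>l\<bar>) ((pderiv ^^ nat \<bar>l\<bar>) (legendre k)) m)"
proof -
  let ?j = "nat \<bar>l\<bar>"
  let ?N = "complex_of_real (sqrt ((2 * real k + 1) / (4 * pi) * (fact (k - ?j) / fact (k + ?j))))"
  let ?c = "?N * (if l \<ge> 0 then (-1) ^ ?j else 1)"
  have "?c \<noteq> 0" by (auto simp: add_nonneg_eq_0_iff)
  moreover have "Y k l = (\<lambda>m. ?c * azimuthal (orientation l) ?j ((pderiv ^^ ?j) (legendre k)) m)"
    by (auto simp: fun_eq_iff Y_def Let_def azimuthal_def planar_def orientation_def complex_eq_iff[of "Complex _ _"] Complex_eq)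
  ultimately show ?thesis by (rule that)
qed

lemma polyfun_Y: "polyfun (Y k l)"
  by (rule Y_eq_azimuthal[of k l]) (auto intro: polyfun.intros polyfun_azimuthal)

lemma smooth_Y: "smooth (Y k l)"
  by (rule polyfun_smooth[OF polyfun_Y])

lemma casimir_Y:
  assumes "norm m = 1"
  shows "casimir (Y k l) m = - (of_nat k * (of_nat k + 1)) * Y k l m"
proof -
  obtain c where c: "Y k l = (\<lambda>m. c * azimuthal (orientation l) (nat \<bar>l\<bar>) ((pderiv ^^ nat \<bar>l\<bar>) (legendre k)) m)"
    using Y_eq_azimuthal by blast
  show ?thesis
    unfolding c
    by (subst casimir_cmult[OF polyfun_smooth[OF polyfun_azimuthal]])
       (unfold casimir_azimuthal[OF orientation_square assms] legendre_equation, simp add: azimuthal_def)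
qed

text \<open>
  The third rotational derivative is \<open>d/d\<phi>\<close>, and the harmonic of order \<open>l\<close> depends on \<open>\<phi>\<close> through \<open>exp (\<i> l \<phi>)\<close>.
\<close>

lemma rot_smooth_3_Y: "rot_smooth 3 (Y k l) m = \<i> * of_int l * Y k l m"
proof -
  let ?\<sigma> = "orientation l" and ?j = "nat \<bar>l\<bar>"
  obtain c where c: "Y k l = (\<lambda>m. c * azimuthal ?\<sigma> ?j ((pderiv ^^ ?j) (legendre k)) m)"
    using Y_eq_azimuthal by blast
  have "rot_smooth 3 (planar ?\<sigma>) m = ?\<sigma> * \<i> * planar ?\<sigma> m"
    by (simp add: rot_smooth_planar cross_axis planar_def orientation_def algebra_simps)
  then have "rot_smooth 3 (\<lambda>m. planar ?\<sigma> m ^ ?j) m = \<i> * (of_nat ?j * ?\<sigma>) * planar ?\<sigma> m ^ ?j"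
    unfolding rot_smooth_power[OF smooth_planar] by (cases ?j) (simp_all add: algebra_simps)
  also have "of_nat ?j * ?\<sigma> = of_int l"
    by (simp add: orientation_def)
  finally show ?thesis
    unfolding c azimuthal_def[abs_def]
    by (simp add: rot_smooth_cmult rot_smooth_mult smooth_mult smooth_power smooth_planar smooth_poly rot_smooth_poly cross_axis)
qed

section \<open>Orthogonality and completeness of the spherical harmonics\<close>

text \<open>
  Applied with \<open>f\<close> another eigenfunction, this makes the pairing of eigenfunctions for different eigenvalues
  vanish.
\<close>

lemma sphere_integral_casimir_eigen:
  assumes f: "smooth f" and u: "smooth u" "\<And>m. norm m = 1 \<Longrightarrow> casimir u m = \<mu> * u m"
  shows "\<mu> * sphere_integral (\<lambda>m. f m * u m) = sphere_integral (\<lambda>m. casimir f m * u m)"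
proof -
  have "sphere_integral (\<lambda>m. casimir f m * u m) = sphere_integral (\<lambda>m. f m * casimir u m)"
    by (rule sphere_integral_casimir_symmetric[OF f u(1)])
  also have "\<dots> = sphere_integral (\<lambda>m. \<mu> * (f m * u m))"
    by (rule sphere_integral_cong) (simp add: u(2))
  finally show ?thesis by (simp add: sphere_integral_cmult)
qed

lemma pronic_eq_iff: "k * (k + 1) = k' * (k' + 1) \<longleftrightarrow> k = k'" for k k' :: nat
proof
  assume eq: "k * (k + 1) = k' * (k' + 1)"
  show "k = k'"
  proof (rule linorder_cases[of k k'])
    assume "k < k'"
    then have "k * (k + 1) < k' * (k' + 1)" by (intro mult_strict_mono) auto
    with eq show ?thesis by simp
  next
    assume "k' < k"
    then have "k' * (k' + 1) < k * (k + 1)" by (intro mult_strict_mono) auto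
    with eq show ?thesis by simp
  qed
qed simp

text \<open>
  Different degrees are orthogonal because the Casimir operator is symmetric and separates them. For the
  orders, the third rotational derivative is antisymmetric and has the eigenvalues \<open>\<i> l\<close> and \<open>\<i> l'\<close>, so the
  pairing vanishes unless \<open>l + l' = 0\<close>.
\<close>

lemma Y_orthogonal:
  assumes "k \<noteq> k' \<or> l' \<noteq> - l"
  shows "sphere_integral (\<lambda>m. Y k l m * Y k' l' m) = 0"
  using assms
proof
  assume "k \<noteq> k'"
  have "- (of_nat k' * (of_nat k' + 1)) * sphere_integral (\<lambda>m. Y k l m * Y k' l' m)
      = sphere_integral (\<lambda>m. casimir (Y k l) m * Y k' l' m)"
    by (rule sphere_integral_casimir_eigen) (simp_all add: smooth_Y casimir_Y)
  also have "\<dots> = sphere_integral (\<lambda>m. - (of_nat k * (of_nat k + 1)) * (Y k l m * Y k' l' m))"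
    by (rule sphere_integral_cong) (simp add: casimir_Y)
  finally have "of_nat (k' * (k' + 1)) * sphere_integral (\<lambda>m. Y k l m * Y k' l' m)
      = of_nat (k * (k + 1)) * sphere_integral (\<lambda>m. Y k l m * Y k' l' m)"
    unfolding sphere_integral_cmult by (simp add: algebra_simps)
  moreover have "complex_of_nat (k' * (k' + 1)) \<noteq> of_nat (k * (k + 1))"
    unfolding of_nat_eq_iff pronic_eq_iff using \<open>k \<noteq> k'\<close> by simp
  ultimately show ?thesis by (metis mult_right_cancel)
next
  assume l: "l' \<noteq> - l"
  have "\<i> * of_int l * sphere_integral (\<lambda>m. Y k l m * Y k' l' m)
      = sphere_integral (\<lambda>m. rot_smooth 3 (Y k l) m * Y k' l' m)"
    by (simp add: rot_smooth_3_Y mult.assoc sphere_integral_cmult)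
  also have "\<dots> = - sphere_integral (\<lambda>m. Y k l m * rot_smooth 3 (Y k' l') m)"
    by (rule sphere_integral_by_parts[OF smooth_Y smooth_Y])
  also have "\<dots> = - (\<i> * of_int l' * sphere_integral (\<lambda>m. Y k l m * Y k' l' m))"
    by (simp add: rot_smooth_3_Y mult.left_commute[of "Y k l _"] mult.assoc sphere_integral_cmult)
  finally have "\<i> * (of_int (l + l') * sphere_integral (\<lambda>m. Y k l m * Y k' l' m)) = 0"
    by (simp add: algebra_simps)
  moreover have "complex_of_int (l + l') \<noteq> 0" using l by (subst of_int_eq_0_iff) auto
  ultimately show ?thesis by simp
qed

lemma smooth_ae_zero:
  assumes f: "smooth f" "ae_eq f (\<lambda>m. 0)" and m: "norm m = 1"
  shows "f m = 0"
proof (rule ccontr)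
  assume fm: "f m \<noteq> 0"
  let ?V = "f -` (- {0})"
  have "open ?V"
    using smooth_continuous[OF f(1), of UNIV] by (intro open_vimage) auto
  have "emeasure sphere_measure (?V \<inter> sphere 0 1) \<noteq> 0"
    by (rule emeasure_sphere_measure_open_pos[OF \<open>open ?V\<close>]) (use fm m in auto)
  moreover have "?V \<inter> sphere 0 1 \<in> sets sphere_measure"
    using \<open>open ?V\<close> by (simp add: in_sets_sphere_measure)
  moreover have "AE x in sphere_measure. x \<notin> ?V \<inter> sphere 0 1"
    using f(2) unfolding ae_eq_def by eventually_elim simp
  ultimately show False using AE_iff_null_sets null_setsD1 by metis
qed

text \<open>
  The factor \<open>x \<plusminus> \<i> y\<close> is nonzero away from the poles and the polynomial in \<open>z\<close> has finitely many zeros.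
\<close>

lemma Y_nonzero:
  assumes "\<bar>l\<bar> \<le> int k"
  obtains m where "norm m = 1" "Y k l m \<noteq> 0"
proof -
  let ?q = "(pderiv ^^ nat \<bar>l\<bar>) (legendre k)"
  have "?q \<noteq> 0" by (rule higher_pderiv_legendre_neq_0) (use assms in simp)
  then have "finite {z. poly ?q z = 0}" by (rule poly_roots_finite)
  moreover have "infinite {0<..<1::real}" by simp
  ultimately obtain z where z: "0 < z" "z < 1" "poly ?q z \<noteq> 0"
    by (metis (mono_tags, lifting) finite_subset greaterThanLessThan_iff mem_Collect_eq subsetI)
  let ?r = "sqrt (1 - z\<^sup>2)"
  have "z\<^sup>2 < 1" using z by (simp add: power_less_one_iff abs_square_less_1)
  then have r: "?r > 0" "?r\<^sup>2 = 1 - z\<^sup>2" by simp_all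
  define m :: "real^3" where "m = vector [?r, 0, z]"
  have m: "m $ 1 = ?r" "m $ 2 = 0" "m $ 3 = z" by (simp_all add: m_def)
  have "norm m = 1"
    using r by (simp add: norm_eq_1 inner_vec_def sum_3 m power2_eq_square)
  moreover obtain c where "c \<noteq> 0" "Y k l = (\<lambda>m. c * azimuthal (orientation l) (nat \<bar>l\<bar>) ?q m)"
    using Y_eq_azimuthal by blast
  then have "Y k l m \<noteq> 0"
    using z r by (simp add: azimuthal_def planar_def m)
  ultimately show ?thesis by (rule that)
qed

lemma Y_not_ae_zero:
  assumes "\<bar>l\<bar> \<le> int k"
  shows "\<not> ae_eq (Y k l) (\<lambda>m. 0)"
  using Y_nonzero[OF assms] smooth_ae_zero[OF smooth_Y] by metis

lemma Y_minus:
  obtains s where "s \<noteq> 0" "\<And>m. Y k (- l) m = s * cnj (Y k l m)"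
proof -
  have c1: "(cnj (Complex a b))= Complex a (- b)" for a b by (simp add: complex_eq_iff)
  let ?s = "if l = 0 then 1 else (-1) ^ nat \<bar>l\<bar> :: complex"
  have s: "(- 1) ^ n * ((- 1) ^ n * x) = x" for n and x :: complex
    by (simp flip: mult.assoc power_mult_distrib)
  have "Y k (- l) m = ?s * cnj (Y k l m)" for m
    by (auto simp: Y_def Let_def c1 s algebra_simps not_le)
  moreover have "?s \<noteq> 0" by simp
  ultimately show ?thesis using that by blast
qed

text \<open>
  The harmonic of order \<open>- l\<close> is a nonzero multiple of the conjugate of the one of order \<open>l\<close>, so the pairing is
  a multiple of the integral of \<open>\<bar>Y\<bar>\<^sup>2\<close>.
\<close>

lemma Y_pairing_nonzero:
  assumes "\<bar>l\<bar> \<le> int k"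
  shows "sphere_integral (\<lambda>m. Y k l m * Y k (- l) m) \<noteq> 0"
proof
  assume zero: "sphere_integral (\<lambda>m. Y k l m * Y k (- l) m) = 0"
  obtain s where s: "s \<noteq> 0" "\<And>m. Y k (- l) m = s * cnj (Y k l m)"
    using Y_minus by blast
  have "sphere_integral (\<lambda>m. Y k l m * Y k (- l) m) = sphere_integral (\<lambda>m. s * of_real ((norm (Y k l m))\<^sup>2))"
    by (rule sphere_integral_cong) (simp only: s complex_norm_square mult_ac)
  also have "\<dots> = s * of_real (integral\<^sup>L sphere_measure (\<lambda>m. (norm (Y k l m))\<^sup>2))"
    unfolding sphere_integral_cmult unfolding sphere_integral_def integral_complex_of_real ..
  finally have "integral\<^sup>L sphere_measure (\<lambda>m. (norm (Y k l m))\<^sup>2) = 0"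
    using zero s by simp
  moreover have "integrable sphere_measure (\<lambda>m. (norm (Y k l m))\<^sup>2)"
    using smooth_L2_sphere[OF smooth_Y] by (simp add: L2_sphere_def)
  ultimately have "AE m in sphere_measure. (norm (Y k l m))\<^sup>2 = 0"
    by (subst (asm) integral_nonneg_eq_0_iff_AE) auto
  with Y_not_ae_zero[OF assms] show False by (simp add: ae_eq_def)
qed

text \<open>
  A family with exactly one polynomial in each degree spans all polynomials; here in the form of an
  induction rule for properties that are closed under linear combinations.
\<close>

lemma poly_triangular_induct [case_names basis add smult]:
  fixes p :: "nat \<Rightarrow> real poly"
  assumes p: "\<And>n. degree (p n) = n" "\<And>n. p n \<noteq> 0"
    and basis: "\<And>n. P (p n)" and add: "\<And>q r. P q \<Longrightarrow> P r \<Longrightarrow> P (q + r)" and smult: "\<And>a q. P q \<Longrightarrow> P (smult a q)"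
  shows "P q"
proof (induction "degree q" arbitrary: q rule: less_induct)
  case less
  have P0: "P 0" using smult[OF basis, of 0] by simp
  let ?n = "degree q"
  define a where "a = lead_coeff q / lead_coeff (p ?n)"
  define r where "r = q - smult a (p ?n)"
  have "P r"
  proof (cases "?n = 0")
    case True
    then have "degree r = 0" using p(1)[of 0] unfolding r_def by (metis degree_diff_le degree_smult_le le_zero_eq)
    moreover have "coeff r 0 = 0" using p(1)[of 0] leading_coeff_neq_0[OF p(2)[of 0]] True by (simp add: r_def a_def)
    ultimately have "r = 0" by (metis leading_coeff_0_iff)
    then show ?thesis using P0 by simp
  next
    case False
    have "degree r \<le> ?n" unfolding r_def using p(1)[of ?n] degree_smult_le[of a "p ?n"]
      by (intro degree_diff_le) auto
    moreover have "coeff r ?n = 0" using p(1)[of ?n] leading_coeff_neq_0[OF p(2)[of ?n]] by (simp add: r_def a_def)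
    ultimately have "degree r < ?n"
      using False by (metis le_neq_implies_less leading_coeff_0_iff degree_0 )
    then show ?thesis by (rule less)
  qed
  then have "P (r + smult a (p ?n))" by (intro add smult basis)
  then show ?case by (simp add: r_def)
qed

text \<open>
  Since \<open>x\<close> and \<open>y\<close> are combinations of \<open>x + \<i> y\<close> and \<open>x - \<i> y\<close>, every polynomial is in the span of these
  monomials.
\<close>

inductive planar_span :: "(real^3 \<Rightarrow> complex) \<Rightarrow> bool" where
  monomial: "planar_span (\<lambda>m. planar 1 m ^ a * planar (-1) m ^ b * of_real (m $ 3) ^ c)"
| add: "planar_span f \<Longrightarrow> planar_span g \<Longrightarrow> planar_span (\<lambda>m. f m + g m)"
| cmult: "planar_span f \<Longrightarrow> planar_span (\<lambda>m. s * f m)"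

lemma planar_span_generators:
  assumes "planar_span f"
  shows "planar_span (\<lambda>m. planar 1 m * f m)" "planar_span (\<lambda>m. planar (-1) m * f m)"
    "planar_span (\<lambda>m. of_real (m $ 3) * f m)"
  using assms
proof (induction rule: planar_span.induct)
  case (monomial a b c)
  {
    case 1
    show ?case using planar_span.monomial[of "Suc a" b c] by (simp add: mult_ac)
  next
    case 2
    show ?case using planar_span.monomial[of a "Suc b" c] by (simp add: mult_ac)
  next
    case 3
    show ?case using planar_span.monomial[of a b "Suc c"] by (simp add: mult_ac)
  }
next
  case (add f g)
  { case 1 show ?case using planar_span.add[OF add.IH(1) add.IH(4)] by (simp add: algebra_simps)
  next case 2 show ?case using planar_span.add[OF add.IH(2) add.IH(5)] by (simp add: algebra_simps)
  next case 3 show ?case using planar_span.add[OF add.IH(3) add.IH(6)] by (simp add: algebra_simps) }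
next
  case (cmult f s)
  { case 1 show ?case using planar_span.cmult[OF cmult.IH(1), of s] by (simp add: algebra_simps)
  next case 2 show ?case using planar_span.cmult[OF cmult.IH(2), of s] by (simp add: algebra_simps)
  next case 3 show ?case using planar_span.cmult[OF cmult.IH(3), of s] by (simp add: algebra_simps) }
qed

lemma planar_span_coordinate:
  assumes f: "planar_span f"
  shows "planar_span (\<lambda>m. of_real (m $ k) * f m)"
proof -
  note gen = planar_span_generators[OF f]
  consider "k = 1" | "k = 2" | "k = 3" using exhaust_3 by blast
  then show ?thesis
  proof cases
    case 1
    have "(\<lambda>m. complex_of_real (m $ k) * f m) = (\<lambda>m. 1/2 * (planar 1 m * f m + planar (-1) m * f m))"
      by (simp add: fun_eq_iff 1 planar_def algebra_simps)
    then show ?thesis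
      by (rule ssubst[where P = planar_span]) (intro planar_span.cmult planar_span.add gen)
  next
    case 2
    have i: "\<i> * (\<i> * c) = - c" for c by (simp flip: mult.assoc)
    have "(\<lambda>m. complex_of_real (m $ k) * f m) = (\<lambda>m. (- \<i>/2) * (planar 1 m * f m + (-1) * (planar (-1) m * f m)))"
      by (simp add: fun_eq_iff 2 planar_def algebra_simps i)
    then show ?thesis
      by (rule ssubst[where P = planar_span]) (intro planar_span.cmult planar_span.add gen)
  next
    case 3
    then show ?thesis using gen(3) by simp
  qed
qed

lemma polyfun_mult_planar_span: "polyfun p \<Longrightarrow> planar_span f \<Longrightarrow> planar_span (\<lambda>m. p m * f m)"
proof (induction arbitrary: f rule: polyfun.induct)
  case (const c)
  then show ?case by (rule planar_span.cmult)
next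
  case (coordinate k)
  then show ?case by (rule planar_span_coordinate)
next
  case (add p q)
  then show ?case using planar_span.add[OF add.IH(1)[OF add.prems] add.IH(2)[OF add.prems]] by (simp add: algebra_simps)
next
  case (mult p q)
  then show ?case using mult.IH(1)[OF mult.IH(2)[OF mult.prems]] by (simp add: mult.assoc)
qed

lemma polyfun_planar_span:
  assumes "polyfun p"
  shows "planar_span p"
proof -
  have "planar_span (\<lambda>m. planar 1 m ^ 0 * planar (-1) m ^ 0 * of_real (m $ 3) ^ 0)"
    by (rule planar_span.monomial)
  from polyfun_mult_planar_span[OF assms this] show ?thesis by simp
qed

lemma planar_span_smooth: "planar_span f \<Longrightarrow> smooth f"
  by (induction rule: planar_span.induct)
     (intro smooth_mult smooth_add smooth_power smooth_planar smooth_coordinate smooth_const; assumption)+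

text \<open>
  For fixed \<open>j\<close>, the \<open>j\<close>-th derivatives of the Legendre polynomials of degree \<open>k \<ge> j\<close> have degrees 0, 1, 2, \<open>\<dots>\<close>,
  so \<open>g\<close> is orthogonal to \<open>(x \<plusminus> \<i> y)\<^sup>j q(z)\<close> for all \<open>q\<close>. On the sphere \<open>(x + \<i> y) (x - \<i> y) = 1 - z\<^sup>2\<close>, so every
  monomial in \<open>x + \<i> y\<close>, \<open>x - \<i> y\<close> and \<open>z\<close> is of this form, and \<open>g\<close> is orthogonal to all polynomials.
\<close>

lemma Y_complete:
  assumes g: "g \<in> L2_sphere"
    and zero: "\<And>k l. \<bar>l\<bar> \<le> int k \<Longrightarrow> sphere_integral (\<lambda>m. g m * Y k l m) = 0"
  shows "ae_eq g (\<lambda>m. 0)"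
proof (rule polyfun_total)
  show "integrable sphere_measure g" by (rule L2_sphere_integrable[OF g])
  have azimuthal_zero: "sphere_integral (\<lambda>m. g m * azimuthal \<sigma> j q m) = 0" if \<sigma>: "\<sigma> = 1 \<or> \<sigma> = -1" for \<sigma> j q
  proof (rule poly_triangular_induct[where p = "\<lambda>n. (pderiv ^^ j) (legendre (j + n))"])
    show "degree ((pderiv ^^ j) (legendre (j + n))) = n" for n
      by (simp add: degree_higher_pderiv_legendre)
    show "(pderiv ^^ j) (legendre (j + n)) \<noteq> 0" for n
      by (simp add: higher_pderiv_legendre_neq_0)
    show "sphere_integral (\<lambda>m. g m * azimuthal \<sigma> j ((pderiv ^^ j) (legendre (j + n))) m) = 0" for n
    proof -
      \<comment> \<open>For \<open>j = 0\<close> both signs \<open>\<sigma>\<close> give the same function, while \<open>l = 0\<close> has positive orientation.\<close>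
      obtain l where l: "nat \<bar>l\<bar> = j" "orientation l = \<sigma> \<or> j = 0"
        using \<sigma> that[of "int j"] that[of "- int j"] by (cases "j = 0") (auto simp: orientation_def)
      obtain c where c: "c \<noteq> 0" "Y (j + n) l = (\<lambda>m. c * azimuthal (orientation l) (nat \<bar>l\<bar>) ((pderiv ^^ nat \<bar>l\<bar>) (legendre (j + n))) m)"
        using Y_eq_azimuthal by blast
      have "azimuthal (orientation l) j = azimuthal \<sigma> j"
        using l(2) by (auto simp: fun_eq_iff azimuthal_def)
      then have "Y (j + n) l = (\<lambda>m. c * azimuthal \<sigma> j ((pderiv ^^ j) (legendre (j + n))) m)"
        using c(2) l(1) by simp
      moreover have "sphere_integral (\<lambda>m. g m * Y (j + n) l m) = 0"
        by (rule zero) (use l(1) in auto)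
      ultimately have "c * sphere_integral (\<lambda>m. g m * azimuthal \<sigma> j ((pderiv ^^ j) (legendre (j + n))) m) = 0"
        by (simp add: mult.left_commute[of _ c] sphere_integral_cmult)
      with c(1) show ?thesis by simp
    qed
    fix q r
    assume "sphere_integral (\<lambda>m. g m * azimuthal \<sigma> j q m) = 0" "sphere_integral (\<lambda>m. g m * azimuthal \<sigma> j r m) = 0"
    then have "sphere_integral (\<lambda>m. g m * azimuthal \<sigma> j q m + g m * azimuthal \<sigma> j r m) = 0"
      by (subst sphere_integral_add) (auto intro!: L2_mult_smooth_integrable g polyfun_smooth polyfun_azimuthal)
    then show "sphere_integral (\<lambda>m. g m * azimuthal \<sigma> j (q + r) m) = 0"
      by (simp add: azimuthal_def algebra_simps)
  next
    fix a q
    assume "sphere_integral (\<lambda>m. g m * azimuthal \<sigma> j q m) = 0"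
    then have "sphere_integral (\<lambda>m. of_real a * (g m * azimuthal \<sigma> j q m)) = 0"
      unfolding sphere_integral_cmult by simp
    then show "sphere_integral (\<lambda>m. g m * azimuthal \<sigma> j (smult a q) m) = 0"
      by (simp add: azimuthal_def mult_ac)
  qed
  fix p assume "polyfun p"
  then have "planar_span p" by (rule polyfun_planar_span)
  then show "sphere_integral (\<lambda>m. g m * p m) = 0"
  proof (induction rule: planar_span.induct)
    case (monomial a b c)
    let ?q = "\<lambda>e. [:1, 0, -1:] ^ e * [:0, 1::real:] ^ c"
    have prod: "planar 1 m * planar (-1) m = of_real (poly [:1, 0, -1:] (m $ 3))" if "norm m = 1" for m
    proof -
      have "planar 1 m * planar (-1) m = (of_real (m $ 1))\<^sup>2 + (of_real (m $ 2))\<^sup>2"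
        by (simp add: planar_def power2_eq_square algebra_simps)
      then show ?thesis
        using norm_1_components[OF that] by (simp add: algebra_simps power2_eq_square)
    qed
    show ?case
    proof (cases "b \<le> a")
      case True
      then obtain d where a: "a = b + d" using le_Suc_ex by blast
      have "planar 1 m ^ a * planar (-1) m ^ b * of_real (m $ 3) ^ c = azimuthal 1 d (?q b) m" if "norm m = 1" for m
      proof -
        have "planar 1 m ^ a * planar (-1) m ^ b * of_real (m $ 3) ^ c
            = planar 1 m ^ d * ((planar 1 m * planar (-1) m) ^ b * of_real (m $ 3) ^ c)"
          by (simp add: a power_add power_mult_distrib mult_ac)
        then show ?thesis
          unfolding prod[OF that] by (simp add: azimuthal_def)
      qed
      then have "sphere_integral (\<lambda>m. g m * (planar 1 m ^ a * planar (-1) m ^ b * of_real (m $ 3) ^ c))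
          = sphere_integral (\<lambda>m. g m * azimuthal 1 d (?q b) m)"
        by (intro sphere_integral_cong) simp
      then show ?thesis by (simp add: azimuthal_zero)
    next
      case False
      then obtain d where b: "b = a + d" using le_Suc_ex nat_le_linear by blast
      have "planar 1 m ^ a * planar (-1) m ^ b * of_real (m $ 3) ^ c = azimuthal (-1) d (?q a) m" if "norm m = 1" for m
      proof -
        have "planar 1 m ^ a * planar (-1) m ^ b * of_real (m $ 3) ^ c
            = planar (-1) m ^ d * ((planar 1 m * planar (-1) m) ^ a * of_real (m $ 3) ^ c)"
          by (simp add: b power_add power_mult_distrib mult_ac)
        then show ?thesis
          unfolding prod[OF that] by (simp add: azimuthal_def)
      qed
      then have "sphere_integral (\<lambda>m. g m * (planar 1 m ^ a * planar (-1) m ^ b * of_real (m $ 3) ^ c))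
          = sphere_integral (\<lambda>m. g m * azimuthal (-1) d (?q a) m)"
        by (intro sphere_integral_cong) simp
      then show ?thesis by (simp add: azimuthal_zero)
    qed
  next
    case (add f h)
    then show ?case
      by (simp add: distrib_left sphere_integral_add L2_mult_smooth_integrable g planar_span_smooth)
  next
    case (cmult f s)
    then show ?case by (simp add: mult.left_commute[of _ s] sphere_integral_cmult)
  qed
qed

section \<open>Moments of the sphere and the interaction operator\<close>

lemma sphere_integral_const: "sphere_integral (\<lambda>m. c) = of_real (4 * pi) * c"
  by (simp add: sphere_integral_def measure_sphere_measure scaleR_conv_of_real)

text \<open>
  The sum is the \<open>a\<close>-th component of the tangential gradient of \<open>F\<close>, because the rotational derivatives of the
  coordinate \<open>m\<^sub>a\<close> are the components of \<open>e\<^sub>i \<times> m\<close>. Integrating by parts leaves \<open>F\<close> times minus the Laplacian of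
  \<open>m\<^sub>a\<close>, which is \<open>2 m\<^sub>a\<close>.
\<close>

lemma gradient_by_parts:
  assumes F: "smooth F"
  shows "sphere_integral (\<lambda>m. \<Sum>i\<in>UNIV. of_real (cross3 (axis i 1) m $ a) * rot_smooth i F m)
    = 2 * sphere_integral (\<lambda>m. of_real (m $ a) * F m)"
proof -
  let ?x = "\<lambda>m::real^3. complex_of_real (m $ a)"
  have "sphere_integral (\<lambda>m. \<Sum>i\<in>UNIV. of_real (cross3 (axis i 1) m $ a) * rot_smooth i F m)
    = (\<Sum>i\<in>UNIV. sphere_integral (\<lambda>m. rot_smooth i ?x m * rot_smooth i F m))"
    unfolding rot_smooth_coordinate
    by (rule sphere_integral_sum) (intro smooth_integrable smooth_mult smooth_rot_smooth smooth_cross_component F)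
  also have "\<dots> = (\<Sum>i\<in>UNIV. - sphere_integral (\<lambda>m. rot_smooth i (rot_smooth i ?x) m * F m))"
    by (intro sum.cong refl) (simp add: sphere_integral_by_parts[of "rot_smooth _ _"] smooth_rot_smooth F)
  also have "\<dots> = - sphere_integral (\<lambda>m. casimir ?x m * F m)"
    unfolding casimir_def sum_distrib_right sum_negf
    by (subst sphere_integral_sum) (auto intro!: smooth_integrable smooth_mult smooth_rot_smooth F)
  also have "\<dots> = 2 * sphere_integral (\<lambda>m. ?x m * F m)"
    by (simp add: casimir_coordinate mult.assoc sphere_integral_cmult[of "-2", simplified] sphere_integral_cmult)
  finally show ?thesis .
qed

text \<open>
  With \<open>F = m\<^sub>b\<close> in the previous lemma, \<open>2 M = 4\<pi> \<delta> - M\<close>.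
\<close>

lemma second_moment:
  "sphere_integral (\<lambda>m. of_real (m $ a) * of_real (m $ b)) = of_real (4 * pi / 3) * of_real (axis a 1 $ b)"
proof -
  let ?M = "sphere_integral (\<lambda>m. of_real (m $ a) * of_real (m $ b))"
  have "2 * ?M = sphere_integral (\<lambda>m. \<Sum>i\<in>UNIV. of_real (cross3 (axis i 1) m $ a) * of_real (cross3 (axis i 1) m $ b))"
    unfolding gradient_by_parts[OF smooth_coordinate, of a b, symmetric] rot_smooth_coordinate ..
  also have "\<dots> = sphere_integral (\<lambda>m. of_real (axis a 1 $ b) - of_real (m $ a) * of_real (m $ b))"
    by (rule sphere_integral_cong) (rule cross_axis_gram)
  also have "\<dots> = of_real (4 * pi) * of_real (axis a 1 $ b) - ?M"
    by (subst sphere_integral_diff)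
       (auto intro!: smooth_integrable smooth_mult simp: sphere_integral_const)
  finally show ?thesis by (simp add: field_simps)
qed

text \<open>
  With \<open>F = m\<^sub>b m\<^sub>c m\<^sub>d\<close> in \<open>gradient_by_parts\<close>, twice the moment is a sum of second moments minus three times
  the moment, so the factor is \<open>(4\<pi>/3) / 5\<close>.
\<close>

lemma fourth_moment:
  "sphere_integral (\<lambda>m. of_real (m $ a) * (of_real (m $ b) * (of_real (m $ c) * of_real (m $ d))))
    = of_real (4 * pi / 15) * (of_real (axis a 1 $ b) * of_real (axis c 1 $ d)
        + of_real (axis a 1 $ c) * of_real (axis b 1 $ d) + of_real (axis a 1 $ d) * of_real (axis b 1 $ c))"
proof -
  let ?x = "\<lambda>a (m::real^3). complex_of_real (m $ a)" and ?\<delta> = "\<lambda>a b. complex_of_real (axis a 1 $ b)"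
  let ?C = "\<lambda>i a (m::real^3). complex_of_real (cross3 (axis i 1) m $ a)"
  let ?T = "sphere_integral (\<lambda>m. ?x a m * (?x b m * (?x c m * ?x d m)))"
  have smooth2: "smooth (\<lambda>m. ?x a m * ?x b m)" for a b
    by (intro smooth_mult smooth_coordinate)
  have "2 * ?T = sphere_integral (\<lambda>m. \<Sum>i\<in>UNIV. ?C i a m * rot_smooth i (\<lambda>m. ?x b m * (?x c m * ?x d m)) m)"
    by (rule gradient_by_parts[symmetric]) (intro smooth_mult smooth_coordinate)
  also have "\<dots> = sphere_integral (\<lambda>m. (?\<delta> a b * (?x c m * ?x d m) + (?\<delta> a c * (?x b m * ?x d m)
      + ?\<delta> a d * (?x b m * ?x c m))) - 3 * (?x a m * (?x b m * (?x c m * ?x d m))))"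
  proof (rule sphere_integral_cong)
    fix m :: "real^3" assume m: "norm m = 1"
    have "(\<Sum>i\<in>UNIV. ?C i a m * rot_smooth i (\<lambda>m. ?x b m * (?x c m * ?x d m)) m)
      = (\<Sum>i\<in>UNIV. ?C i a m * ?C i b m) * (?x c m * ?x d m) + (\<Sum>i\<in>UNIV. ?C i a m * ?C i c m) * (?x b m * ?x d m)
        + (\<Sum>i\<in>UNIV. ?C i a m * ?C i d m) * (?x b m * ?x c m)"
      by (simp add: rot_smooth_mult smooth2 rot_smooth_coordinate sum_distrib_right flip: sum.distrib)
         (simp add: algebra_simps)
    then show "(\<Sum>i\<in>UNIV. ?C i a m * rot_smooth i (\<lambda>m. ?x b m * (?x c m * ?x d m)) m)
      = (?\<delta> a b * (?x c m * ?x d m) + (?\<delta> a c * (?x b m * ?x d m)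
      + ?\<delta> a d * (?x b m * ?x c m))) - 3 * (?x a m * (?x b m * (?x c m * ?x d m)))"
      unfolding cross_axis_gram[OF m] by (simp add: algebra_simps)
  qed
  also have "\<dots> = (?\<delta> a b * (of_real (4 * pi / 3) * ?\<delta> c d) + (?\<delta> a c * (of_real (4 * pi / 3) * ?\<delta> b d)
      + ?\<delta> a d * (of_real (4 * pi / 3) * ?\<delta> b c))) - 3 * ?T"
  proof -
    have i2: "integrable sphere_measure (\<lambda>m. e * (?x a m * ?x b m))" for e a b
      by (intro smooth_integrable smooth_mult smooth_const smooth_coordinate)
    have i3: "integrable sphere_measure (\<lambda>m. 3 * (?x a m * (?x b m * (?x c m * ?x d m))))"
      by (intro smooth_integrable smooth_mult smooth_const smooth_coordinate)
    note i4 = Bochner_Integration.integrable_add[OF i2 i2]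
    show ?thesis
      unfolding sphere_integral_diff[OF Bochner_Integration.integrable_add[OF i2 i4] i3]
        sphere_integral_add[OF i2 i4] sphere_integral_add[OF i2 i2] sphere_integral_cmult second_moment ..
  qed
  finally show ?thesis by (simp add: field_simps)
qed

lemma sphere_integral_sum_sum:
  assumes "\<And>a b. integrable sphere_measure (f a b)"
  shows "sphere_integral (\<lambda>m. \<Sum>a\<in>A. \<Sum>b\<in>B. f a b m) = (\<Sum>a\<in>A. \<Sum>b\<in>B. sphere_integral (f a b))"
  by (subst sphere_integral_sum) (auto intro!: Bochner_Integration.integrable_sum assms simp: sphere_integral_sum assms)

definition moment :: "3 \<Rightarrow> 3 \<Rightarrow> (real^3 \<Rightarrow> complex) \<Rightarrow> complex" where
  "moment a b f = sphere_integral (\<lambda>m. of_real (m $ a) * of_real (m $ b) * f m)"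

lemma moment_integrable:
  assumes "f \<in> L2_sphere"
  shows "integrable sphere_measure (\<lambda>m. c * (of_real (m $ a) * of_real (m $ b) * f m))"
proof -
  have "(\<lambda>m. c * (f m * (of_real (m $ a) * of_real (m $ b)))) \<in> L2_sphere"
    by (intro L2_sphere_cmult L2_sphere_mult assms smooth_continuous smooth_mult smooth_coordinate)
  then show ?thesis using L2_sphere_integrable by (simp add: mult_ac)
qed

text \<open>
  For a unit vector \<open>m'\<close> the kernel is \<open>\<bar>m\<bar>\<^sup>2 - (m \<bullet> m')\<^sup>2\<close>, a polynomial in \<open>m\<close>, and integration over \<open>m'\<close> turns its
  coefficients into moments of \<open>f\<close>. In particular \<open>U \<alpha> f\<close> is smooth on the whole space.
\<close>

lemma U_eq:
  assumes f: "f \<in> L2_sphere"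
  shows "U \<alpha> f = (\<lambda>m. of_real \<alpha> * ((\<Sum>a\<in>UNIV. of_real (m $ a) * of_real (m $ a)) * sphere_integral f
     + (-1) * (\<Sum>a\<in>UNIV. \<Sum>b\<in>UNIV. of_real (m $ a) * of_real (m $ b) * moment a b f)))"
proof
  fix m :: "real^3"
  let ?x = "\<lambda>a. complex_of_real (m $ a)"
  let ?s = "\<Sum>a\<in>UNIV. ?x a * ?x a"
  note int = moment_integrable[OF f]
  have int1: "integrable sphere_measure (\<lambda>m'. c * f m')" for c
    by (intro L2_sphere_integrable L2_sphere_cmult f)
  have int2: "integrable sphere_measure (\<lambda>m'. \<Sum>a\<in>UNIV. \<Sum>b\<in>UNIV. c a b * (of_real (m' $ a) * of_real (m' $ b) * f m'))" for c
    by (intro Bochner_Integration.integrable_sum int)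
  have "sphere_integral (\<lambda>m'. of_real ((norm (cross3 m m'))\<^sup>2) * f m')
    = sphere_integral (\<lambda>m'. ?s * f m' - (\<Sum>a\<in>UNIV. \<Sum>b\<in>UNIV. ?x a * ?x b * (of_real (m' $ a) * of_real (m' $ b) * f m')))"
  proof (rule sphere_integral_cong)
    fix m' :: "real^3" assume m': "norm m' = 1"
    have "(norm (cross3 m m'))\<^sup>2 = (norm m)\<^sup>2 - (m \<bullet> m')\<^sup>2"
      using norm_cross_dot[of m m'] m' by simp
    also have "(norm m)\<^sup>2 = (\<Sum>a\<in>UNIV. m $ a * m $ a)"
      unfolding power2_norm_eq_inner inner_vec_def by simp
    also have "(m \<bullet> m')\<^sup>2 = (\<Sum>a\<in>UNIV. \<Sum>b\<in>UNIV. m $ a * m $ b * (m' $ a * m' $ b))"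
      unfolding power2_eq_square inner_vec_def sum_product by (simp add: mult_ac)
    finally have "complex_of_real ((norm (cross3 m m'))\<^sup>2)
       = ?s - (\<Sum>a\<in>UNIV. \<Sum>b\<in>UNIV. ?x a * ?x b * (of_real (m' $ a) * of_real (m' $ b)))"
      by simp
    then show "of_real ((norm (cross3 m m'))\<^sup>2) * f m'
       = ?s * f m' - (\<Sum>a\<in>UNIV. \<Sum>b\<in>UNIV. ?x a * ?x b * (of_real (m' $ a) * of_real (m' $ b) * f m'))"
      by (simp only: left_diff_distrib sum_distrib_right mult.assoc)
  qed
  also have "\<dots> = ?s * sphere_integral f - (\<Sum>a\<in>UNIV. \<Sum>b\<in>UNIV. ?x a * ?x b * moment a b f)"
    unfolding sphere_integral_diff[OF int1 int2] sphere_integral_cmult sphere_integral_sum_sum[OF int] moment_def ..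
  finally show "U \<alpha> f m = of_real \<alpha> * (?s * sphere_integral f + (-1) * (\<Sum>a\<in>UNIV. \<Sum>b\<in>UNIV. ?x a * ?x b * moment a b f))"
    by (simp add: U_def)
qed

lemma smooth_U: "f \<in> L2_sphere \<Longrightarrow> smooth (U \<alpha> f)"
  unfolding U_eq by (intro smooth_mult smooth_add smooth_sum smooth_const smooth_coordinate)

lemma U_mean_zero:
  assumes "f \<in> L2_sphere" "sphere_integral f = 0"
  shows "U \<alpha> f m = - of_real \<alpha> * (\<Sum>a\<in>UNIV. \<Sum>b\<in>UNIV. of_real (m $ a) * of_real (m $ b) * moment a b f)"
  by (simp add: U_eq assms)

text \<open>
  Both sides equal \<open>- \<alpha>\<close> times the sum of the products of the second moments of \<open>f\<close> and \<open>g\<close>.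
\<close>

lemma U_symmetric:
  assumes f: "f \<in> L2_sphere" "sphere_integral f = 0" and g: "g \<in> L2_sphere" "sphere_integral g = 0"
  shows "sphere_integral (\<lambda>m. U \<alpha> f m * g m) = sphere_integral (\<lambda>m. f m * U \<alpha> g m)"
proof -
  have key: "sphere_integral (\<lambda>m. U \<alpha> f m * g m) = - of_real \<alpha> * (\<Sum>a\<in>UNIV. \<Sum>b\<in>UNIV. moment a b f * moment a b g)"
    if f: "f \<in> L2_sphere" "sphere_integral f = 0" and g: "g \<in> L2_sphere" for f g
  proof -
    have "sphere_integral (\<lambda>m. U \<alpha> f m * g m)
      = sphere_integral (\<lambda>m. - of_real \<alpha> * (\<Sum>a\<in>UNIV. \<Sum>b\<in>UNIV. moment a b f * (of_real (m $ a) * of_real (m $ b) * g m)))"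
      unfolding U_mean_zero[OF f]
      by (rule sphere_integral_cong) (simp add: sum_distrib_left sum_distrib_right mult_ac)
    also have "\<dots> = - of_real \<alpha> * (\<Sum>a\<in>UNIV. \<Sum>b\<in>UNIV. moment a b f * moment a b g)"
      unfolding sphere_integral_cmult moment_def[of _ _ g]
      by (simp only: sphere_integral_sum_sum[OF moment_integrable[OF g]] sphere_integral_cmult)
    finally show ?thesis .
  qed
  show ?thesis
    using key[OF f g(1)] key[OF g f(1)] by (simp add: mult.commute)
qed

text \<open>
  The second moments of the uniform density are isotropic, so \<open>U \<alpha> h0\<close> is a multiple of \<open>\<bar>m\<bar>\<^sup>2\<close>, which is constant
  along rotations.
\<close>

lemma rot_smooth_U_h0: "rot_smooth i (U \<alpha> h0) m = 0"
proof -
  have L: "h0 \<in> L2_sphere"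
    unfolding h0_def by (intro smooth_L2_sphere smooth_const)
  have mom: "moment a b h0 = of_real (1/3) * of_real (axis a 1 $ b)" for a b
  proof -
    have "moment a b h0 = of_real (1 / (4 * pi)) * sphere_integral (\<lambda>m. of_real (m $ a) * of_real (m $ b))"
      unfolding moment_def h0_def by (subst sphere_integral_cmult[symmetric]) (simp only: mult_ac)
    then show ?thesis by (simp add: second_moment)
  qed
  have mean: "sphere_integral h0 = 1"
    unfolding h0_def sphere_integral_const by simp
  have Uh0: "U \<alpha> h0 = (\<lambda>m. of_real \<alpha> * of_real (2/3) * (\<Sum>a\<in>UNIV. of_real (m $ a) * of_real (m $ a)))"
    unfolding U_eq[OF L] mom mean by (simp add: fun_eq_iff sum_3 axis_components field_simps)
  have zero: "(\<Sum>a\<in>UNIV. of_real (cross3 (axis i 1) m $ a) * complex_of_real (m $ a) + of_real (m $ a) * of_real (cross3 (axis i 1) m $ a)) = 0"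
    by (insert exhaust_3[of i], elim disjE; simp add: sum_3 cross_axis)
  have sm: "smooth (\<lambda>m. complex_of_real (m $ a) * of_real (m $ a))" for a :: 3
    by (intro smooth_mult smooth_coordinate)
  show ?thesis
    unfolding Uh0 rot_smooth_cmult[OF smooth_sum[OF sm]] rot_smooth_sum[OF sm]
      rot_smooth_mult[OF smooth_coordinate smooth_coordinate] rot_smooth_coordinate zero by simp
qed

lemma sphere_integral_Y:
  assumes "k \<ge> 1"
  shows "sphere_integral (Y k l) = 0"
proof -
  have "- (of_nat k * (of_nat k + 1)) * sphere_integral (\<lambda>m. 1 * Y k l m) = sphere_integral (\<lambda>m. casimir (\<lambda>m. 1) m * Y k l m)"
    by (rule sphere_integral_casimir_eigen) (simp_all add: smooth_Y casimir_Y)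
  then have "of_nat k * (of_nat k + 1) * sphere_integral (Y k l) = 0"
    by (simp add: casimir_const sphere_integral_const)
  then have "of_nat (k * (k + 1)) * sphere_integral (Y k l) = 0"
    by (simp only: of_nat_mult of_nat_add of_nat_1)
  moreover have "complex_of_nat (k * (k + 1)) \<noteq> 0" using assms by (subst of_nat_eq_0_iff) simp
  ultimately show ?thesis by (metis mult_eq_0_iff)
qed

text \<open>
  On the sphere the Casimir operator maps \<open>m\<^sub>a m\<^sub>b\<close> to \<open>- 6 m\<^sub>a m\<^sub>b + 2 \<delta>\<close>, so by symmetry the moment satisfies
  \<open>- k (k + 1) M = - 6 M\<close>, the constant being orthogonal to the harmonic.
\<close>

lemma moment_Y:
  assumes k: "k \<ge> 1" "k \<noteq> 2"
  shows "moment a b (Y k l) = 0"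
proof -
  let ?xx = "\<lambda>m::real^3. complex_of_real (m $ a) * of_real (m $ b)" and ?\<delta> = "complex_of_real (axis a 1 $ b)"
  have cas: "casimir ?xx m = - 6 * ?xx m + 2 * ?\<delta>" if "norm m = 1" for m
    unfolding casimir_mult[OF smooth_coordinate smooth_coordinate] casimir_coordinate rot_smooth_coordinate
      cross_axis_gram[OF that] by simp
  have "- (of_nat k * (of_nat k + 1)) * moment a b (Y k l) = sphere_integral (\<lambda>m. casimir ?xx m * Y k l m)"
    unfolding moment_def by (rule sphere_integral_casimir_eigen) (simp_all add: smooth_Y casimir_Y smooth_mult)
  also have "\<dots> = sphere_integral (\<lambda>m. - 6 * (?xx m * Y k l m) + 2 * ?\<delta> * Y k l m)"
    by (rule sphere_integral_cong) (simp add: cas algebra_simps)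
  also have "\<dots> = - 6 * moment a b (Y k l) + 2 * ?\<delta> * sphere_integral (Y k l)"
    unfolding moment_def
    by (subst sphere_integral_add)
       ((intro smooth_integrable smooth_mult smooth_Y smooth_const smooth_coordinate)+, simp only: sphere_integral_cmult)
  finally have "(of_nat (k * (k + 1)) - of_nat (2 * (2 + 1))) * moment a b (Y k l) = 0"
    unfolding sphere_integral_Y[OF k(1)] by (simp add: algebra_simps)
  moreover have "complex_of_nat (k * (k + 1)) \<noteq> of_nat (2 * (2 + 1))"
    unfolding of_nat_eq_iff pronic_eq_iff using k by simp
  ultimately show ?thesis by (metis eq_iff_diff_eq_0 mult_eq_0_iff)
qed

text \<open>
  By the fourth moments, \<open>\<integral> m\<^sub>a m\<^sub>b f = (4\<pi>/15) (\<delta> tr q + q\<^sub>a\<^sub>b + q\<^sub>b\<^sub>a)\<close>, and the trace vanishes.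
\<close>

lemma U_traceless_quadratic:
  fixes q :: "3 \<Rightarrow> 3 \<Rightarrow> complex"
  assumes f: "smooth f" "\<And>m. norm m = 1 \<Longrightarrow> f m = (\<Sum>c\<in>UNIV. \<Sum>d\<in>UNIV. q c d * (of_real (m $ c) * of_real (m $ d)))"
    and trace: "(\<Sum>c\<in>UNIV. q c c) = 0" and zero: "sphere_integral f = 0" and m: "norm m = 1"
  shows "U \<alpha> f m = - of_real (8 * pi / 15 * \<alpha>) * f m"
proof -
  let ?x = "\<lambda>a. complex_of_real (m $ a)"
  have mom: "moment a b f = of_real (4 * pi / 15) * (q a b + q b a)" for a b
  proof -
    have "moment a b f = sphere_integral (\<lambda>m. \<Sum>c\<in>UNIV. \<Sum>d\<in>UNIV. q c d *
        (of_real (m $ a) * (of_real (m $ b) * (of_real (m $ c) * of_real (m $ d)))))"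
      unfolding moment_def
      by (rule sphere_integral_cong) (simp add: f(2) sum_distrib_left mult_ac)
    also have "\<dots> = (\<Sum>c\<in>UNIV. \<Sum>d\<in>UNIV. q c d * (of_real (4 * pi / 15) * (of_real (axis a 1 $ b) * of_real (axis c 1 $ d)
        + of_real (axis a 1 $ c) * of_real (axis b 1 $ d) + of_real (axis a 1 $ d) * of_real (axis b 1 $ c))))"
      unfolding fourth_moment[symmetric]
      by (subst sphere_integral_sum_sum)
         (intro smooth_integrable smooth_mult smooth_const smooth_coordinate, simp only: sphere_integral_cmult)
    also have "\<dots> = of_real (4 * pi / 15) * (of_real (axis a 1 $ b) * (\<Sum>c\<in>UNIV. q c c) + (q a b + q b a))"
      by (insert exhaust_3[of a] exhaust_3[of b], elim disjE; simp add: sum_3 axis_components algebra_simps)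
    finally show ?thesis by (simp add: trace)
  qed
  have "U \<alpha> f m = - of_real \<alpha> * (\<Sum>a\<in>UNIV. \<Sum>b\<in>UNIV. ?x a * ?x b * (of_real (4 * pi / 15) * (q a b + q b a)))"
    unfolding U_mean_zero[OF smooth_L2_sphere[OF f(1)] zero] mom ..
  also have "\<dots> = - of_real (8 * pi / 15 * \<alpha>) * (\<Sum>c\<in>UNIV. \<Sum>d\<in>UNIV. q c d * (?x c * ?x d))"
    by (simp add: sum_3 algebra_simps)
  finally show ?thesis by (simp add: f(2)[OF m])
qed

text \<open>
  The harmonics of degree 2 are, up to factors, \<open>(3z\<^sup>2 - 1)/2 = z\<^sup>2 - (x\<^sup>2 + y\<^sup>2)/2\<close>, \<open>3 z (x \<plusminus> \<i> y)\<close> and \<open>3 (x \<plusminus> \<i> y)\<^sup>2\<close>.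
\<close>

lemma azimuthal_2_quadratic:
  assumes "\<sigma>\<^sup>2 = 1" "j \<le> 2"
  obtains q :: "3 \<Rightarrow> 3 \<Rightarrow> complex" where "(\<Sum>c\<in>UNIV. q c c) = 0"
    "\<And>m. norm m = 1 \<Longrightarrow> azimuthal \<sigma> j ((pderiv ^^ j) (legendre 2)) m
        = (\<Sum>c\<in>UNIV. \<Sum>d\<in>UNIV. q c d * (of_real (m $ c) * of_real (m $ d)))"
proof -
  have L0: "legendre 2 = [:-1/2, 0, 3/2:]"
    by (simp add: legendre_def numeral_2_eq_2 pderiv_mult pderiv_pCons)
  have L1: "pderiv (legendre 2) = [:0, 3:]" and L2: "pderiv (pderiv (legendre 2)) = [:3:]"
    by (simp_all add: L0 pderiv_pCons)
  have two: "(pderiv ^^ 2) p = pderiv (pderiv p)" for p :: "real poly"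
    by (simp add: numeral_2_eq_2)
  consider "j = 0" | "j = 1" | "j = 2" using assms(2) by linarith
  then show ?thesis
  proof cases
    case 1
    let ?q = "\<lambda>c d :: 3. if c = d then (if c = 3 then 1 else - 1/2) else (0::complex)"
    show ?thesis
    proof (rule that[of ?q])
      fix m :: "real^3" assume m: "norm m = 1"
      have z: "(complex_of_real (m $ 3))\<^sup>2 = 1 - (of_real (m $ 1))\<^sup>2 - (of_real (m $ 2))\<^sup>2"
        using norm_1_components[OF m] by (simp add: algebra_simps)
      show "azimuthal \<sigma> j ((pderiv ^^ j) (legendre 2)) m = (\<Sum>c\<in>UNIV. \<Sum>d\<in>UNIV. ?q c d * (of_real (m $ c) * of_real (m $ d)))"
        by (simp add: 1 azimuthal_def L0 sum_3 z field_simps flip: power2_eq_square)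
    qed (simp add: sum_3)
  next
    case 2
    let ?q = "\<lambda>c d :: 3. if d = 3 then (if c = 1 then 3 else if c = 2 then 3 * \<sigma> * \<i> else 0) else (0::complex)"
    show ?thesis
      by (rule that[of ?q]) (simp_all add: sum_3 2 azimuthal_def planar_def L1 algebra_simps)
  next
    case 3
    let ?q = "\<lambda>c d :: 3. if c = 1 \<and> d = 1 then 3 else if c = 2 \<and> d = 2 then - 3 else if c = 1 \<and> d = 2 then 6 * \<sigma> * \<i> else (0::complex)"
    have s: "(x + \<sigma> * \<i> * y)\<^sup>2 = x\<^sup>2 + 2 * \<sigma> * \<i> * x * y - \<sigma>\<^sup>2 * y\<^sup>2" for x y
      by (simp add: power2_eq_square algebra_simps)
    show ?thesis
      by (rule that[of ?q]) (simp_all add: sum_3 3 azimuthal_def planar_def s assms(1)[unfolded power2_eq_square] L2 two algebra_simps power2_eq_square)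
  qed
qed

lemma U_Y:
  assumes k: "k \<ge> 1" "\<bar>l\<bar> \<le> int k" and m: "norm m = 1"
  shows "U \<alpha> (Y k l) m = (if k = 2 then - of_real (8 * pi / 15 * \<alpha>) else 0) * Y k l m"
proof (cases "k = 2")
  case False
  then show ?thesis
    by (simp add: U_mean_zero smooth_L2_sphere smooth_Y sphere_integral_Y[OF k(1)] moment_Y[OF k(1)])
next
  case True
  obtain c where c: "Y k l = (\<lambda>m. c * azimuthal (orientation l) (nat \<bar>l\<bar>) ((pderiv ^^ nat \<bar>l\<bar>) (legendre k)) m)"
    using Y_eq_azimuthal by blast
  have l: "nat \<bar>l\<bar> \<le> 2" using k True by simp
  obtain q :: "3 \<Rightarrow> 3 \<Rightarrow> complex" where q: "(\<Sum>c\<in>UNIV. q c c) = 0"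
    "\<And>m. norm m = 1 \<Longrightarrow> azimuthal (orientation l) (nat \<bar>l\<bar>) ((pderiv ^^ nat \<bar>l\<bar>) (legendre 2)) m
        = (\<Sum>c\<in>UNIV. \<Sum>d\<in>UNIV. q c d * (of_real (m $ c) * of_real (m $ d)))"
    by (rule azimuthal_2_quadratic[OF orientation_square[of l] l]) blast
  have "U \<alpha> (Y k l) m = - of_real (8 * pi / 15 * \<alpha>) * Y k l m"
  proof (rule U_traceless_quadratic[where q = "\<lambda>a b. c * q a b"])
    show "Y k l m = (\<Sum>a\<in>UNIV. \<Sum>b\<in>UNIV. c * q a b * (of_real (m $ a) * of_real (m $ b)))" if "norm m = 1" for m
      unfolding c unfolding True q(2)[OF that] by (simp only: sum_distrib_left mult.assoc)
    show "(\<Sum>a\<in>UNIV. c * q a a) = 0" by (simp add: q(1) flip: sum_distrib_left)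
  qed (rule smooth_Y sphere_integral_Y k m)+
  with True show ?thesis by simp
qed

section \<open>The linearised operator\<close>

lemma smooth_sobolev_sphere: "smooth f \<Longrightarrow> f \<in> sobolev_sphere k"
proof (induction k arbitrary: f)
  case 0
  then show ?case by (simp add: smooth_L2_sphere)
next
  case (Suc k)
  then show ?case
    using has_weak_rot_smooth smooth_rot_smooth smooth_L2_sphere by (simp, blast)
qed

lemma domG_L2: "f \<in> domG \<Longrightarrow> f \<in> L2_sphere"
  by (simp add: domG_def numeral_2_eq_2)

lemma Y_domG: "k \<ge> 1 \<Longrightarrow> Y k l \<in> domG"
  by (simp add: domG_def smooth_sobolev_sphere smooth_Y sphere_integral_Y)

lemma rot_smooth_ae:
  assumes "smooth f"
  shows "ae_eq (rot i f) (rot_smooth i f)"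
  using has_weak_rot_unique has_weak_rot_rot has_weak_rot_smooth[OF assms] by blast

text \<open>
  The symbol \<^const>\<open>rot\<close> stands for some weak derivative, fixed only up to null sets, so all identities
  between the summands hold almost everywhere. The term with \<open>U \<alpha> h0\<close> vanishes, which turns the summand
  into the \<open>i\<close>-th derivative of \<open>u\<close>; it has a further weak derivative because \<open>f\<close> has two and \<open>U \<alpha> f\<close> is smooth.
\<close>

lemma G_summand_has_weak_rot:
  fixes \<alpha> :: real
  assumes f: "f \<in> domG"
  defines "u \<equiv> \<lambda>m. f m + of_real (1 / (4 * pi)) * U \<alpha> f m"
    and "F \<equiv> \<lambda>i m. rot i f m + h0 m * rot i (U \<alpha> f) m + f m * rot i (U \<alpha> h0) m"
  shows "has_weak_rot i u (F i)" "has_weak_rot i (F i) (rot i (F i))"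
proof -
  let ?c = "complex_of_real (1 / (4 * pi))"
  have fL: "f \<in> L2_sphere" by (rule domG_L2[OF f])
  have h0L: "h0 \<in> L2_sphere"
    unfolding h0_def by (intro smooth_L2_sphere smooth_const)
  note sU = smooth_U[OF fL, of \<alpha>] and sUh = smooth_U[OF h0L, of \<alpha>]
  \<comment> \<open>The derivative that lies in the first Sobolev space is some \<open>g\<close>, of which \<open>rot i f\<close> is a copy up to a null set.\<close>
  obtain g where g: "has_weak_rot i f g" "\<forall>j. \<exists>g'\<in>L2_sphere. has_weak_rot j g g'"
    using f unfolding domG_def numeral_2_eq_2 sobolev_sphere.simps by blast
  obtain g' where g': "has_weak_rot i g g'" using g(2) by blast
  let ?W = "\<lambda>m. g m + ?c * rot_smooth i (U \<alpha> f) m"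
  have W: "has_weak_rot i u ?W"
    unfolding u_def by (intro has_weak_rot_add has_weak_rot_cmult g has_weak_rot_smooth sU)
  have W': "has_weak_rot i ?W (\<lambda>m. g' m + ?c * rot_smooth i (rot_smooth i (U \<alpha> f)) m)"
    by (intro has_weak_rot_add has_weak_rot_cmult g' has_weak_rot_smooth smooth_rot_smooth sU)
  have r: "rot i f \<in> borel_measurable sphere_measure" "rot i (U \<alpha> f) \<in> borel_measurable sphere_measure"
     "rot i (U \<alpha> h0) \<in> borel_measurable sphere_measure" "f \<in> borel_measurable sphere_measure" "h0 \<in> borel_measurable sphere_measure"
    using has_weak_rot_rot[OF g(1)] has_weak_rot_rot[OF has_weak_rot_smooth[OF sU]]
      has_weak_rot_rot[OF has_weak_rot_smooth[OF sUh]] fL h0L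
    unfolding has_weak_rot_def by (auto intro: L2_sphere_borel)
  then have Fm: "F i \<in> borel_measurable sphere_measure"
    unfolding F_def by (intro borel_measurable_add borel_measurable_times)
  have "ae_eq (rot i f) g"
    by (rule has_weak_rot_unique[OF has_weak_rot_rot[OF g(1)] g(1)])
  with rot_smooth_ae[OF sU, of i] rot_smooth_ae[OF sUh, of i] have WF: "ae_eq ?W (F i)"
    unfolding ae_eq_def F_def by eventually_elim (simp add: rot_smooth_U_h0, simp add: h0_def)
  have FL: "F i \<in> L2_sphere"
    using W WF Fm L2_sphere_cong_AE unfolding has_weak_rot_def by blast
  show "has_weak_rot i (F i) (rot i (F i))"
    by (rule has_weak_rot_rot[OF has_weak_rot_cong_AE[OF W' Fm WF]])
  have "sphere_integral (\<lambda>m. F i m * \<phi> m) = sphere_integral (\<lambda>m. ?W m * \<phi> m)" if "smooth \<phi>" for \<phi>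
  proof (rule sphere_integral_cong_AE)
    show "ae_eq (\<lambda>m. F i m * \<phi> m) (\<lambda>m. ?W m * \<phi> m)"
      using WF unfolding ae_eq_def by eventually_elim simp
    show "(\<lambda>m. ?W m * \<phi> m) \<in> borel_measurable sphere_measure"
      using W unfolding has_weak_rot_def
      by (intro borel_measurable_integrable L2_mult_smooth_integrable that) blast
  qed (intro borel_measurable_integrable L2_mult_smooth_integrable that FL)
  with W FL show "has_weak_rot i u (F i)" unfolding has_weak_rot_def by simp
qed

text \<open>
  Moving the two rotational derivatives of each summand to the test function gives the Casimir operator.
\<close>

lemma G_weak:
  fixes \<alpha> :: real
  assumes f: "f \<in> domG"
  defines "u \<equiv> \<lambda>m. f m + of_real (1 / (4 * pi)) * U \<alpha> f m"
  shows "u \<in> L2_sphere" "G \<alpha> h0 f \<in> L2_sphere"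
    "smooth \<phi> \<Longrightarrow> sphere_integral (\<lambda>m. G \<alpha> h0 f m * \<phi> m) = sphere_integral (\<lambda>m. u m * casimir \<phi> m)"
proof -
  let ?F = "\<lambda>i m. rot i f m + h0 m * rot i (U \<alpha> f) m + f m * rot i (U \<alpha> h0) m"
  note w = G_summand_has_weak_rot[OF f, of _ \<alpha>, folded u_def]
  have G: "G \<alpha> h0 f = (\<lambda>m. \<Sum>i\<in>UNIV. rot i (?F i) m)"
    by (simp add: G_def fun_eq_iff)
  have L: "u \<in> L2_sphere" "rot i (?F i) \<in> L2_sphere" for i
    using w unfolding has_weak_rot_def by blast+
  show "u \<in> L2_sphere" by (rule L(1))
  show "G \<alpha> h0 f \<in> L2_sphere"
    unfolding G by (rule L2_sphere_sum[OF L(2)])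
  assume \<phi>: "smooth \<phi>"
  have *: "sphere_integral (\<lambda>m. rot i (?F i) m * \<phi> m) = sphere_integral (\<lambda>m. u m * rot_smooth i (rot_smooth i \<phi>) m)" for i
    using w[of i] \<phi> smooth_rot_smooth[OF \<phi>, of i] unfolding has_weak_rot_def by auto
  show "sphere_integral (\<lambda>m. G \<alpha> h0 f m * \<phi> m) = sphere_integral (\<lambda>m. u m * casimir \<phi> m)"
    unfolding G casimir_def sum_distrib_left sum_distrib_right
    by (subst (1 2) sphere_integral_sum)
       (auto intro!: L2_mult_smooth_integrable L smooth_rot_smooth \<phi> simp: *)
qed

lemma G_has_weak_laplacian:
  assumes "f \<in> domG"
  shows "has_weak_laplacian (\<lambda>m. f m + of_real (1 / (4 * pi)) * U \<alpha> f m) (G \<alpha> h0 f)"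
  unfolding has_weak_laplacian_def
  using G_weak[OF assms, where \<alpha> = \<alpha>]
  by (auto intro!: sphere_integral_cong simp: laplace_beltrami_smooth_eq_casimir)

lemma sphere_integral_mult_Y_0:
  assumes "f \<in> domG"
  shows "sphere_integral (\<lambda>m. f m * Y 0 0 m) = 0"
proof -
  obtain c where "Y 0 0 = (\<lambda>m. c * azimuthal (orientation 0) (nat \<bar>0\<bar>) ((pderiv ^^ nat \<bar>0\<bar>) (legendre 0)) m)"
    using Y_eq_azimuthal by blast
  then have "Y 0 0 m = c" for m by (simp add: azimuthal_def legendre_def)
  with assms show ?thesis
    by (simp add: domG_def mult.commute[of _ c] sphere_integral_cmult)
qed

text \<open>
  Testing with a harmonic moves the Laplacian and, by symmetry, also the interaction operator onto it, and it
  is an eigenfunction of both. For \<open>k = 0\<close> both sides vanish, as the harmonic is constant.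
\<close>

lemma G_coefficient:
  assumes f: "f \<in> domG" and l: "\<bar>l\<bar> \<le> int k"
  shows "sphere_integral (\<lambda>m. G \<alpha> h0 f m * Y k l m) = of_real (eig \<alpha> k) * sphere_integral (\<lambda>m. f m * Y k l m)"
proof -
  let ?c = "complex_of_real (1 / (4 * pi))"
  let ?u = "\<lambda>m. f m + ?c * U \<alpha> f m"
  have fL: "f \<in> L2_sphere" by (rule domG_L2[OF f])
  have f0: "sphere_integral f = 0" using f by (simp add: domG_def)
  have "sphere_integral (\<lambda>m. G \<alpha> h0 f m * Y k l m) = sphere_integral (\<lambda>m. ?u m * casimir (Y k l) m)"
    by (rule G_weak(3)[OF f smooth_Y])
  also have "\<dots> = sphere_integral (\<lambda>m. - (of_nat k * (of_nat k + 1)) * (?u m * Y k l m))"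
    by (rule sphere_integral_cong) (simp add: casimir_Y)
  also have "\<dots> = - (of_nat k * (of_nat k + 1)) * sphere_integral (\<lambda>m. ?u m * Y k l m)"
    by (rule sphere_integral_cmult)
  finally have *: "sphere_integral (\<lambda>m. G \<alpha> h0 f m * Y k l m) = - (of_nat k * (of_nat k + 1)) * sphere_integral (\<lambda>m. ?u m * Y k l m)" .
  show ?thesis
  proof (cases "k = 0")
    case True
    then show ?thesis using * by (simp add: eig_def)
  next
    case False
    then have k: "k \<ge> 1" by simp
    let ?\<nu> = "if k = 2 then - of_real (8 * pi / 15 * \<alpha>) else 0 :: complex"
    let ?I = "sphere_integral (\<lambda>m. f m * Y k l m)"
    have "sphere_integral (\<lambda>m. U \<alpha> f m * Y k l m) = sphere_integral (\<lambda>m. f m * U \<alpha> (Y k l) m)"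
      by (rule U_symmetric[OF fL f0 smooth_L2_sphere[OF smooth_Y] sphere_integral_Y[OF k]])
    also have "\<dots> = sphere_integral (\<lambda>m. ?\<nu> * (f m * Y k l m))"
      by (rule sphere_integral_cong) (simp add: U_Y[OF k l])
    also have "\<dots> = ?\<nu> * ?I"
      by (rule sphere_integral_cmult)
    finally have UY: "sphere_integral (\<lambda>m. U \<alpha> f m * Y k l m) = ?\<nu> * ?I" .
    have "sphere_integral (\<lambda>m. ?u m * Y k l m) = sphere_integral (\<lambda>m. f m * Y k l m + ?c * (U \<alpha> f m * Y k l m))"
      by (simp add: algebra_simps)
    also have "\<dots> = ?I + ?c * (?\<nu> * ?I)"
    proof -
      have int: "integrable sphere_measure (\<lambda>m. f m * Y k l m)"
        "integrable sphere_measure (\<lambda>m. ?c * (U \<alpha> f m * Y k l m))"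
        by (intro L2_mult_smooth_integrable fL smooth_Y,
            intro smooth_integrable smooth_mult smooth_const smooth_Y smooth_U fL)
      show ?thesis
        unfolding sphere_integral_add[OF int] sphere_integral_cmult UY ..
    qed
    finally have "sphere_integral (\<lambda>m. G \<alpha> h0 f m * Y k l m) = - (of_nat k * (of_nat k + 1)) * (?I + ?c * (?\<nu> * ?I))"
      using * by simp
    also have "\<dots> = - (of_nat k * (of_nat k + 1)) * (1 + ?c * ?\<nu>) * ?I"
      by (simp add: algebra_simps)
    also have "- (of_nat k * (of_nat k + 1)) * (1 + ?c * ?\<nu>) = of_real (eig \<alpha> k)"
      by (cases "k = 2") (simp_all add: eig_def field_simps)
    finally show ?thesis .
  qed
qed

text \<open>
  The coefficients of \<open>G \<alpha> h0 f - \<mu> f\<close> are \<open>eig \<alpha> k - \<mu>\<close> times those of \<open>f\<close>, and the harmonics are complete.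
\<close>

lemma G_eigen_iff_coefficients:
  assumes f: "f \<in> domG"
  shows "ae_eq (G \<alpha> h0 f) (\<lambda>m. \<mu> * f m) \<longleftrightarrow>
    (\<forall>k l. \<bar>l\<bar> \<le> int k \<longrightarrow> of_real (eig \<alpha> k) \<noteq> \<mu> \<longrightarrow> sphere_integral (\<lambda>m. f m * Y k l m) = 0)"
proof
  have GL: "G \<alpha> h0 f \<in> L2_sphere" by (rule G_weak(2)[OF f])
  have fL: "f \<in> L2_sphere" by (rule domG_L2[OF f])
  {
    assume ae: "ae_eq (G \<alpha> h0 f) (\<lambda>m. \<mu> * f m)"
    show "\<forall>k l. \<bar>l\<bar> \<le> int k \<longrightarrow> of_real (eig \<alpha> k) \<noteq> \<mu> \<longrightarrow> sphere_integral (\<lambda>m. f m * Y k l m) = 0"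
    proof (intro allI impI)
      fix k l assume l: "\<bar>l\<bar> \<le> int k" and ne: "complex_of_real (eig \<alpha> k) \<noteq> \<mu>"
      have "sphere_integral (\<lambda>m. G \<alpha> h0 f m * Y k l m) = sphere_integral (\<lambda>m. \<mu> * (f m * Y k l m))"
      proof (rule sphere_integral_cong_AE)
        show "ae_eq (\<lambda>m. G \<alpha> h0 f m * Y k l m) (\<lambda>m. \<mu> * (f m * Y k l m))"
          using ae unfolding ae_eq_def by eventually_elim simp
      qed (use GL fL in \<open>auto intro!: borel_measurable_integrable L2_mult_smooth_integrable smooth_Y
             Bochner_Integration.integrable_mult_right\<close>)
      then have "(of_real (eig \<alpha> k) - \<mu>) * sphere_integral (\<lambda>m. f m * Y k l m) = 0"
        unfolding G_coefficient[OF f l] sphere_integral_cmult by (simp add: algebra_simps)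
      with ne show "sphere_integral (\<lambda>m. f m * Y k l m) = 0" by simp
    qed
  }
  assume zero: "\<forall>k l. \<bar>l\<bar> \<le> int k \<longrightarrow> of_real (eig \<alpha> k) \<noteq> \<mu> \<longrightarrow> sphere_integral (\<lambda>m. f m * Y k l m) = 0"
  have "ae_eq (\<lambda>m. G \<alpha> h0 f m - \<mu> * f m) (\<lambda>m. 0)"
  proof (rule Y_complete)
    show "(\<lambda>m. G \<alpha> h0 f m - \<mu> * f m) \<in> L2_sphere"
      by (intro L2_sphere_diff L2_sphere_cmult GL fL)
    fix k l assume l: "\<bar>l\<bar> \<le> int k"
    have "sphere_integral (\<lambda>m. (G \<alpha> h0 f m - \<mu> * f m) * Y k l m)
        = sphere_integral (\<lambda>m. G \<alpha> h0 f m * Y k l m - \<mu> * (f m * Y k l m))"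
      by (simp add: algebra_simps)
    also have "\<dots> = of_real (eig \<alpha> k) * sphere_integral (\<lambda>m. f m * Y k l m) - \<mu> * sphere_integral (\<lambda>m. f m * Y k l m)"
    proof -
      have int: "integrable sphere_measure (\<lambda>m. G \<alpha> h0 f m * Y k l m)"
        "integrable sphere_measure (\<lambda>m. \<mu> * (f m * Y k l m))"
        by (intro L2_mult_smooth_integrable GL fL smooth_Y Bochner_Integration.integrable_mult_right)+
      show ?thesis
        unfolding sphere_integral_diff[OF int] G_coefficient[OF f l] sphere_integral_cmult ..
    qed
    also have "\<dots> = 0" using zero l by (cases "of_real (eig \<alpha> k) = \<mu>") auto
    finally show "sphere_integral (\<lambda>m. (G \<alpha> h0 f m - \<mu> * f m) * Y k l m) = 0" .
  qed
  then show "ae_eq (G \<alpha> h0 f) (\<lambda>m. \<mu> * f m)" by (simp add: ae_eq_def)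
qed

lemma Y_eigenfunction:
  assumes k: "k \<ge> 1" and l: "\<bar>l\<bar> \<le> int k"
  shows "eigenfunction (G \<alpha> h0) domG (of_real (eig \<alpha> k)) (Y k l)"
  unfolding eigenfunction_def G_eigen_iff_coefficients[OF Y_domG[OF k]]
  by (intro conjI Y_domG k Y_not_ae_zero l allI impI Y_orthogonal) auto

text \<open>
  For \<open>k \<noteq> 2\<close> the degree is bounded by \<open>k (k + 1) = \<bar>\<mu>\<bar>\<close>. Finiteness matters because the sum over an infinite set
  would be 0 by convention.
\<close>

lemma finite_eigenvalue_indices:
  "finite {(k, l). k \<ge> 1 \<and> \<bar>l\<bar> \<le> int k \<and> complex_of_real (eig \<alpha> k) = \<mu>}"
proof -
  let ?B = "insert 2 {..nat \<lceil>\<bar>Re \<mu>\<bar>\<rceil>}"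
  have "k \<in> ?B" if "complex_of_real (eig \<alpha> k) = \<mu>" for k
  proof (cases "k = 2")
    case False
    have "Re \<mu> = - (real k * (real k + 1))" using that False by (auto simp: eig_def)
    moreover have "real k * real k \<ge> 0" by simp
    ultimately have "real k \<le> \<bar>Re \<mu>\<bar>" unfolding distrib_left by linarith
    then show ?thesis by (simp add: le_nat_iff) linarith
  qed simp
  then have "{(k, l). k \<ge> 1 \<and> \<bar>l\<bar> \<le> int k \<and> complex_of_real (eig \<alpha> k) = \<mu>} \<subseteq> (SIGMA k:?B. {- int k..int k})"
    by auto
  then show ?thesis by (rule finite_subset) auto
qed

text \<open>
  The combination with the coefficients \<open>c\<close> below has the same pairing as \<open>f\<close> with every harmonic: with those of
  the eigenvalue \<open>\<mu>\<close> by the choice of \<open>c\<close>, and with the others both pairings vanish, in degree 0 because \<open>f\<close> has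
  mean zero.
\<close>

lemma G_eigenspace:
  fixes \<alpha> :: real
  assumes f: "f \<in> domG"
  defines "A \<equiv> \<lambda>\<mu>. {(k, l). k \<ge> 1 \<and> \<bar>l\<bar> \<le> int k \<and> complex_of_real (eig \<alpha> k) = \<mu>}"
  shows "ae_eq (G \<alpha> h0 f) (\<lambda>m. \<mu> * f m) \<longleftrightarrow>
    (\<exists>c :: nat \<Rightarrow> int \<Rightarrow> complex. ae_eq f (\<lambda>m. \<Sum>(k, l) \<in> A \<mu>. c k l * Y k l m))"
proof
  have fL: "f \<in> L2_sphere" by (rule domG_L2[OF f])
  have fin: "finite (A \<mu>)" unfolding A_def by (rule finite_eigenvalue_indices)
  have smooth_comb: "smooth (\<lambda>m. \<Sum>(k, l) \<in> A \<mu>. c k l * Y k l m)" for c :: "nat \<Rightarrow> int \<Rightarrow> complex"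
    unfolding case_prod_unfold by (intro smooth_sum smooth_mult smooth_const smooth_Y)
  have comb: "sphere_integral (\<lambda>m. (\<Sum>(k, l) \<in> A \<mu>. c k l * Y k l m) * Y k' l' m)
      = (\<Sum>(k, l) \<in> A \<mu>. c k l * sphere_integral (\<lambda>m. Y k l m * Y k' l' m))" for c k' l'
  proof -
    have "sphere_integral (\<lambda>m. (\<Sum>(k, l) \<in> A \<mu>. c k l * Y k l m) * Y k' l' m)
      = sphere_integral (\<lambda>m. \<Sum>p\<in>A \<mu>. c (fst p) (snd p) * (Y (fst p) (snd p) m * Y k' l' m))"
      by (simp add: case_prod_unfold sum_distrib_right mult.assoc)
    also have "\<dots> = (\<Sum>p\<in>A \<mu>. sphere_integral (\<lambda>m. c (fst p) (snd p) * (Y (fst p) (snd p) m * Y k' l' m)))"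
      by (rule sphere_integral_sum) (intro smooth_integrable smooth_mult smooth_const smooth_Y)
    finally show ?thesis by (simp add: sphere_integral_cmult case_prod_unfold)
  qed
  {
    assume "ae_eq (G \<alpha> h0 f) (\<lambda>m. \<mu> * f m)"
    then have zero: "sphere_integral (\<lambda>m. f m * Y k l m) = 0" if "\<bar>l\<bar> \<le> int k" "of_real (eig \<alpha> k) \<noteq> \<mu>" for k l
      using that unfolding G_eigen_iff_coefficients[OF f] by blast
    define c where "c k l = sphere_integral (\<lambda>m. f m * Y k (- l) m) / sphere_integral (\<lambda>m. Y k l m * Y k (- l) m)" for k l
    have "ae_eq (\<lambda>m. f m - (\<Sum>(k, l) \<in> A \<mu>. c k l * Y k l m)) (\<lambda>m. 0)"
    proof (rule Y_complete)
      show "(\<lambda>m. f m - (\<Sum>(k, l) \<in> A \<mu>. c k l * Y k l m)) \<in> L2_sphere"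
        by (intro L2_sphere_diff fL smooth_L2_sphere smooth_comb)
      fix k' l' assume l': "\<bar>l'\<bar> \<le> int k'"
      have "(\<Sum>(k, l) \<in> A \<mu>. c k l * sphere_integral (\<lambda>m. Y k l m * Y k' l' m))
          = (\<Sum>p \<in> A \<mu>. if p = (k', - l') then sphere_integral (\<lambda>m. f m * Y k' l' m) else 0)"
      proof (intro sum.cong refl, clarify)
        fix k l
        show "c k l * sphere_integral (\<lambda>m. Y k l m * Y k' l' m)
            = (if (k, l) = (k', - l') then sphere_integral (\<lambda>m. f m * Y k' l' m) else 0)"
        proof (cases "(k, l) = (k', - l')")
          case True
          then show ?thesis using Y_pairing_nonzero[of "- l'" k'] l' by (simp add: c_def)
        next
          case False
          then have "k \<noteq> k' \<or> l' \<noteq> - l" by auto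
          then show ?thesis
            unfolding Y_orthogonal[OF \<open>k \<noteq> k' \<or> l' \<noteq> - l\<close>] if_not_P[OF False] by simp
        qed
      qed
      also have "\<dots> = (if (k', - l') \<in> A \<mu> then sphere_integral (\<lambda>m. f m * Y k' l' m) else 0)"
        by (simp add: sum.delta[OF fin])
      also have "\<dots> = sphere_integral (\<lambda>m. f m * Y k' l' m)"
      proof (cases "(k', - l') \<in> A \<mu>")
        case False
        then have "k' = 0 \<or> of_real (eig \<alpha> k') \<noteq> \<mu>" using l' by (auto simp: A_def)
        then have "sphere_integral (\<lambda>m. f m * Y k' l' m) = 0"
          using zero[OF l'] sphere_integral_mult_Y_0[OF f] l' by auto
        with False show ?thesis by simp
      qed simp
      finally have "sphere_integral (\<lambda>m. f m * Y k' l' m)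
          - sphere_integral (\<lambda>m. (\<Sum>(k, l) \<in> A \<mu>. c k l * Y k l m) * Y k' l' m) = 0"
        unfolding comb by simp
      then show "sphere_integral (\<lambda>m. (f m - (\<Sum>(k, l) \<in> A \<mu>. c k l * Y k l m)) * Y k' l' m) = 0"
        unfolding left_diff_distrib
        by (subst sphere_integral_diff)
           (simp_all add: L2_mult_smooth_integrable fL smooth_Y smooth_integrable smooth_mult smooth_comb)
    qed
    then have "ae_eq f (\<lambda>m. \<Sum>(k, l) \<in> A \<mu>. c k l * Y k l m)"
      by (simp add: ae_eq_def)
    then show "\<exists>c. ae_eq f (\<lambda>m. \<Sum>(k, l) \<in> A \<mu>. c k l * Y k l m)" by blast
  }
  assume "\<exists>c. ae_eq f (\<lambda>m. \<Sum>(k, l) \<in> A \<mu>. c k l * Y k l m)"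
  then obtain c where c: "ae_eq f (\<lambda>m. \<Sum>(k, l) \<in> A \<mu>. c k l * Y k l m)" by blast
  show "ae_eq (G \<alpha> h0 f) (\<lambda>m. \<mu> * f m)"
    unfolding G_eigen_iff_coefficients[OF f]
  proof (intro allI impI)
    fix k' l' assume "\<bar>l'\<bar> \<le> int k'" and ne: "complex_of_real (eig \<alpha> k') \<noteq> \<mu>"
    have "sphere_integral (\<lambda>m. f m * Y k' l' m) = sphere_integral (\<lambda>m. (\<Sum>(k, l) \<in> A \<mu>. c k l * Y k l m) * Y k' l' m)"
    proof (rule sphere_integral_cong_AE)
      show "ae_eq (\<lambda>m. f m * Y k' l' m) (\<lambda>m. (\<Sum>(k, l) \<in> A \<mu>. c k l * Y k l m) * Y k' l' m)"
        using c unfolding ae_eq_def by eventually_elim simp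
    qed (intro borel_measurable_integrable L2_mult_smooth_integrable fL smooth_L2_sphere smooth_comb smooth_Y)+
    also have "\<dots> = 0"
      unfolding comb
    proof (intro sum.neutral ballI, clarify)
      fix k l assume "(k, l) \<in> A \<mu>"
      then have "k \<noteq> k'" using ne by (auto simp: A_def)
      then show "c k l * sphere_integral (\<lambda>m. Y k l m * Y k' l' m) = 0" by (simp add: Y_orthogonal)
    qed
    finally show "sphere_integral (\<lambda>m. f m * Y k' l' m) = 0" .
  qed
qed

lemma eigenvalue_G_iff:
  "eigenvalue (G \<alpha> h0) domG \<mu> \<longleftrightarrow> (\<exists>k\<ge>1. \<mu> = of_real (eig \<alpha> k))"
proof
  assume "eigenvalue (G \<alpha> h0) domG \<mu>"
  then obtain f where f: "f \<in> domG" "\<not> ae_eq f (\<lambda>m. 0)" "ae_eq (G \<alpha> h0 f) (\<lambda>m. \<mu> * f m)"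
    by (auto simp: eigenvalue_def eigenfunction_def)
  then obtain c where c: "ae_eq f (\<lambda>m. \<Sum>(k, l) \<in> {(k, l). k \<ge> 1 \<and> \<bar>l\<bar> \<le> int k \<and> complex_of_real (eig \<alpha> k) = \<mu>}. c k l * Y k l m)"
    unfolding G_eigenspace[OF f(1)] by blast
  show "\<exists>k\<ge>1. \<mu> = of_real (eig \<alpha> k)"
  proof (rule ccontr)
    assume "\<not> ?thesis"
    then have empty: "{(k, l). k \<ge> 1 \<and> \<bar>l\<bar> \<le> int k \<and> complex_of_real (eig \<alpha> k) = \<mu>} = {}" by auto
    from c f(2) show False unfolding empty by simp
  qed
next
  assume "\<exists>k\<ge>1. \<mu> = of_real (eig \<alpha> k)"
  then obtain k where "k \<ge> 1" "\<mu> = of_real (eig \<alpha> k)" by blast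
  then show "eigenvalue (G \<alpha> h0) domG \<mu>"
    using Y_eigenfunction[of k 0 \<alpha>] by (auto simp: eigenvalue_def)
qed

theorem proposition4p1:
  fixes \<alpha> :: real
  assumes "\<alpha> > 0"
  shows
    "(\<forall>f \<in> domG. has_weak_laplacian (\<lambda>m. f m + of_real (1 / (4 * pi)) * U \<alpha> f m) (G \<alpha> h0 f)) \<and>
     {\<mu>. eigenvalue (G \<alpha> h0) domG \<mu>} =
       {complex_of_real (- (real k * (real k + 1))) | k. k \<ge> 1 \<and> k \<noteq> 2}
       \<union> {complex_of_real (- 6 + 4 * \<alpha> / 5)} \<and>
     (\<forall>k l. k \<ge> 1 \<and> k \<noteq> 2 \<and> \<bar>l\<bar> \<le> int k \<longrightarrow>
        eigenfunction (G \<alpha> h0) domG (complex_of_real (- (real k * (real k + 1)))) (Y k l)) \<and>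
     (\<forall>l. \<bar>l\<bar> \<le> 2 \<longrightarrow>
        eigenfunction (G \<alpha> h0) domG (complex_of_real (- 6 + 4 * \<alpha> / 5)) (Y 2 l)) \<and>
     (\<forall>\<mu>. \<forall>f \<in> domG.
        ae_eq (G \<alpha> h0 f) (\<lambda>m. \<mu> * f m) \<longleftrightarrow>
        (\<exists>c :: nat \<Rightarrow> int \<Rightarrow> complex.
           ae_eq f (\<lambda>m. \<Sum>(k, l) \<in> {(k, l). k \<ge> 1 \<and> \<bar>l\<bar> \<le> int k \<and>
                                            complex_of_real (eig \<alpha> k) = \<mu>}.
                          c k l * Y k l m))) \<and>
     ((\<exists>\<mu>::real. \<mu> > 0 \<and> eigenvalue (G \<alpha> h0) domG (complex_of_real \<mu>)) \<longleftrightarrow> \<alpha> > 7.5)"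
proof (intro conjI)
  have eig_2: "eig \<alpha> 2 = - 6 + 4 * \<alpha> / 5"
    and eig_other: "\<And>k. k \<noteq> 2 \<Longrightarrow> eig \<alpha> k = - (real k * (real k + 1))"
    by (simp_all add: eig_def)
  show "\<forall>f \<in> domG. has_weak_laplacian (\<lambda>m. f m + of_real (1 / (4 * pi)) * U \<alpha> f m) (G \<alpha> h0 f)"
    using G_has_weak_laplacian by blast
  have "(\<exists>k\<ge>1. \<mu> = complex_of_real (eig \<alpha> k)) \<longleftrightarrow>
      (\<exists>k. \<mu> = complex_of_real (- (real k * (real k + 1))) \<and> k \<ge> 1 \<and> k \<noteq> 2) \<or> \<mu> = complex_of_real (- 6 + 4 * \<alpha> / 5)" for \<mu>
    using eig_2 eig_other by (metis one_le_numeral)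
  then show "{\<mu>. eigenvalue (G \<alpha> h0) domG \<mu>} =
       {complex_of_real (- (real k * (real k + 1))) | k. k \<ge> 1 \<and> k \<noteq> 2}
       \<union> {complex_of_real (- 6 + 4 * \<alpha> / 5)}"
    unfolding eigenvalue_G_iff by blast
  show "\<forall>k l. k \<ge> 1 \<and> k \<noteq> 2 \<and> \<bar>l\<bar> \<le> int k \<longrightarrow>
        eigenfunction (G \<alpha> h0) domG (complex_of_real (- (real k * (real k + 1)))) (Y k l)"
    using Y_eigenfunction eig_other by metis
  show "\<forall>l. \<bar>l\<bar> \<le> 2 \<longrightarrow> eigenfunction (G \<alpha> h0) domG (complex_of_real (- 6 + 4 * \<alpha> / 5)) (Y 2 l)"
    using Y_eigenfunction[of 2 _ \<alpha>] eig_2 by simp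
  show "\<forall>\<mu>. \<forall>f \<in> domG.
        ae_eq (G \<alpha> h0 f) (\<lambda>m. \<mu> * f m) \<longleftrightarrow>
        (\<exists>c :: nat \<Rightarrow> int \<Rightarrow> complex.
           ae_eq f (\<lambda>m. \<Sum>(k, l) \<in> {(k, l). k \<ge> 1 \<and> \<bar>l\<bar> \<le> int k \<and>
                                            complex_of_real (eig \<alpha> k) = \<mu>}.
                          c k l * Y k l m))"
    using G_eigenspace by blast
  have "(\<exists>\<mu>::real. \<mu> > 0 \<and> eigenvalue (G \<alpha> h0) domG (complex_of_real \<mu>)) \<longleftrightarrow> (\<exists>k\<ge>1. eig \<alpha> k > 0)"
    unfolding eigenvalue_G_iff by auto
  also have "\<dots> \<longleftrightarrow> eig \<alpha> 2 > 0"
  proof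
    assume "\<exists>k\<ge>1. eig \<alpha> k > 0"
    then obtain k where k: "eig \<alpha> k > 0" by blast
    have "- (real k * (real k + 1)) \<le> 0" by simp
    with k eig_other[of k] show "eig \<alpha> 2 > 0" by (cases "k = 2") auto
  qed (use one_le_numeral in blast)
  also have "\<dots> \<longleftrightarrow> \<alpha> > 7.5" unfolding eig_2 by (simp add: field_simps)
  finally show "(\<exists>\<mu>::real. \<mu> > 0 \<and> eigenvalue (G \<alpha> h0) domG (complex_of_real \<mu>)) \<longleftrightarrow> \<alpha> > 7.5" .
qed

end
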